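(* Let $0\leq \gamma \leq 1\leq \beta <d$ be fixed. Then for all $\tilde \gamma, \alpha, \tilde \beta$ satisfying $$0\leq\tilde \gamma \leq\gamma,\quad \tilde \beta \geq 0,\quad \beta -2 < \tilde \beta \leq \beta,\quad 0 < \alpha <1,\quad \beta -\tilde \beta -1< \alpha < d-\tilde\beta,$$ there exists a positive constant $\delta=\delta_{\gamma,\tilde \gamma,\alpha,\beta,\tilde \beta,d}$ (depending only on the indicated parameters) such that for all $u_0 \in L^\infty(|x|^\gamma\mathrm{d}x) \cap L^\infty(|x|^\beta\mathrm{d}x)$ with $\mathrm{div}(u_0) = 0$ satisfying $$\sup_{x \in \mathbb R^d,\, t>0}\Big(|x|^{\tilde \gamma}t^{\frac{1}{2}(\gamma- \tilde \gamma)} + |x|^\alpha t^{\frac{1}{2}(1- \alpha)}+|x|^{\tilde\beta} t^{\frac{1}{2}(\beta- \tilde \beta)}\Big)|(e^{t\Delta}u_0)(x)|\leq \delta,$$ the Navier-Stokes equations have a global mild solution $u$ on $(0,\infty) \times \mathbb R^d$ with initial datum $u_0$ such that $$\sup_{x \in \mathbb R^d,\, t>0}\big(|x|^{\gamma}+t^{\frac{\gamma}{2}} +|x|^\beta +t^{\frac{\beta}{2}}\big)|u(x,t)| <+\infty.$$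
   Context: $d\ge 2$ is the space dimension; $u_0$ and $u(\cdot,t)$ are vector fields on $\mathbb R^d$ with $d$ components. For $\beta\ge 0$, $L^\infty(|x|^\beta\mathrm{d}x)$ denotes the space of measurable functions $u$ on $\mathbb R^d$ (scalar- or vector-valued) with $\|u\|_{L^\infty(|x|^\beta\mathrm{d}x)} := \operatorname{ess\,sup}_{x\in\mathbb R^d}|x|^\beta|u(x)|<+\infty$ (with $|x|^0=1$). The heat semigroup is $e^{t\Delta}u(x)=\int_{\mathbb R^d}(4\pi t)^{-d/2}e^{-|x-y|^2/(4t)}u(y)\,\mathrm{d}y$, acting componentwise. The Navier-Stokes equations are $\partial_t u=\Delta u-\nabla\cdot(u\otimes u)-\nabla p$, $\nabla\cdot u=0$, $u(0,x)=u_0$. A mild solution on $[0,T]$ (global if $T=\infty$) with divergence-free initial datum $u_0$ is a $u$ solving the integral equation $$u(t)=e^{t\Delta}u_0-\int_0^t e^{(t-\tau)\Delta}\mathbb P\nabla\cdot\big(u(\tau,\cdot)\otimes u(\tau,\cdot)\big)\,\mathrm{d}\tau .$$ Here $(u\otimes v)_{ij}=u_iv_j$, $(\nabla\cdot F)_i=\sum_{j=1}^d\partial_jF_{ij}$ for a tensor $F=(F_{ij})$, and $\mathbb P$ is the Helmholtz-Leray projection $(\mathbb Pf)_j=f_j+\sum_{k=1}^dR_jR_kf_k$, with Riesz transforms $\widehat{R_jg}(\xi)=\frac{i\xi_j}{|\xi|}\hat g(\xi)$. The operator $e^{t\Delta}\mathbb P\nabla\cdot$ acts by convolution with its (integrable,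 for $t>0$) kernel, whose Fourier symbol is given by $(e^{t\Delta}\mathbb P\nabla\cdot F)^{\wedge}_j(\xi)=\sum_{k,l}e^{-t|\xi|^2}\big(\delta_{jk}-\tfrac{\xi_j\xi_k}{|\xi|^2}\big)i\xi_l\hat F_{kl}(\xi)$. *)

theory Defs
  imports "HOL-Probability.Probability"
begin

text \<open>
  Space is \<^typ>\<open>real^'n\<close>, so the dimension is \<^term>\<open>CARD('n)\<close>; "measurable" means
  Lebesgue measurable. A space-time field is a curried function of (time, position).
\<close>

text \<open>\<^term>\<open>r powr b\<close> with the convention that the zeroth power is 1 also for
  \<^prop>\<open>r = 0\<close> (whereas \<^term>\<open>0 powr 0 = (0::real)\<close>).\<close>

definition wpow :: "real \<Rightarrow> real \<Rightarrow> real" where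
  "wpow r b = (if b = 0 then 1 else r powr b)"

definition weighted_Linf :: "real \<Rightarrow> (real^'n \<Rightarrow> real^'n) set" where
  "weighted_Linf \<beta> =
    {u \<in> borel_measurable lebesgue.
       esssup lebesgue (\<lambda>x. ereal (wpow (norm x) \<beta> * norm (u x))) < \<infinity>}"

definition partial_deriv :: "'n \<Rightarrow> (real^'n \<Rightarrow> real) \<Rightarrow> real^'n \<Rightarrow> real" where
  "partial_deriv i f x = frechet_derivative f (at x) (axis i 1)"

primrec times_differentiable :: "nat \<Rightarrow> (real^'n \<Rightarrow> real) \<Rightarrow> bool" where
  "times_differentiable 0 f \<longleftrightarrow> continuous_on UNIV f"
| "times_differentiable (Suc k) f \<longleftrightarrow>
     f differentiable_on UNIV \<and> (\<forall>i. times_differentiable k (partial_deriv i f))"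

definition test_function :: "(real^'n \<Rightarrow> real) \<Rightarrow> bool" where
  "test_function \<phi> \<longleftrightarrow> (\<forall>k. times_differentiable k \<phi>) \<and> compact (closure {x. \<phi> x \<noteq> 0})"

text \<open>Vanishing divergence in the sense of distributions, for locally integrable fields.\<close>

definition divergence_free :: "(real^'n \<Rightarrow> real^'n) \<Rightarrow> bool" where
  "divergence_free u \<longleftrightarrow>
    (\<forall>\<phi>. test_function \<phi> \<longrightarrow>
       integral\<^sup>L lebesgue (\<lambda>x. \<Sum>i\<in>UNIV. u x $ i * partial_deriv i \<phi> x) = 0)"

definition heat_kernel :: "real \<Rightarrow> real^'n \<Rightarrow> real" where
  "heat_kernel t x =
    (4 * pi * t) powr (- real CARD('n) / 2) * exp (- (norm x)\<^sup>2 / (4 * t))"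

definition heat :: "real \<Rightarrow> (real^'n \<Rightarrow> real^'n) \<Rightarrow> real^'n \<Rightarrow> real^'n" where
  "heat t u x = integral\<^sup>L lebesgue (\<lambda>y. heat_kernel t (x - y) *\<^sub>R u y)"

text \<open>
  The Fourier symbol of the operator taking a tensor field \<open>F\<close> to
  \<open>exp(t\<Delta>) P div F\<close>, where \<open>P\<close> is the Helmholtz-Leray projection:
  the \<open>j\<close>-th component of the image has Fourier transform
  \<open>\<Sum>k l. oseen_symbol t j k l \<xi> * (Fourier transform of F_kl)(\<xi>)\<close>.
  The value at \<open>\<xi> = 0\<close>, where the quotient is 0 by totalisation, is immaterial.
\<close>

definition oseen_symbol :: "real \<Rightarrow> 'n \<Rightarrow> 'n \<Rightarrow> 'n \<Rightarrow> real^'n \<Rightarrow> complex" where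
  "oseen_symbol t j k l \<xi> =
    complex_of_real (exp (- t * (norm \<xi>)\<^sup>2) *
      ((if j = k then 1 else 0) - \<xi> $ j * \<xi> $ k / (norm \<xi>)\<^sup>2)) * (\<i> * complex_of_real (\<xi> $ l))"

text \<open>
  The convolution kernel is the inverse Fourier transform of this symbol, which is integrable for
  \<open>t > 0\<close>. The normalisation is the one in which differentiation in direction \<open>l\<close>
  has symbol \<open>\<i> \<xi>_l\<close>, i.e. the forward transform integrates against
  \<open>exp(-\<i> x \<bullet> \<xi>)\<close>. The symbol is odd and purely imaginary, so the inverse
  transform is real-valued and taking \<^const>\<open>Re\<close> only changes the type.
\<close>

definition oseen_kernel :: "real \<Rightarrow> 'n \<Rightarrow> 'n \<Rightarrow> 'n \<Rightarrow> real^'n \<Rightarrow> real" where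
  "oseen_kernel t j k l x =
    Re (integral\<^sup>L lebesgue (\<lambda>\<xi>. cis (x \<bullet> \<xi>) * oseen_symbol t j k l \<xi>)) / (2 * pi) ^ CARD('n)"

definition tensor :: "real^'n \<Rightarrow> real^'n \<Rightarrow> real^'n^'n" where
  "tensor u v = (\<chi> i j. u $ i * v $ j)"

definition oseen :: "real \<Rightarrow> (real^'n \<Rightarrow> real^'n^'n) \<Rightarrow> real^'n \<Rightarrow> real^'n" where
  "oseen t F x =
    (\<chi> j. \<Sum>k\<in>UNIV. \<Sum>l\<in>UNIV.
       integral\<^sup>L lebesgue (\<lambda>y. oseen_kernel t j k l (x - y) * F y $ k $ l))"

definition oseen_converges :: "real \<Rightarrow> (real^'n \<Rightarrow> real^'n^'n) \<Rightarrow> real^'n \<Rightarrow> bool" where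
  "oseen_converges t F x \<longleftrightarrow>
    (\<forall>j k l. integrable lebesgue (\<lambda>y. oseen_kernel t j k l (x - y) * F y $ k $ l))"

text \<open>
  The integral equation is an identity between functions of \<open>x\<close> modulo null sets, for every
  \<open>t > 0\<close>. Absolute convergence of all integrals is demanded explicitly because
  \<^const>\<open>lebesgue_integral\<close> is 0 on non-integrable functions.
\<close>

definition global_mild_solution ::
    "(real^'n \<Rightarrow> real^'n) \<Rightarrow> (real \<Rightarrow> real^'n \<Rightarrow> real^'n) \<Rightarrow> bool" where
  "global_mild_solution u0 u \<longleftrightarrow>
    (\<lambda>(t, x). u t x) \<in> borel_measurable (lebesgue_on ({0<..} \<times> UNIV)) \<and>
    (\<forall>t>0. AE x in lebesgue.
       integrable lebesgue (\<lambda>y. heat_kernel t (x - y) *\<^sub>R u0 y) \<and>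
       (AE \<tau> in lebesgue. \<tau> \<in> {0<..<t} \<longrightarrow>
          oseen_converges (t - \<tau>) (\<lambda>y. tensor (u \<tau> y) (u \<tau> y)) x) \<and>
       set_integrable lebesgue {0<..<t} (\<lambda>\<tau>. oseen (t - \<tau>) (\<lambda>y. tensor (u \<tau> y) (u \<tau> y)) x) \<and>
       u t x = heat t u0 x -
         (LINT \<tau>:{0<..<t}|lebesgue. oseen (t - \<tau>) (\<lambda>y. tensor (u \<tau> y) (u \<tau> y)) x))"

end

theory Submission
  imports Defs
begin

text \<open>
  The Oseen kernel is dominated by \<open>(|x| + \<surd>t)\<close> to the power \<open>-(d+1)\<close>: write
  \<open>exp(-t|\<xi>|\<^sup>2) / |\<xi>|\<^sup>2\<close> as the integral of \<open>exp(-s|\<xi>|\<^sup>2)\<close> over \<open>s \<ge> t\<close>, so that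
  its inverse Fourier transform is a superposition of third derivatives of Gaussians. With this majorant the
  bilinear Duhamel term maps \<open>p * p\<close> to \<open>p\<close> and \<open>p * q\<close> to \<open>q\<close>, where
  \<open>p = |x| powr -\<alpha> * t powr (-(1-\<alpha>)/2)\<close> is the scale-invariant
  weight and \<open>q = (|x| + \<surd>t) powr -w\<close> for any \<open>0 \<le> w < d\<close>. Smallness in the weight
  \<open>p\<close> alone makes the Picard iteration contract, and since the Duhamel term is linear in \<open>q\<close> with
  a small factor, the iterates stay bounded by every \<open>q\<close> that bounds the heat flow, in particular for
  \<open>w = \<gamma>\<close> and \<open>w = \<beta>\<close>.
\<close>

section \<open>Spatial integrals of power weights\<close>

text \<open>The exponents are tight in the estimate for \<open>p * q\<close>. Convolving the kernel
  majorant with \<open>|y| powr -a\<close> requires a < d, whereas near the origin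
  \<open>p * q\<close> is dominated in space alone only by \<open>|y| powr -(\<alpha> + w)\<close>,
  and \<alpha> + w may reach d. The remedy is to give up \<kappa> = min \<alpha> w powers of |y| in
  exchange for powers of the square root of time: the exponent left is a = max \<alpha> w < d, and
  the extra singularity at time 0 is still integrable. For \<open>p * p\<close> the condition is 2
  \<alpha> < 2 \<le> d. The weight \<open>p\<close> has parabolic degree -1, which compensates the
  derivative in the Duhamel term. Hence the powers of t left over by the time integrals are exactly
  those of the weights, the constants are uniform in t, and the solution is global. The heat kernel
  is at most sqrt t times the Oseen majorant, so one convolution lemma treats the linear part as
  well. Since integrals of non-integrable functions are 0 by convention, each bound is first proved
  for a nonnegative majorant in \<open>ennreal\<close>, whose finiteness then yields
  integrability.\<close>

lemma nn_integral_le_ball_series: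
  fixes f :: "'a::euclidean_space \<Rightarrow> ennreal"
  assumes f: "\<And>y. f y \<le> (\<Sum>k. ennreal (c k) * indicator (ball 0 (\<rho> k)) y)"
    and c: "\<And>k. 0 \<le> c k" and \<rho>: "\<And>k. 0 < \<rho> k"
    and s: "\<And>k. c k * \<rho> k powr real DIM('a) = A * q ^ k" and A: "0 \<le> A" "0 \<le> q" "q < 1"
  shows "(\<integral>\<^sup>+y. f y \<partial>lborel) \<le> ennreal (unit_ball_vol (real DIM('a)) * A / (1 - q))"
proof -
  let ?V = "unit_ball_vol (real DIM('a))"
  have "(\<integral>\<^sup>+y. f y \<partial>lborel) \<le> (\<integral>\<^sup>+y. (\<Sum>k. ennreal (c k) * indicator (ball 0 (\<rho> k)) (y::'a)) \<partial>lborel)"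
    by (intro nn_integral_mono f)
  also have "\<dots> = (\<Sum>k. \<integral>\<^sup>+y. ennreal (c k) * indicator (ball 0 (\<rho> k)) (y::'a) \<partial>lborel)"
    by (rule nn_integral_suminf) (auto intro!: borel_measurable_times_ennreal borel_measurable_indicator)
  also have "\<dots> = (\<Sum>k. ennreal (?V * A * q ^ k))"
  proof (rule suminf_cong)
    fix k
    have "(\<integral>\<^sup>+y. ennreal (c k) * indicator (ball 0 (\<rho> k)) (y::'a) \<partial>lborel)
        = ennreal (c k) * ennreal (?V * \<rho> k ^ DIM('a))"
      using \<rho>[of k] by (subst nn_integral_cmult_indicator) (auto simp: emeasure_ball)
    also have "\<dots> = ennreal (?V * (c k * \<rho> k powr real DIM('a)))"
      using \<rho>[of k] c[of k] by (simp add: powr_realpow ennreal_mult[symmetric] ac_simps)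
    finally show "(\<integral>\<^sup>+y. ennreal (c k) * indicator (ball 0 (\<rho> k)) (y::'a) \<partial>lborel)
        = ennreal (?V * A * q ^ k)" by (simp only: s mult.assoc)
  qed
  also have "\<dots> = ennreal (\<Sum>k. ?V * A * q ^ k)"
    using A by (intro suminf_ennreal2) (auto intro!: summable_mult summable_geometric)
  also have "(\<Sum>k. ?V * A * q ^ k) = ?V * A / (1 - q)"
    using A by (subst suminf_mult) (auto simp: suminf_geometric summable_geometric)
  finally show ?thesis .
qed

text \<open>Dyadic shells: for \<open>R / 2 ^ Suc k \<le> |y| < R / 2 ^ k\<close> the integrand is
  at most its value at the inner radius, and the resulting masses form a geometric series of ratio
  \<open>2 powr (a - d)\<close>, which is below 1 because a < d. The power of R is forced by
  scaling.\<close>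

lemma nn_integral_norm_powr_ball_le:
  fixes a :: real
  assumes a: "0 \<le> a" "a < real DIM('a::euclidean_space)"
  shows "\<exists>C\<ge>0. \<forall>R>0. (\<integral>\<^sup>+y. ennreal (norm (y::'a) powr - a) * indicator (ball 0 R) y \<partial>lborel)
    \<le> ennreal (C * R powr (real DIM('a) - a))"
proof -
  let ?D = "real DIM('a)"
  define q where "q = (2::real) powr (a - ?D)"
  have q: "0 \<le> q" "q < 1" using a by (auto simp: q_def powr_less_one)
  define C where "C = unit_ball_vol ?D * 2 powr a / (1 - q)"
  have C: "0 \<le> C" using q by (simp add: C_def)
  have "(\<integral>\<^sup>+y. ennreal (norm (y::'a) powr - a) * indicator (ball 0 R) y \<partial>lborel)
    \<le> ennreal (C * R powr (?D - a))" if R: "R > 0" for R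
  proof -
    have "(\<integral>\<^sup>+y. ennreal (norm (y::'a) powr - a) * indicator (ball 0 R) y \<partial>lborel)
      \<le> ennreal (unit_ball_vol ?D * (R powr (?D - a) * 2 powr a) / (1 - q))"
    proof (rule nn_integral_le_ball_series[where c="\<lambda>k. (R / 2 ^ Suc k) powr - a" and \<rho>="\<lambda>k. R / 2 ^ k"])
      fix y :: 'a
      show "ennreal (norm y powr - a) * indicator (ball 0 R) y
        \<le> (\<Sum>k. ennreal ((R / 2 ^ Suc k) powr - a) * indicator (ball 0 (R / 2 ^ k)) y)"
      \<comment> \<open>At y = 0 the left side is 0 because \<open>0 powr - a = 0\<close>, and
        outside the ball the indicator vanishes; every other point lies in a shell.\<close>
      proof (cases "y \<noteq> 0 \<and> norm y < R")
        case True
        have "\<exists>n. R / 2 ^ n \<le> norm y"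
        proof -
          obtain n where "(1/2::real) ^ n < norm y / R"
            using real_arch_pow_inv[of "norm y / R" "1/2"] True R by auto
          then show ?thesis using R by (intro exI[of _ n]) (simp add: field_simps power_one_over)
        qed
        then obtain n where n: "R / 2 ^ n \<le> norm y" "\<And>m. m < n \<Longrightarrow> norm y < R / 2 ^ m"
          using exists_least_iff[of "\<lambda>n. R / 2 ^ n \<le> norm y"] by (auto simp: not_le)
        \<comment> \<open>The least index is positive, since |y| < R excludes 0; its predecessor k
          names the shell.\<close>
        with True obtain k where k: "n = Suc k" by (cases n) auto
        have "ennreal (norm y powr - a) * indicator (ball 0 R) y
            \<le> ennreal ((R / 2 ^ Suc k) powr - a) * indicator (ball 0 (R / 2 ^ k)) y"
          using n(1) n(2)[of k] True R a k
          by (auto simp: indicator_def intro!: ennreal_leI powr_mono2')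
        also have "\<dots> \<le> (\<Sum>k. ennreal ((R / 2 ^ Suc k) powr - a) * indicator (ball 0 (R / 2 ^ k)) y)"
          using sum_le_suminf[of "\<lambda>k. ennreal ((R / 2 ^ Suc k) powr - a) * indicator (ball 0 (R / 2 ^ k)) y" "{k}"]
          by (simp only: sum.insert sum.empty finite.intros add_0_right empty_iff not_False_eq_True summableI if_False) simp
        finally show ?thesis .
      qed (auto simp: indicator_def)
      fix k :: nat
      define s where "s = R / 2 ^ k"
      have s: "s > 0" using R by (simp add: s_def)
      have "(s / 2) powr - a * s powr ?D = 2 powr a * (s powr - a * s powr ?D)"
        using s by (simp add: powr_divide powr_minus_divide)
      also have "s powr - a * s powr ?D = s powr (?D - a)"
        by (simp only: powr_add[symmetric]) simp
      also have "s powr (?D - a) = R powr (?D - a) * q ^ k"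
      proof -
        have "q ^ k = (2 ^ k) powr (a - ?D)"
          by (simp only: q_def powr_realpow[symmetric, of 2] powr_realpow[symmetric, of "2 powr _"] powr_powr mult.commute powr_gt_zero zero_less_numeral)
        also have "\<dots> = 1 / (2 ^ k) powr (?D - a)"
          by (simp add: powr_minus_divide[symmetric])
        finally show ?thesis using R by (simp add: s_def powr_divide)
      qed
      finally show "(R / 2 ^ Suc k) powr - a * (R / 2 ^ k) powr ?D = R powr (?D - a) * 2 powr a * q ^ k"
        by (simp add: s_def mult_ac)
    qed (use R q in auto)
    then show ?thesis by (simp add: C_def field_simps)
  qed
  with C show ?thesis by blast
qed

text \<open>The dyadic device, now outwards: for the first radius \<open>r * 2 ^ k\<close> that
  exceeds |y|, the base |y| + r is at least half that radius. The exponent exceeds the dimension by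
  one, which gives the ratio 1/2 and a single power of 1/r.\<close>

lemma nn_integral_shifted_norm_powr_le:
  "\<exists>C\<ge>0. \<forall>r>0. (\<integral>\<^sup>+y. ennreal ((norm (y::'a::euclidean_space) + r) powr - (real DIM('a) + 1)) \<partial>lborel)
    \<le> ennreal (C / r)"
proof -
  let ?D = "real DIM('a)"
  define C where "C = unit_ball_vol ?D * 2 powr (?D + 1) / (1 - 1/2)"
  have "(\<integral>\<^sup>+y. ennreal ((norm (y::'a) + r) powr - (?D + 1)) \<partial>lborel) \<le> ennreal (C / r)" if r: "r > 0" for r
  proof -
    have "(\<integral>\<^sup>+y. ennreal ((norm (y::'a) + r) powr - (?D + 1)) \<partial>lborel)
      \<le> ennreal (unit_ball_vol ?D * (2 powr (?D + 1) / r) / (1 - 1/2))"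
    proof (rule nn_integral_le_ball_series[where c="\<lambda>k. (r * 2 ^ k / 2) powr - (?D + 1)" and \<rho>="\<lambda>k. r * 2 ^ k"])
      fix y :: 'a
      obtain n0 where "norm y / r < 2 ^ n0" using real_arch_pow[of 2 "norm y / r"] by auto
      then have "norm y < r * 2 ^ n0" using r by (simp add: field_simps)
      then obtain n where n: "norm y < r * 2 ^ n" "\<And>m. m < n \<Longrightarrow> r * 2 ^ m \<le> norm y"
        using exists_least_iff[of "\<lambda>n. norm y < r * 2 ^ n"] by (auto simp: not_less)
      have "r * 2 ^ n / 2 \<le> norm y + r"
      proof (cases n)
        case (Suc k) then show ?thesis using n(2)[of k] r by simp
      qed (use r in \<open>simp add: field_simps add_increasing\<close>)
      then have "ennreal ((norm y + r) powr - (?D + 1))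
          \<le> ennreal ((r * 2 ^ n / 2) powr - (?D + 1)) * indicator (ball 0 (r * 2 ^ n)) y"
        using n(1) r by (auto simp: indicator_def intro!: ennreal_leI powr_mono2')
      also have "\<dots> \<le> (\<Sum>k. ennreal ((r * 2 ^ k / 2) powr - (?D + 1)) * indicator (ball 0 (r * 2 ^ k)) y)"
        using sum_le_suminf[of "\<lambda>k. ennreal ((r * 2 ^ k / 2) powr - (?D + 1)) * indicator (ball 0 (r * 2 ^ k)) y" "{n}"]
        by (simp only: sum.insert sum.empty finite.intros add_0_right empty_iff not_False_eq_True summableI if_False) simp
      finally show "ennreal ((norm y + r) powr - (?D + 1))
          \<le> (\<Sum>k. ennreal ((r * 2 ^ k / 2) powr - (?D + 1)) * indicator (ball 0 (r * 2 ^ k)) y)" .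
      fix k :: nat
      show "(r * 2 ^ k / 2) powr - (?D + 1) * (r * 2 ^ k) powr ?D = 2 powr (?D + 1) / r * (1/2) ^ k"
      proof -
        define s where "s = r * 2 ^ k"
        have s: "s > 0" using r by (simp add: s_def)
        have "(s / 2) powr - (?D + 1) * s powr ?D = 2 powr (?D + 1) * (s powr - (?D + 1) * s powr ?D)"
          using s powr_divide[of s 2 "- (?D + 1)"] by (simp only: powr_minus[of 2]) (simp add: field_simps)
        also have "s powr - (?D + 1) * s powr ?D = s powr (- 1)"
          by (simp only: powr_add[symmetric]) simp
        also have "s powr (- 1) = 1 / r * (1 / 2) ^ k"
          using s r by (simp add: powr_minus_divide s_def power_one_over)
        finally show ?thesis by (simp add: s_def)
      qed
    qed (use r in auto)
    then show ?thesis by (simp add: C_def field_simps)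
  qed
  moreover have "0 \<le> C" by (simp add: C_def)
  ultimately show ?thesis by blast
qed

text \<open>Split at |y| = \<rho>/4 with \<rho> = |x| + r. Inside, the triangle inequality keeps the
  base of the kernel above 3\<rho>/4, so the kernel leaves the integral and the ball estimate
  applies to the weight. Outside, the weight is at most \<open>(\<rho> / 4) powr - a\<close>, and
  the kernel has mass of order 1/r.\<close>

lemma nn_integral_shifted_norm_powr_conv_le:
  fixes a :: real
  assumes a: "0 \<le> a" "a < real DIM('a::euclidean_space)"
  shows "\<exists>C\<ge>0. \<forall>r>0. \<forall>x. (\<integral>\<^sup>+y. ennreal ((norm (x - y) + r) powr - (real DIM('a) + 1) * norm (y::'a) powr - a) \<partial>lborel)
    \<le> ennreal (C / r * (norm x + r) powr - a)"
proof -
  let ?D = "real DIM('a)"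
  obtain C1 where C1: "0 \<le> C1" "\<And>R. R > 0 \<Longrightarrow>
      (\<integral>\<^sup>+y. ennreal (norm (y::'a) powr - a) * indicator (ball 0 R) y \<partial>lborel) \<le> ennreal (C1 * R powr (?D - a))"
    using nn_integral_norm_powr_ball_le[OF a] by blast
  obtain C2 where C2: "0 \<le> C2" "\<And>r. r > 0 \<Longrightarrow>
      (\<integral>\<^sup>+y. ennreal ((norm (y::'a) + r) powr - (?D + 1)) \<partial>lborel) \<le> ennreal (C2 / r)"
    using nn_integral_shifted_norm_powr_le by blast
  define c where "c = (3/4::real) powr - (?D + 1) * (1/4) powr (?D - a) * C1"
  define C where "C = (1/4) powr - a * C2 + c"
  have c: "0 \<le> c" and C: "0 \<le> C" using C1 C2 by (auto simp: c_def C_def)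
  have "(\<integral>\<^sup>+y. ennreal ((norm (x - y) + r) powr - (?D + 1) * norm (y::'a) powr - a) \<partial>lborel)
    \<le> ennreal (C / r * (norm x + r) powr - a)" if r: "r > 0" for r and x :: 'a
  proof -
    define \<rho> where "\<rho> = norm x + r"
    have \<rho>: "\<rho> > 0" "r \<le> \<rho>" using r by (auto simp: \<rho>_def add_nonneg_pos)
    have pt: "(norm (x - y) + r) powr - (?D + 1) * norm y powr - a
       \<le> (\<rho> / 4) powr - a * (norm (y - x) + r) powr - (?D + 1)
          + (3/4 * \<rho>) powr - (?D + 1) * (norm y powr - a * indicator (ball 0 (\<rho> / 4)) y)" for y :: 'a
    proof (cases "norm y < \<rho> / 4")
      case True
      have "norm x \<le> norm (x - y) + norm y" using norm_triangle_ineq[of "x - y" y] by simp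
      then have "3/4 * \<rho> \<le> norm (x - y) + r" using True r by (simp add: \<rho>_def)
      then have "(norm (x - y) + r) powr - (?D + 1) \<le> (3/4 * \<rho>) powr - (?D + 1)"
        using \<rho> by (intro powr_mono2') auto
      then have "(norm (x - y) + r) powr - (?D + 1) * norm y powr - a \<le> (3/4 * \<rho>) powr - (?D + 1) * norm y powr - a"
        by (intro mult_right_mono) auto
      moreover have "0 \<le> (\<rho> / 4) powr - a * (norm (y - x) + r) powr - (?D + 1)" by simp
      ultimately show ?thesis using True by (simp only: indicator_simps mem_ball dist_0_norm)
    next
      case False
      then have "norm y powr - a \<le> (\<rho> / 4) powr - a" using \<rho> a by (intro powr_mono2') auto
      then have "(norm (x - y) + r) powr - (?D + 1) * norm y powr - a
          \<le> (norm (x - y) + r) powr - (?D + 1) * (\<rho> / 4) powr - a"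
        by (intro mult_left_mono) auto
      then show ?thesis using False by (simp add: norm_minus_commute mult.commute)
    qed
    have m1: "(\<lambda>y. ennreal ((norm (y - x) + r) powr - (?D + 1))) \<in> borel_measurable lborel"
      by simp
    have "(\<lambda>y::'a. ennreal (norm y powr - a)) \<in> borel_measurable lborel"
      by simp
    then have m2: "(\<lambda>y::'a. ennreal (norm y powr - a) * indicator (ball 0 (\<rho> / 4)) y) \<in> borel_measurable lborel"
      by (rule borel_measurable_times_ennreal) (auto intro: borel_measurable_indicator)
    have "(\<integral>\<^sup>+y. ennreal ((norm (x - y) + r) powr - (?D + 1) * norm (y::'a) powr - a) \<partial>lborel)
      \<le> (\<integral>\<^sup>+y. ennreal ((\<rho> / 4) powr - a) * ennreal ((norm (y - x) + r) powr - (?D + 1))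
          + ennreal ((3/4 * \<rho>) powr - (?D + 1)) * (ennreal (norm y powr - a) * indicator (ball 0 (\<rho> / 4)) y) \<partial>lborel)"
    proof (intro nn_integral_mono)
      fix y :: 'a
      show "ennreal ((norm (x - y) + r) powr - (?D + 1) * norm (y::'a) powr - a)
       \<le> ennreal ((\<rho> / 4) powr - a) * ennreal ((norm (y - x) + r) powr - (?D + 1))
          + ennreal ((3/4 * \<rho>) powr - (?D + 1)) * (ennreal (norm y powr - a) * indicator (ball 0 (\<rho> / 4)) y)"
      proof -
        have eq: "ennreal (A * B + D * (E * indicator S y)) = ennreal A * ennreal B + ennreal D * (ennreal E * indicator S y)"
          if "0 \<le> A" "0 \<le> B" "0 \<le> D" "0 \<le> E" for A B D E :: real and S :: "'a set"
          using that by (simp add: indicator_def ennreal_mult ennreal_plus)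
        show ?thesis
          by (rule order_trans[OF ennreal_leI[OF pt[of y]]], subst eq) simp_all
      qed
    qed
    also have "\<dots> = ennreal ((\<rho> / 4) powr - a) * (\<integral>\<^sup>+y. ennreal ((norm (y - x) + r) powr - (?D + 1)) \<partial>lborel)
        + ennreal ((3/4 * \<rho>) powr - (?D + 1)) * (\<integral>\<^sup>+y. ennreal (norm y powr - a) * indicator (ball 0 (\<rho> / 4)) (y::'a) \<partial>lborel)"
      by (simp only: nn_integral_add nn_integral_cmult m1 m2 borel_measurable_times_ennreal borel_measurable_const)
    also have "(\<integral>\<^sup>+y. ennreal ((norm (y - x) + r) powr - (?D + 1)) \<partial>lborel) = (\<integral>\<^sup>+y. ennreal ((norm (y::'a) + r) powr - (?D + 1)) \<partial>lborel)"
      by (subst lborel_distr_plus[symmetric, of "- x"]) (simp add: nn_integral_distr)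
    also have "ennreal ((\<rho> / 4) powr - a) * \<dots> \<le> ennreal ((\<rho> / 4) powr - a) * ennreal (C2 / r)"
      by (intro mult_left_mono C2 r) auto
    also have "ennreal ((3/4 * \<rho>) powr - (?D + 1)) * (\<integral>\<^sup>+y. ennreal (norm y powr - a) * indicator (ball 0 (\<rho> / 4)) (y::'a) \<partial>lborel)
      \<le> ennreal ((3/4 * \<rho>) powr - (?D + 1)) * ennreal (C1 * (\<rho> / 4) powr (?D - a))"
      using \<rho> by (intro mult_left_mono C1) auto
    also have "ennreal ((\<rho> / 4) powr - a) * ennreal (C2 / r) + ennreal ((3/4 * \<rho>) powr - (?D + 1)) * ennreal (C1 * (\<rho> / 4) powr (?D - a))
       = ennreal ((\<rho> / 4) powr - a * (C2 / r) + (3/4 * \<rho>) powr - (?D + 1) * (C1 * (\<rho> / 4) powr (?D - a)))"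
      using C1(1) C2(1) r
      by (simp only: ennreal_plus ennreal_mult powr_ge_zero mult_nonneg_nonneg divide_nonneg_pos)
    also have "\<dots> \<le> ennreal (C / r * \<rho> powr - a)"
    proof (rule ennreal_leI)
      have e1: "(\<rho> / 4) powr - a * (C2 / r) = (1/4) powr - a * C2 / r * \<rho> powr - a"
        using \<rho> powr_mult[of \<rho> "1/4" "-a"] by simp
      have e2: "(3/4 * \<rho>) powr - (?D + 1) = (3/4) powr - (?D + 1) * \<rho> powr - (?D + 1)"
        using \<rho> by (subst powr_mult) auto
      have e3: "(\<rho> / 4) powr (?D - a) = (1/4) powr (?D - a) * \<rho> powr (?D - a)"
        using \<rho> powr_mult[of \<rho> "1/4" "?D - a"] by simp
      have e4: "\<rho> powr - (?D + 1) * \<rho> powr (?D - a) = \<rho> powr - a / \<rho>"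
        using \<rho> by (simp add: powr_add[symmetric] powr_minus_divide powr_diff powr_minus)
      have "(3/4 * \<rho>) powr - (?D + 1) * (C1 * (\<rho> / 4) powr (?D - a))
         = c * (\<rho> powr - (?D + 1) * \<rho> powr (?D - a))"
        unfolding e2 e3 c_def by (simp only: ac_simps)
      also have "\<dots> = c * (\<rho> powr - a / \<rho>)" by (simp only: e4)
      \<comment> \<open>The inner part even has the better factor 1/\<rho>; r \<le> \<rho> brings it
        to the form of the outer part.\<close>
      also have "\<dots> \<le> c * (\<rho> powr - a / r)"
        using c \<rho> r by (intro mult_left_mono divide_left_mono) auto
      finally have *: "(3/4 * \<rho>) powr - (?D + 1) * (C1 * (\<rho> / 4) powr (?D - a)) \<le> c * (\<rho> powr - a / r)" .
      show "(\<rho> / 4) powr - a * (C2 / r) + (3/4 * \<rho>) powr - (?D + 1) * (C1 * (\<rho> / 4) powr (?D - a))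
         \<le> C / r * \<rho> powr - a"
      proof -
        have "C / r * \<rho> powr - a = (1/4) powr - a * C2 / r * \<rho> powr - a + c * (\<rho> powr - a / r)"
          by (simp add: C_def add_divide_distrib distrib_right)
        then show ?thesis using * unfolding e1 by linarith
      qed
    qed
    finally show ?thesis by (simp add: \<rho>_def add_left_mono add_right_mono)
  qed
  with C show ?thesis by blast
qed

section \<open>Gaussian moments\<close>

text \<open>Since ln (1 + z) \<le> z, the exponent is at most p z - c z^2, and completing the square
  bounds this by the exponent on the right. Every trade of Gaussian decay for power decay goes
  through this inequality.\<close>

lemma powr_times_gaussian_le:
  fixes c p z :: real
  assumes "0 < c" "0 \<le> p" "0 \<le> z"
  shows "(1 + z) powr p * exp (- c * z\<^sup>2) \<le> exp (p\<^sup>2 / (4 * c))"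
proof -
  have "p * ln (1 + z) \<le> p * z"
    using assms by (intro mult_left_mono ln_add_one_self_le_self) auto
  moreover have "p * z - c * z\<^sup>2 \<le> p\<^sup>2 / (4 * c)"
  proof -
    have "0 \<le> (2 * c * z - p)\<^sup>2" by simp
    then have "4 * c * (p * z - c * z\<^sup>2) \<le> p\<^sup>2"
      by (simp add: power2_eq_square algebra_simps)
    then show ?thesis using \<open>0 < c\<close> by (simp add: field_simps)
  qed
  ultimately have "p * ln (1 + z) + - c * z\<^sup>2 \<le> p\<^sup>2 / (4 * c)" by simp
  then show ?thesis using assms by (simp add: powr_def exp_add[symmetric])
qed

lemma integrable_power_gaussian:
  assumes "0 < s"
  shows "integrable lborel (\<lambda>\<xi>::real. \<xi> ^ m * exp (- s * \<xi>\<^sup>2))"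
proof -
  \<comment> \<open>The standard deviation for which the normal density is proportional to exp (- s
    \<xi>^2).\<close>
  define \<sigma> where "\<sigma> = 1 / sqrt (2 * s)"
  have \<sigma>: "0 < \<sigma>" "\<sigma>\<^sup>2 = 1 / (2 * s)" using assms by (auto simp: \<sigma>_def power_divide)
  have "integrable lborel (\<lambda>\<xi>. sqrt (2 * pi * \<sigma>\<^sup>2) * (normal_density 0 \<sigma> \<xi> * (\<xi> - 0) ^ m))"
    using integrable_normal_moment[OF \<sigma>(1), of 0 m] by simp
  also have "(\<lambda>\<xi>. sqrt (2 * pi * \<sigma>\<^sup>2) * (normal_density 0 \<sigma> \<xi> * (\<xi> - 0) ^ m)) = (\<lambda>\<xi>. \<xi> ^ m * exp (- s * \<xi>\<^sup>2))"
    using assms by (auto simp: normal_density_def \<sigma>(2) fun_eq_iff)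
  finally show ?thesis .
qed

text \<open>The one-dimensional inverse Fourier transform, without the factor 1/(2 pi), of a
  monomial times a Gaussian; formally the m-th power of -i d/dx applied to the case m = 0.\<close>

definition gaussian_moment :: "nat \<Rightarrow> real \<Rightarrow> real \<Rightarrow> complex" where
  "gaussian_moment m s x = (\<integral>\<xi>. cis (x * \<xi>) * of_real (\<xi> ^ m * exp (- s * \<xi>\<^sup>2)) \<partial>lborel)"

lemma borel_measurable_cis [measurable]: "cis \<in> borel_measurable borel"
  by (intro borel_measurable_continuous_onI continuous_intros)

lemma integrable_gaussian_moment:
  assumes "0 < s"
  shows "integrable lborel (\<lambda>\<xi>::real. cis (x * \<xi>) * complex_of_real (\<xi> ^ m * exp (- s * \<xi>\<^sup>2)))"
  by (rule Bochner_Integration.integrable_bound[OF integrable_power_gaussian[OF assms, of m]])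
    (auto simp: norm_mult norm_power abs_mult power_abs)

text \<open>This is the characteristic function of the standard normal distribution after a change
  of variable: with c^2 = 1/(2 s), the Gaussian evaluated at c \<xi> is exp (- \<xi>^2 / 2).\<close>

lemma gaussian_moment_0:
  assumes s: "0 < s"
  shows "gaussian_moment 0 s x = of_real (sqrt (pi / s) * exp (- x\<^sup>2 / (4 * s)))"
proof -
  define c where "c = 1 / sqrt (2 * s)"
  have c: "0 < c" "c\<^sup>2 = 1 / (2 * s)" using s by (auto simp: c_def power_divide)
  have "complex_of_real (exp (- (x * c)\<^sup>2 / 2)) = char std_normal_distribution (x * c)"
    by (simp only: char_std_normal_distribution)
  also have "\<dots> = (\<integral>\<xi>. std_normal_density \<xi> *\<^sub>R iexp (x * c * \<xi>) \<partial>lborel)"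
    unfolding char_def by (subst integral_density) auto
  also have "\<dots> = (\<integral>\<xi>. complex_of_real (1 / sqrt (2 * pi)) * (cis (x * (c * \<xi>)) * of_real (exp (- s * (c * \<xi>)\<^sup>2))) \<partial>lborel)"
    using s by (intro Bochner_Integration.integral_cong refl)
      (auto simp: normal_density_def cis_conv_exp scaleR_conv_of_real power_mult_distrib c(2) mult_ac exp_of_real)
  also have "\<dots> = complex_of_real (1 / sqrt (2 * pi)) * (\<integral>\<xi>. cis (x * (c * \<xi>)) * of_real (exp (- s * (c * \<xi>)\<^sup>2)) \<partial>lborel)"
    by (rule integral_mult_right_zero)
  also have "(\<integral>\<xi>. cis (x * (c * \<xi>)) * of_real (exp (- s * (c * \<xi>)\<^sup>2)) \<partial>lborel) = gaussian_moment 0 s x /\<^sub>R c"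
    using lborel_integral_real_affine[of c "\<lambda>\<xi>. cis (x * \<xi>) * complex_of_real (exp (- s * \<xi>\<^sup>2))" 0] c(1)
    by (simp add: gaussian_moment_def)
  finally have "gaussian_moment 0 s x = of_real (exp (- (x * c)\<^sup>2 / 2) * (sqrt (2 * pi) * c))"
    using c(1) by (simp add: scaleR_conv_of_real field_simps)
  moreover have e1: "sqrt (2 * pi) * c = sqrt (pi / s)"
    using s by (simp add: c_def real_sqrt_divide real_sqrt_mult)
  moreover have e2: "- (x * c)\<^sup>2 / 2 = - x\<^sup>2 / (4 * s)" using s by (simp add: power_mult_distrib c(2))
  ultimately show ?thesis by (simp only: e1 e2 mult.commute)
qed

text \<open>Integration by parts: \<open>?g m\<close> vanishes at both ends of the line, so its
  derivative \<open>?f\<close> has integral 0, and that is the recursion. It replaces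
  differentiation in x under the integral sign. For m = 0 the truncated index m - 1 is harmless,
  because its coefficient is 0.\<close>

lemma gaussian_moment_Suc:
  assumes s: "0 < s"
  shows "gaussian_moment (Suc m) s x
    = (of_nat m * gaussian_moment (m - 1) s x + \<i> * x * gaussian_moment m s x) / (2 * s)"
proof -
  let ?g = "\<lambda>m \<xi>. cis (x * \<xi>) * complex_of_real (\<xi> ^ m * exp (- s * \<xi>\<^sup>2))"
  note int_g = integrable_gaussian_moment[OF s, of x]
  let ?f = "\<lambda>\<xi>. of_nat m * ?g (m - 1) \<xi> + \<i> * x * ?g m \<xi> - 2 * s * ?g (Suc m) \<xi>"
  have g_eq: "?g m \<xi> = exp (\<i> * x * of_real \<xi> - s * (of_real \<xi>)\<^sup>2) * of_real \<xi> ^ m" for m \<xi>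
    by (simp add: cis_conv_exp exp_diff exp_minus exp_of_real[symmetric] field_simps)
  have int: "integrable lborel ?f"
    by (intro Bochner_Integration.integrable_add Bochner_Integration.integrable_diff integrable_mult_right int_g)
  \<comment> \<open>The Gaussian absorbs one factor 1 + |\<xi>| more than the monomial requires, and
    this factor supplies the rate.\<close>
  have lim: "(?g m \<longlongrightarrow> 0) F" if F: "F = at_top \<or> F = at_bot" for F
  proof (rule Lim_null_comparison)
    let ?C = "exp ((real (Suc m))\<^sup>2 / (4 * s))"
    have "norm (?g m \<xi>) \<le> ?C / (1 + \<bar>\<xi>\<bar>)" for \<xi>
    proof -
      have "(1 + \<bar>\<xi>\<bar>) * \<bar>\<xi>\<bar> ^ m \<le> (1 + \<bar>\<xi>\<bar>) ^ Suc m"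
        by (simp add: power_mono mult_left_mono)
      then have "(1 + \<bar>\<xi>\<bar>) * (\<bar>\<xi>\<bar> ^ m * exp (- s * \<xi>\<^sup>2)) \<le> (1 + \<bar>\<xi>\<bar>) ^ Suc m * exp (- s * \<bar>\<xi>\<bar>\<^sup>2)"
        unfolding mult.assoc[symmetric] power2_abs by (rule mult_right_mono) simp
      also have "(1 + \<bar>\<xi>\<bar>) ^ Suc m = (1 + \<bar>\<xi>\<bar>) powr real (Suc m)"
        by (subst powr_realpow) auto
      also have "\<dots> * exp (- s * \<bar>\<xi>\<bar>\<^sup>2) \<le> ?C"
        by (rule powr_times_gaussian_le) (use s in auto)
      finally have "(1 + \<bar>\<xi>\<bar>) * norm (?g m \<xi>) \<le> ?C" by (simp add: norm_mult norm_power)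
      then show ?thesis by (simp add: field_simps add_pos_nonneg)
    qed
    then show "\<forall>\<^sub>F \<xi> in F. norm (?g m \<xi>) \<le> ?C / (1 + \<bar>\<xi>\<bar>)" by simp
    show "((\<lambda>\<xi>. ?C / (1 + \<bar>\<xi>\<bar>)) \<longlongrightarrow> 0) F"
      using F by (elim disjE; hypsubst; real_asymp)
  qed
  \<comment> \<open>The derivative is computed for the holomorphic extension to complex arguments
    and then restricted to the real line.\<close>
  have der: "(?g m has_vector_derivative ?f \<xi>) (at \<xi>)" for \<xi>
  proof -
    have "((\<lambda>z. exp (\<i> * x * z - s * z\<^sup>2) * z ^ m) has_field_derivative
       (exp (\<i> * x * of_real \<xi> - s * (of_real \<xi>)\<^sup>2) * (of_nat m * of_real \<xi> ^ (m - 1))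
         + (\<i> * x - 2 * s * of_real \<xi>) * exp (\<i> * x * of_real \<xi> - s * (of_real \<xi>)\<^sup>2) * of_real \<xi> ^ m)) (at (complex_of_real \<xi>))"
      by (auto intro!: derivative_eq_intros simp: algebra_simps)
    from has_vector_derivative_real_field[OF this] show ?thesis
      unfolding g_eq by (simp add: algebra_simps)
  qed
  have "continuous_on UNIV ?f"
    by (intro continuous_intros)
  then have cont: "isCont ?f \<xi>" for \<xi>
    by (rule continuous_on_interior) simp
  have "(LBINT \<xi>=-\<infinity>..\<infinity>. ?f \<xi>) = 0 - 0"
    by (rule interval_integral_FTC_integrable[where F="?g m"])
      (use int der cont lim[of at_top] lim[of at_bot] in \<open>auto simp: set_integrable_def einterval_eq ereal_tendsto_simps simp del: ereal_less_eq\<close>)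
  then have "(\<integral>\<xi>. ?f \<xi> \<partial>lborel) = 0"
    by (simp add: interval_lebesgue_integral_def set_lebesgue_integral_def einterval_eq)
  moreover have "(\<integral>\<xi>. ?f \<xi> \<partial>lborel) = of_nat m * gaussian_moment (m - 1) s x + \<i> * x * gaussian_moment m s x
      - 2 * s * gaussian_moment (Suc m) s x"
    unfolding gaussian_moment_def
    by (simp only: Bochner_Integration.integral_diff Bochner_Integration.integral_add
        Bochner_Integration.integrable_add integrable_mult_right int_g integral_mult_right_zero)
  ultimately show ?thesis using s by (simp add: field_simps)
qed

text \<open>In the variable z = |x| / sqrt s each order costs a factor \<open>s powr (-1/2)\<close>
  and one power of 1 + z: the term with x because |x| / s = z / sqrt s, the other because it skips
  an order while carrying 1/s. The induction is strong since the recursion reaches back two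
  orders.\<close>

lemma gaussian_moment_bound_aux:
  "\<exists>C\<ge>0. \<forall>s>0. \<forall>x. norm (gaussian_moment m s x)
     \<le> C * s powr (- (real m + 1) / 2) * ((1 + \<bar>x\<bar> / sqrt s) ^ m * exp (- x\<^sup>2 / (4 * s)))"
proof (induction m rule: less_induct)
  case (less m)
  show ?case
  proof (cases m)
    case 0
    have "norm (gaussian_moment 0 s x) \<le> sqrt pi * s powr (- (real 0 + 1) / 2) * ((1 + \<bar>x\<bar> / sqrt s) ^ 0 * exp (- x\<^sup>2 / (4 * s)))"
      if "s > 0" for s x
      using that unfolding gaussian_moment_0[OF that] norm_of_real
      by (simp add: real_sqrt_divide powr_minus_divide powr_half_sqrt abs_mult)
    then show ?thesis unfolding 0 by (intro exI[of _ "sqrt pi"]) auto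
  next
    case (Suc n)
    obtain C1 where C1: "C1 \<ge> 0" "\<And>s x. s > 0 \<Longrightarrow> norm (gaussian_moment n s x)
     \<le> C1 * s powr (- (real n + 1) / 2) * ((1 + \<bar>x\<bar> / sqrt s) ^ n * exp (- x\<^sup>2 / (4 * s)))"
      using less.IH[of n] Suc by auto
    obtain C2 where C2: "C2 \<ge> 0" "\<And>s x. s > 0 \<Longrightarrow> norm (gaussian_moment (n - 1) s x)
     \<le> C2 * s powr (- (real (n - 1) + 1) / 2) * ((1 + \<bar>x\<bar> / sqrt s) ^ (n - 1) * exp (- x\<^sup>2 / (4 * s)))"
      using less.IH[of "n - 1"] Suc by (meson diff_le_self le_imp_less_Suc)
    have "norm (gaussian_moment (Suc n) s x)
     \<le> (n * C2 + C1) * s powr (- (real (Suc n) + 1) / 2) * ((1 + \<bar>x\<bar> / sqrt s) ^ Suc n * exp (- x\<^sup>2 / (4 * s)))"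
      if s: "s > 0" for s x
    proof -
      define z where "z = \<bar>x\<bar> / sqrt s"
      define E where "E = exp (- x\<^sup>2 / (4 * s))"
      have z: "z \<ge> 0" "\<bar>x\<bar> = z * s powr (1/2)" and E: "E \<ge> 0"
        using s by (auto simp: z_def powr_half_sqrt E_def)
      have A: "real n * norm (gaussian_moment (n - 1) s x) \<le> n * C2 * s powr (- real n / 2) * ((1 + z) ^ Suc n * E)"
      proof (cases n)
        case (Suc k)
        have "(1 + z) ^ k \<le> (1 + z) ^ Suc n" using z Suc by (intro power_increasing) auto
        then have "C2 * s powr (- (real k + 1) / 2) * ((1 + z) ^ k * E)
            \<le> C2 * s powr (- (real k + 1) / 2) * ((1 + z) ^ Suc n * E)"
          using C2(1) E by (intro mult_left_mono mult_right_mono) auto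
        with C2(2)[OF s, of x] Suc have "norm (gaussian_moment (n - 1) s x) \<le> C2 * s powr (- real n / 2) * ((1 + z) ^ Suc n * E)"
          by (simp add: z_def E_def add.commute)
        then have "real n * norm (gaussian_moment (n - 1) s x) \<le> real n * (C2 * s powr (- real n / 2) * ((1 + z) ^ Suc n * E))"
          by (intro mult_left_mono) auto
        then show ?thesis by (simp only: mult.assoc)
      qed simp
      have B: "\<bar>x\<bar> * norm (gaussian_moment n s x) \<le> C1 * s powr (- real n / 2) * ((1 + z) ^ Suc n * E)"
      proof -
        have "\<bar>x\<bar> * norm (gaussian_moment n s x) \<le> (z * s powr (1/2)) * (C1 * s powr (- (real n + 1) / 2) * ((1 + z) ^ n * E))"
          unfolding z(2) using C1(2)[OF s, of x] z(1)
          by (intro mult_left_mono) (simp_all only: z_def[symmetric] E_def[symmetric] mult_nonneg_nonneg powr_ge_zero)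
        also have "\<dots> = C1 * (s powr (1/2) * s powr (- (real n + 1) / 2)) * (z * (1 + z) ^ n * E)"
          by (simp only: mult_ac)
        also have "s powr (1/2) * s powr (- (real n + 1) / 2) = s powr (- real n / 2)"
          by (simp add: powr_add[symmetric] field_simps)
        also have "C1 * s powr (- real n / 2) * (z * (1 + z) ^ n * E) \<le> C1 * s powr (- real n / 2) * ((1 + z) ^ Suc n * E)"
          using z E C1(1) by (intro mult_left_mono mult_right_mono) (auto intro!: mult_right_mono)
        finally show ?thesis .
      qed
      have "norm (gaussian_moment (Suc n) s x) \<le> (real n * norm (gaussian_moment (n - 1) s x) + \<bar>x\<bar> * norm (gaussian_moment n s x)) / (2 * s)"
      proof -
        have "norm (of_nat n * gaussian_moment (n - 1) s x + \<i> * x * gaussian_moment n s x)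
            \<le> real n * norm (gaussian_moment (n - 1) s x) + \<bar>x\<bar> * norm (gaussian_moment n s x)"
          by (rule order_trans[OF norm_triangle_ineq]) (simp add: norm_mult)
        then show ?thesis using s unfolding gaussian_moment_Suc[OF s]
          by (simp add: norm_divide norm_mult divide_right_mono)
      qed
      also have "\<dots> \<le> (n * C2 * s powr (- real n / 2) * ((1 + z) ^ Suc n * E) + C1 * s powr (- real n / 2) * ((1 + z) ^ Suc n * E)) / s"
        using A B s C1(1) C2(1) E z by (intro frac_le add_mono) (auto intro!: add_nonneg_nonneg mult_nonneg_nonneg)
      also have "\<dots> = (n * C2 + C1) * (s powr (- real n / 2) / s) * ((1 + z) ^ Suc n * E)"
        by (simp add: algebra_simps add_divide_distrib)
      also have "s powr (- real n / 2) / s = s powr (- (real (Suc n) + 1) / 2)"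
      proof -
        have "s powr (- real n / 2) / s = s powr (- real n / 2) * s powr (- 1)" using s by (simp add: powr_minus_divide)
        also have "\<dots> = s powr (- (real (Suc n) + 1) / 2)" by (simp only: powr_add[symmetric]) (rule arg_cong[where f="(powr) s"], simp add: field_simps)
        finally show ?thesis .
      qed
      finally show ?thesis by (simp add: z_def E_def)
    qed
    then show ?thesis unfolding Suc using C1(1) C2(1) by (intro exI[of _ "n * C2 + C1"]) auto
  qed
qed

text \<open>Half of the Gaussian exponent absorbs the polynomial in z, hence 8 s in place of 4
  s.\<close>

lemma gaussian_moment_bound:
  "\<exists>C\<ge>0. \<forall>s>0. \<forall>x. norm (gaussian_moment m s x) \<le> C * s powr (- (real m + 1) / 2) * exp (- x\<^sup>2 / (8 * s))"
proof -
  obtain C where C: "C \<ge> 0" "\<And>s x. s > 0 \<Longrightarrow> norm (gaussian_moment m s x)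
     \<le> C * s powr (- (real m + 1) / 2) * ((1 + \<bar>x\<bar> / sqrt s) ^ m * exp (- x\<^sup>2 / (4 * s)))"
    using gaussian_moment_bound_aux by blast
  define K where "K = exp ((real m)\<^sup>2 / (4 * (1/8)))"
  have "norm (gaussian_moment m s x) \<le> (C * K) * s powr (- (real m + 1) / 2) * exp (- x\<^sup>2 / (8 * s))"
    if s: "s > 0" for s x
  proof -
    define z where "z = \<bar>x\<bar> / sqrt s"
    have z: "z \<ge> 0" "x\<^sup>2 / s = z\<^sup>2" using s by (auto simp: z_def power_divide)
    have "(1 + z) ^ m * exp (- (1/8) * z\<^sup>2) \<le> K"
      using powr_times_gaussian_le[of "1/8" "real m" z] z by (simp add: K_def powr_realpow)
    moreover have "- x\<^sup>2 / (4 * s) = - (1/8) * z\<^sup>2 + - x\<^sup>2 / (8 * s)" by (simp add: z(2)[symmetric])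
    ultimately have "(1 + z) ^ m * exp (- x\<^sup>2 / (4 * s)) \<le> K * exp (- x\<^sup>2 / (8 * s))"
      by (simp only: exp_add mult.assoc[symmetric]) (rule mult_right_mono, simp_all)
    then have "C * s powr (- (real m + 1) / 2) * ((1 + z) ^ m * exp (- x\<^sup>2 / (4 * s)))
       \<le> C * s powr (- (real m + 1) / 2) * (K * exp (- x\<^sup>2 / (8 * s)))"
      using C(1) by (intro mult_left_mono) auto
    also have "\<dots> = (C * K) * s powr (- (real m + 1) / 2) * exp (- x\<^sup>2 / (8 * s))"
      by (simp only: mult_ac)
    finally show ?thesis using C(2)[OF s, of x] unfolding z_def by linarith
  qed
  then show ?thesis using C(1) by (intro exI[of _ "C * K"]) (auto simp: K_def)
qed

section \<open>Pointwise bounds for the Oseen and heat kernels\<close>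

text \<open>The inner product and the squared norm are sums over coordinates, so the integrand is a
  product of functions of one variable, and \<open>lborel\<close> is the image of a product
  measure.\<close>

lemma gaussian_monomial_factorization:
  fixes x :: "'a::euclidean_space" and m :: "'a \<Rightarrow> nat"
  assumes s: "0 < s"
  defines "g \<equiv> \<lambda>\<xi>. cis (x \<bullet> \<xi>) * complex_of_real ((\<Prod>b\<in>Basis. (\<xi> \<bullet> b) ^ m b) * exp (- s * (norm \<xi>)\<^sup>2))"
  shows "integrable lborel g" (is ?int)
    and "(\<integral>\<xi>. g \<xi> \<partial>lborel) = (\<Prod>b\<in>Basis. gaussian_moment (m b) s (x \<bullet> b))" (is ?eq)
proof -
  let ?h = "\<lambda>b \<xi>::real. cis ((x \<bullet> b) * \<xi>) * complex_of_real (\<xi> ^ m b * exp (- s * \<xi>\<^sup>2))"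
  let ?T = "\<lambda>f. \<Sum>b\<in>Basis. f b *\<^sub>R (b::'a)"
  let ?P = "Pi\<^sub>M Basis (\<lambda>_::'a. lborel :: real measure)"
  interpret product_sigma_finite "\<lambda>_::'a. lborel :: real measure"
    by (rule product_sigma_finite.intro) (rule lborel.sigma_finite_measure_axioms)
  have g: "g \<xi> = (\<Prod>b\<in>Basis. ?h b (\<xi> \<bullet> b))" for \<xi>
  proof -
    have "cis (x \<bullet> \<xi>) = (\<Prod>b\<in>Basis. cis ((x \<bullet> b) * (\<xi> \<bullet> b)))"
      by (subst euclidean_inner) (simp add: cis_conv_exp exp_sum[symmetric] sum_distrib_left)
    moreover have "(norm \<xi>)\<^sup>2 = (\<Sum>b\<in>Basis. (\<xi> \<bullet> b)\<^sup>2)"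
      by (subst power2_norm_eq_inner, subst euclidean_inner) (simp add: power2_eq_square)
    then have "exp (- s * (norm \<xi>)\<^sup>2) = (\<Prod>b\<in>Basis. exp (- s * (\<xi> \<bullet> b)\<^sup>2))"
      by (simp only: sum_distrib_left exp_sum finite_Basis)
    ultimately show ?thesis by (simp add: g_def prod.distrib)
  qed
  have meas: "g \<in> borel_measurable borel" unfolding g_def by measurable
  have T: "?T \<in> measurable ?P borel" by simp
  have gT: "g (?T f) = (\<Prod>b\<in>Basis. ?h b (f b))" for f
    unfolding g by (intro prod.cong refl) (simp add: inner_sum_left_Basis)
  have "integrable ?P (\<lambda>f. g (?T f))"
    unfolding gT by (intro product_integrable_prod finite_Basis integrable_gaussian_moment[OF s])
  then show ?int
    unfolding lborel_eq[where 'a='a] by (rule integrable_distr_eq[THEN iffD2, OF T meas])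
  have "(\<integral>\<xi>. g \<xi> \<partial>lborel) = (\<integral>f. g (?T f) \<partial>?P)"
    unfolding lborel_eq[where 'a='a] by (rule integral_distr[OF T meas])
  also have "\<dots> = (\<Prod>b\<in>Basis. gaussian_moment (m b) s (x \<bullet> b))"
    unfolding gT gaussian_moment_def by (intro product_integral_prod finite_Basis integrable_gaussian_moment[OF s])
  finally show ?eq .
qed

text \<open>Each coordinate b contributes (m b + 1)/2 to the exponent of 1/s, and the Gaussians in
  the coordinates multiply to one in |x|.\<close>

lemma gaussian_monomial_bound:
  fixes m :: "'a::euclidean_space \<Rightarrow> nat"
  shows "\<exists>C\<ge>0. \<forall>s>0. \<forall>x::'a. norm (\<integral>\<xi>. cis (x \<bullet> \<xi>) * complex_of_real ((\<Prod>b\<in>Basis. (\<xi> \<bullet> b) ^ m b) * exp (- s * (norm \<xi>)\<^sup>2)) \<partial>lborel)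
    \<le> C * s powr (- (real (DIM('a) + (\<Sum>b\<in>Basis. m b)) / 2)) * exp (- (norm x)\<^sup>2 / (8 * s))"
proof -
  have "\<forall>b::'a. \<exists>C\<ge>0. \<forall>s>0. \<forall>x. norm (gaussian_moment (m b) s x) \<le> C * s powr (- (real (m b) + 1) / 2) * exp (- x\<^sup>2 / (8 * s))"
    using gaussian_moment_bound by blast
  then obtain C where C: "\<And>b. C b \<ge> 0"
      "\<And>b s x. s > 0 \<Longrightarrow> norm (gaussian_moment (m b) s x) \<le> C b * s powr (- (real (m b) + 1) / 2) * exp (- x\<^sup>2 / (8 * s))"
    by metis
  have "norm (\<integral>\<xi>. cis (x \<bullet> \<xi>) * complex_of_real ((\<Prod>b\<in>Basis. (\<xi> \<bullet> b) ^ m b) * exp (- s * (norm \<xi>)\<^sup>2)) \<partial>lborel)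
    \<le> (\<Prod>b\<in>Basis. C b) * s powr (- (real (DIM('a) + (\<Sum>b\<in>Basis. m b)) / 2)) * exp (- (norm x)\<^sup>2 / (8 * s))"
    if s: "s > 0" for s and x :: 'a
  proof -
    have "norm (\<Prod>b\<in>Basis. gaussian_moment (m b) s (x \<bullet> b))
      \<le> (\<Prod>b\<in>Basis. C b * s powr (- (real (m b) + 1) / 2) * exp (- (x \<bullet> b)\<^sup>2 / (8 * s)))"
      unfolding prod_norm[symmetric] by (intro prod_mono conjI norm_ge_zero C(2)[OF s])
    also have "\<dots> = (\<Prod>b\<in>Basis. C b) * (\<Prod>b\<in>(Basis::'a set). s powr (- (real (m b) + 1) / 2)) * (\<Prod>b\<in>Basis. exp (- (x \<bullet> b)\<^sup>2 / (8 * s)))"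
      by (simp only: prod.distrib)
    also have "(\<Prod>b\<in>(Basis::'a set). s powr (- (real (m b) + 1) / 2)) = s powr (\<Sum>b\<in>(Basis::'a set). - (real (m b) + 1) / 2)"
      using s by (simp add: powr_sum)
    also have "(\<Sum>b\<in>(Basis::'a set). - (real (m b) + 1) / 2) = - (real (DIM('a) + (\<Sum>b\<in>Basis. m b)) / 2)"
    proof -
      have "(\<Sum>b\<in>(Basis::'a set). real (m b) + 1) = real (DIM('a) + (\<Sum>b\<in>Basis. m b))"
        by (simp add: sum.distrib)
      then show ?thesis by (simp only: sum_divide_distrib[symmetric] sum_negf minus_divide_left)
    qed
    also have "(\<Prod>b\<in>Basis. exp (- (x \<bullet> b)\<^sup>2 / (8 * s))) = exp (- (norm x)\<^sup>2 / (8 * s))"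
    proof -
      have "(norm x)\<^sup>2 = (\<Sum>b\<in>Basis. (x \<bullet> b)\<^sup>2)"
        by (subst power2_norm_eq_inner, subst euclidean_inner) (simp add: power2_eq_square)
      then show ?thesis
        by (simp only: sum_negf[symmetric] sum_divide_distrib exp_sum finite_Basis)
    qed
    finally show ?thesis unfolding gaussian_monomial_factorization(2)[OF s] .
  qed
  moreover have "0 \<le> (\<Prod>b\<in>Basis. C b)" using C(1) by (simp add: prod_nonneg)
  ultimately show ?thesis by blast
qed

text \<open>With w = z / sqrt s one has z + sqrt s = sqrt s * (1 + w): the prefactor supplies the
  power of sqrt s, and the Gaussian absorbs that of 1 + w.\<close>

lemma scaled_gaussian_le:
  fixes c p s z :: real
  assumes "0 < c" "0 \<le> p" "0 < s" "0 \<le> z"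
  shows "s powr (- (p / 2)) * exp (- c * z\<^sup>2 / s) \<le> exp (p\<^sup>2 / (4 * c)) * (z + sqrt s) powr - p"
proof -
  define w where "w = z / sqrt s"
  have w: "0 \<le> w" "z\<^sup>2 / s = w\<^sup>2" "z + sqrt s = sqrt s * (1 + w)"
    using assms by (auto simp: w_def power_divide field_simps)
  have "(1 + w) powr p * exp (- c * w\<^sup>2) \<le> exp (p\<^sup>2 / (4 * c))"
    by (rule powr_times_gaussian_le) (use assms w in auto)
  then have "exp (- c * w\<^sup>2) \<le> exp (p\<^sup>2 / (4 * c)) / (1 + w) powr p"
    using w(1) by (simp only: pos_le_divide_eq powr_gt_zero) (simp add: mult.commute)
  also have "\<dots> = exp (p\<^sup>2 / (4 * c)) * (1 + w) powr - p"
    by (simp only: powr_minus divide_inverse)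
  finally have "s powr (- (p / 2)) * exp (- c * w\<^sup>2) \<le> s powr (- (p / 2)) * (exp (p\<^sup>2 / (4 * c)) * (1 + w) powr - p)"
    by (rule mult_left_mono) simp
  moreover have "s powr (- (p / 2)) = sqrt s powr - p"
    using assms by (simp add: powr_half_sqrt[symmetric] powr_powr)
  moreover have "(z + sqrt s) powr - p = sqrt s powr - p * (1 + w) powr - p"
    unfolding w(3) using w(1) assms by (subst powr_mult) auto
  moreover have "- c * z\<^sup>2 / s = - c * w\<^sup>2" unfolding w(2)[symmetric] by simp
  ultimately show ?thesis by (simp only: mult_ac)
qed

text \<open>In the variable sqrt s this is the tail integral of a pure power; the integration costs
  one power of decay.\<close>

lemma nn_integral_heat_tail:
  fixes a t p :: real
  assumes t: "0 < t" and a: "0 \<le> a" and p: "1 < p"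
  shows "(\<integral>\<^sup>+s. ennreal (s powr (- (1 / 2)) * (a + sqrt s) powr - p) * indicator {t..} s \<partial>lborel)
     = ennreal (2 / (p - 1) * (a + sqrt t) powr (1 - p))"
proof -
  let ?F = "\<lambda>s. 2 / (1 - p) * (a + sqrt s) powr (1 - p)"
  have "(\<integral>\<^sup>+s. ennreal (s powr (- (1 / 2)) * (a + sqrt s) powr - p) * indicator {t..} s \<partial>lborel) = ennreal (0 - ?F t)"
  proof (rule nn_integral_FTC_atLeast)
    fix s assume "t \<le> s"
    then have s: "0 < s" using t by simp
    then have pos: "0 < a + sqrt s" using a by (simp add: add_nonneg_pos)
    have "((\<lambda>s. (a + sqrt s) powr (1 - p)) has_real_derivative (1 - p) * (a + sqrt s) powr (1 - p - 1) * (inverse (sqrt s) / 2)) (at s)"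
      using s pos by (auto intro!: derivative_eq_intros)
    from DERIV_cmult[OF this, of "2 / (1 - p)"]
    have "(?F has_real_derivative 2 / (1 - p) * ((1 - p) * (a + sqrt s) powr (1 - p - 1) * (inverse (sqrt s) / 2))) (at s)" .
    also have "2 / (1 - p) * ((1 - p) * (a + sqrt s) powr (1 - p - 1) * (inverse (sqrt s) / 2)) = s powr (- (1 / 2)) * (a + sqrt s) powr - p"
      using p s by (simp add: powr_minus powr_half_sqrt)
    finally show "(?F has_real_derivative s powr (- (1 / 2)) * (a + sqrt s) powr - p) (at s)" .
  next
    have "filterlim (\<lambda>s. a + sqrt s) at_top at_top"
      by (intro filterlim_tendsto_add_at_top[OF tendsto_const] sqrt_at_top)
    then have "((\<lambda>s. (a + sqrt s) powr (1 - p)) \<longlongrightarrow> 0) at_top"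
      using p by (intro tendsto_neg_powr) auto
    from tendsto_mult_left[OF this, of "2 / (1 - p)"] show "(?F \<longlongrightarrow> 0) at_top" by simp
  qed auto
  also have "0 - ?F t = 2 / (p - 1) * (a + sqrt t) powr (1 - p)"
    using p by (simp add: field_simps)
  finally show ?thesis .
qed

text \<open>Used with q = |\<xi>|^2, where it removes the singular denominator of the Leray
  symbol.\<close>

lemma heat_symbol_integral:
  fixes q t :: real
  assumes "0 < q"
  shows "has_bochner_integral lborel (\<lambda>s. exp (- s * q) * indicator {t..} s) (exp (- t * q) / q)"
proof (rule has_bochner_integral_nn_integral)
  have "(\<integral>\<^sup>+s. ennreal (exp (- s * q)) * indicator {t..} s \<partial>lborel) = ennreal (0 - (- exp (- t * q) / q))"
  proof (rule nn_integral_FTC_atLeast)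
    show "((\<lambda>s. - exp (- s * q) / q) \<longlongrightarrow> 0) at_top"
      using assms by real_asymp
  qed (use assms in \<open>auto intro!: derivative_eq_intros\<close>)
  then show "(\<integral>\<^sup>+s. ennreal (exp (- s * q) * indicator {t..} s) \<partial>lborel) = ennreal (exp (- t * q) / q)"
    by (simp add: ennreal_mult' ennreal_indicator)
qed (use assms in auto)

text \<open>By Fubini the transform is an integral over s \<ge> t of transforms of a cubic monomial
  times a Gaussian, each of order \<open>s powr (-(d+3)/2)\<close>. Half a power of 1/s is kept as
  density for \<open>nn_integral_heat_tail\<close>; the rest turns into
  \<open>(|x| + sqrt s) powr -(d+2)\<close>, and the integration in s ends at exponent d +
  1.\<close>

lemma gaussian_riesz_bound:
  fixes b1 b2 b3 :: "'a::euclidean_space"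
  assumes b: "b1 \<in> Basis" "b2 \<in> Basis" "b3 \<in> Basis"
  defines "M \<equiv> \<lambda>\<xi>. (\<xi> \<bullet> b1) * (\<xi> \<bullet> b2) * (\<xi> \<bullet> b3)"
  defines "g \<equiv> \<lambda>t x \<xi>. cis (x \<bullet> \<xi>) * complex_of_real (M \<xi> * (exp (- t * (norm \<xi>)\<^sup>2) / (norm \<xi>)\<^sup>2))"
  shows "\<exists>C\<ge>0. \<forall>t>0. \<forall>x. integrable lborel (g t x) \<and>
    norm (\<integral>\<xi>. g t x \<xi> \<partial>lborel) \<le> C * (norm x + sqrt t) powr - (real DIM('a) + 1)"
proof -
  let ?D = "real DIM('a)"
  \<comment> \<open>Multiplicities are added because the three basis vectors may coincide.\<close>
  define m where "m b = (if b = b1 then 1 else 0) + (if b = b2 then 1 else 0) + (if b = b3 then 1 else (0::nat))" for b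
  have M: "(\<Prod>b\<in>Basis. (\<xi> \<bullet> b) ^ m b) = M \<xi>" for \<xi>
  proof -
    have "(\<Prod>b\<in>Basis. (\<xi> \<bullet> b) ^ (if b = c then 1 else 0)) = \<xi> \<bullet> c" if "c \<in> Basis" for c
      using that by (subst prod.mono_neutral_right[of _ "{c}"]) auto
    then show ?thesis using b by (simp only: m_def power_add prod.distrib M_def)
  qed
  have m_sum: "(\<Sum>b\<in>Basis. m b) = 3"
    using b by (simp add: m_def sum.distrib)
  have Mle: "\<bar>M \<xi>\<bar> \<le> norm \<xi> ^ 3" for \<xi>
    using b unfolding M_def abs_mult power3_eq_cube
    by (intro mult_mono Basis_le_norm mult_nonneg_nonneg) auto
  have [measurable]: "M \<in> borel_measurable borel" unfolding M_def by measurable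
  obtain C where C: "0 \<le> C" "\<And>s x. s > 0 \<Longrightarrow> norm (\<integral>\<xi>. cis (x \<bullet> \<xi>) * complex_of_real (M \<xi> * exp (- s * (norm \<xi>)\<^sup>2)) \<partial>lborel)
    \<le> C * s powr (- ((?D + 3) / 2)) * exp (- (norm x)\<^sup>2 / (8 * s))"
    using gaussian_monomial_bound[of m] unfolding M m_sum of_nat_add by auto
  define K where "K = exp ((?D + 2)\<^sup>2 / (4 * (1 / 8)))"
  define K' where "K' = C * K * (2 / (?D + 1))"
  have K': "0 \<le> K'" using C(1) by (simp add: K'_def K_def)
  have "integrable lborel (g t x) \<and> norm (\<integral>\<xi>. g t x \<xi> \<partial>lborel) \<le> K' * (norm x + sqrt t) powr - (?D + 1)" if t: "t > 0" for t and x :: 'a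
  proof -
    let ?e = "\<lambda>\<xi> s. exp (- s * (norm (\<xi>::'a))\<^sup>2) * indicator {t..} s"
    let ?h = "\<lambda>\<xi> s. cis (x \<bullet> \<xi>) * complex_of_real (M \<xi> * ?e \<xi> s)"
    have [measurable]: "g t x \<in> borel_measurable borel" unfolding g_def by measurable
    \<comment> \<open>After division at most |\<xi>| is left of the cubic numerator. Of the d + 2
      powers supplied by the Gaussian one absorbs 1 + |\<xi>|, and the other d + 1 suffice for
      integrability.\<close>
    have gnorm: "norm (g t x \<xi>) \<le> exp ((?D + 2)\<^sup>2 / (4 * t)) * (norm \<xi> + 1) powr - (?D + 1)" for \<xi>
    proof (cases "\<xi> = 0")
      case False
      then have z: "norm \<xi> > 0" by simp
      have "norm (g t x \<xi>) = \<bar>M \<xi>\<bar> / (norm \<xi>)\<^sup>2 * exp (- t * (norm \<xi>)\<^sup>2)"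
        by (simp only: g_def norm_mult norm_of_real norm_cis abs_mult mult_1) simp
      also have "\<bar>M \<xi>\<bar> / (norm \<xi>)\<^sup>2 \<le> 1 + norm \<xi>"
      proof -
        have "\<bar>M \<xi>\<bar> \<le> norm \<xi> * (norm \<xi>)\<^sup>2" using Mle[of \<xi>] by (simp add: power3_eq_cube power2_eq_square)
        then have "\<bar>M \<xi>\<bar> / (norm \<xi>)\<^sup>2 \<le> norm \<xi>" using z by (simp add: pos_divide_le_eq)
        then show ?thesis by simp
      qed
      also have "(1 + norm \<xi>) * exp (- t * (norm \<xi>)\<^sup>2) \<le> exp ((?D + 2)\<^sup>2 / (4 * t)) * (norm \<xi> + 1) powr - (?D + 1)"
      proof -
        have "(1 + norm \<xi>) powr (?D + 2) * exp (- t * (norm \<xi>)\<^sup>2) \<le> exp ((?D + 2)\<^sup>2 / (4 * t))"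
          by (rule powr_times_gaussian_le) (use t in auto)
        moreover have "(1 + norm \<xi>) powr (?D + 2) = (1 + norm \<xi>) * (1 + norm \<xi>) powr (?D + 1)"
          using powr_add[of "1 + norm \<xi>" 1 "?D + 1"] by (simp add: add.commute)
        ultimately have "(1 + norm \<xi>) * exp (- t * (norm \<xi>)\<^sup>2) * (1 + norm \<xi>) powr (?D + 1) \<le> exp ((?D + 2)\<^sup>2 / (4 * t))"
          by (simp only: mult_ac)
        moreover have "0 < (1 + norm \<xi>) powr (?D + 1)" by (subst powr_gt_zero) (use z in linarith)
        ultimately have "(1 + norm \<xi>) * exp (- t * (norm \<xi>)\<^sup>2) \<le> exp ((?D + 2)\<^sup>2 / (4 * t)) / (1 + norm \<xi>) powr (?D + 1)"
          by (simp only: pos_le_divide_eq)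
        then show ?thesis by (simp only: powr_minus divide_inverse add.commute[of "norm \<xi>" 1])
      qed
      finally show ?thesis by (simp only: mult_right_mono exp_ge_zero)
    qed (simp add: g_def)
    have "integrable lborel (\<lambda>\<xi>::'a. exp ((?D + 2)\<^sup>2 / (4 * t)) * (norm \<xi> + 1) powr - (?D + 1))"
    proof (intro integrable_mult_right integrableI_bounded)
      obtain C2 where "(\<integral>\<^sup>+y. ennreal ((norm (y::'a) + 1) powr - (?D + 1)) \<partial>lborel) \<le> ennreal C2"
        using nn_integral_shifted_norm_powr_le[where 'a='a] by (metis div_by_1 zero_less_one)
      then show "(\<integral>\<^sup>+y. ennreal (norm ((norm (y::'a) + 1) powr - (?D + 1))) \<partial>lborel) < \<infinity>"
        by (simp add: le_less_trans[OF _ ennreal_less_top])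
    qed simp
    then have int: "integrable lborel (g t x)"
      by (rule Bochner_Integration.integrable_bound) (use gnorm in \<open>auto intro: order_trans[OF _ abs_ge_self]\<close>)
    have E: "has_bochner_integral lborel (?e \<xi>) (exp (- t * (norm \<xi>)\<^sup>2) / (norm \<xi>)\<^sup>2)" if "\<xi> \<noteq> 0" for \<xi> :: 'a
      by (rule heat_symbol_integral) (use that in simp)
    \<comment> \<open>At \<xi> = 0 the representation of 1 / |\<xi>|^2 fails, but the monomial
      vanishes there and both sides are 0.\<close>
    have H: "has_bochner_integral lborel (?h \<xi>) (g t x \<xi>)" for \<xi>
    proof (cases "\<xi> = 0")
      case True
      have "M 0 = 0" by (simp add: M_def)
      then show ?thesis using True by (simp add: g_def has_bochner_integral_zero)
    next
      case False
      show ?thesis unfolding g_def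
        by (intro has_bochner_integral_mult_right has_bochner_integral_of_real E False)
    qed
    have Hn: "has_bochner_integral lborel (\<lambda>s. norm (?h \<xi> s)) (norm (g t x \<xi>))" for \<xi>
    proof (cases "\<xi> = 0")
      case True
      have "M 0 = 0" by (simp add: M_def)
      then show ?thesis using True by (simp add: g_def has_bochner_integral_zero)
    next
      case False
      have "has_bochner_integral lborel (\<lambda>s. \<bar>M \<xi>\<bar> * ?e \<xi> s) (\<bar>M \<xi>\<bar> * (exp (- t * (norm \<xi>)\<^sup>2) / (norm \<xi>)\<^sup>2))"
        by (intro has_bochner_integral_mult_right E False)
      moreover have "norm (g t x \<xi>) = \<bar>M \<xi>\<bar> * (exp (- t * (norm \<xi>)\<^sup>2) / (norm \<xi>)\<^sup>2)"
        by (simp only: g_def norm_mult norm_of_real norm_cis abs_mult mult_1) simp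
      moreover have "norm (?h \<xi> s) = \<bar>M \<xi>\<bar> * ?e \<xi> s" for s
        by (simp only: norm_mult norm_of_real norm_cis abs_mult mult_1) simp
      ultimately show ?thesis by (simp only:)
    qed
    \<comment> \<open>The superposition in s has a nonnegative density, so integrating absolute
      values over s returns |g|, which is integrable in \<xi>.\<close>
    have "integrable (lborel \<Otimes>\<^sub>M lborel) (\<lambda>(\<xi>, s). ?h \<xi> s)"
    proof (rule lborel_pair.Fubini_integrable)
      show "integrable lborel (\<lambda>\<xi>. \<integral>s. norm (case (\<xi>, s) of (\<xi>, s) \<Rightarrow> ?h \<xi> s) \<partial>lborel)"
        using int by (simp only: prod.case has_bochner_integral_integral_eq[OF Hn] integrable_norm)
      show "AE \<xi> in lborel. integrable lborel (\<lambda>s. case (\<xi>, s) of (\<xi>, s) \<Rightarrow> ?h \<xi> s)"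
        by (simp only: prod.case integrable.intros[OF H] eventually_True)
    qed measurable
    from lborel_pair.Fubini_integral[OF this]
    have "(\<integral>\<xi>. g t x \<xi> \<partial>lborel) = (\<integral>s. (\<integral>\<xi>. ?h \<xi> s \<partial>lborel) \<partial>lborel)"
      by (simp only: has_bochner_integral_integral_eq[OF H])
    moreover have "norm (\<integral>s. (\<integral>\<xi>. ?h \<xi> s \<partial>lborel) \<partial>lborel) \<le> K' * (norm x + sqrt t) powr - (?D + 1)"
    proof (rule ennreal_le_iff[THEN iffD1])
      show "0 \<le> K' * (norm x + sqrt t) powr - (?D + 1)" using K' by simp
      have pt: "norm (\<integral>\<xi>. ?h \<xi> s \<partial>lborel) \<le> C * K * (s powr (- (1 / 2)) * (norm x + sqrt s) powr - (?D + 2)) * indicator {t..} s" for s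
      proof (cases "t \<le> s")
        case True
        then have s: "s > 0" using t by simp
        have "norm (\<integral>\<xi>. ?h \<xi> s \<partial>lborel) = norm (\<integral>\<xi>. cis (x \<bullet> \<xi>) * complex_of_real (M \<xi> * exp (- s * (norm \<xi>)\<^sup>2)) \<partial>lborel)"
          using True by simp
        also have "\<dots> \<le> C * s powr (- ((?D + 3) / 2)) * exp (- (norm x)\<^sup>2 / (8 * s))" by (rule C(2)[OF s])
        also have "s powr (- ((?D + 3) / 2)) = s powr (- (1 / 2)) * s powr (- ((?D + 2) / 2))"
          by (simp only: powr_add[symmetric]) (rule arg_cong[where f="(powr) s"], simp add: field_simps)
        also have "C * (s powr (- (1 / 2)) * s powr (- ((?D + 2) / 2))) * exp (- (norm x)\<^sup>2 / (8 * s))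
            = C * s powr (- (1 / 2)) * (s powr (- ((?D + 2) / 2)) * exp (- (1 / 8) * (norm x)\<^sup>2 / s))"
          by (simp add: mult_ac)
        also have "\<dots> \<le> C * s powr (- (1 / 2)) * (K * (norm x + sqrt s) powr - (?D + 2))"
          unfolding K_def using C(1) s by (intro mult_left_mono scaled_gaussian_le) auto
        finally show ?thesis using True by (simp only: indicator_simps atLeast_iff mult_1_right mult_ac)
      qed simp
      have "ennreal (norm (\<integral>s. (\<integral>\<xi>. ?h \<xi> s \<partial>lborel) \<partial>lborel)) \<le> (\<integral>\<^sup>+s. ennreal (norm (\<integral>\<xi>. ?h \<xi> s \<partial>lborel)) \<partial>lborel)"
        by (rule integral_norm_bound_ennreal[OF lborel_pair.integrable_snd[OF \<open>integrable (lborel \<Otimes>\<^sub>M lborel) (\<lambda>(\<xi>, s). ?h \<xi> s)\<close>]])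
      also have "\<dots> \<le> (\<integral>\<^sup>+s. ennreal (C * K) * (ennreal (s powr (- (1 / 2)) * (norm x + sqrt s) powr - (?D + 2)) * indicator {t..} s) \<partial>lborel)"
      proof (intro nn_integral_mono)
        fix s
        have "ennreal (A * B * indicator {t..} s) = ennreal A * (ennreal B * indicator {t..} s)" if "0 \<le> A" "0 \<le> B" for A B :: real
          using that by (simp add: indicator_def ennreal_mult)
        then show "ennreal (norm (\<integral>\<xi>. ?h \<xi> s \<partial>lborel)) \<le> ennreal (C * K) * (ennreal (s powr (- (1 / 2)) * (norm x + sqrt s) powr - (?D + 2)) * indicator {t..} s)"
          using ennreal_leI[OF pt[of s]] C(1) by (simp only: K_def mult_nonneg_nonneg exp_ge_zero powr_ge_zero)
      qed
      also have "\<dots> = ennreal (C * K) * ennreal (2 / (?D + 2 - 1) * (norm x + sqrt t) powr (1 - (?D + 2)))"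
        by (subst nn_integral_cmult, measurable) (subst nn_integral_heat_tail, use t in auto)
      also have "\<dots> = ennreal (C * K * (2 / (?D + 2 - 1) * (norm x + sqrt t) powr (1 - (?D + 2))))"
        using C(1) by (intro ennreal_mult[symmetric]) (auto simp: K_def)
      also have "C * K * (2 / (?D + 2 - 1) * (norm x + sqrt t) powr (1 - (?D + 2))) = K' * (norm x + sqrt t) powr - (?D + 1)"
      proof -
        have "?D + 2 - 1 = ?D + 1" "1 - (?D + 2) = - (?D + 1)" by simp_all
        then show ?thesis by (simp only: K'_def mult_ac)
      qed
      finally show "ennreal (norm (\<integral>s. (\<integral>\<xi>. ?h \<xi> s \<partial>lborel) \<partial>lborel))
          \<le> ennreal (K' * (norm x + sqrt t) powr - (?D + 1))" .
    qed
    ultimately show ?thesis using int by simp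
  qed
  with K' show ?thesis by blast
qed


text \<open>The symbol splits into a linear monomial times a Gaussian, present for j = k, and the
  cubic part divided by |\<xi>|^2. The first has order \<open>t powr (-(d+1)/2)\<close> with
  Gaussian decay in x, and the second is covered by \<open>gaussian_riesz_bound\<close>.\<close>

lemma oseen_kernel_le:
  "\<exists>C\<ge>0. \<forall>t>0. \<forall>(x::real^'n) j k l. \<bar>oseen_kernel t j k l x\<bar> \<le> C * (norm x + sqrt t) powr - (real CARD('n) + 1)"
proof -
  let ?D = "real CARD('n)"
  have "\<exists>C\<ge>0. \<forall>t>0. \<forall>x::real^'n. \<bar>oseen_kernel t j k l x\<bar> \<le> C * (norm x + sqrt t) powr - (?D + 1)" for j k l :: 'n
  proof -
    let ?b = "\<lambda>i. axis i (1::real) :: real^'n"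
    have b: "?b i \<in> Basis" for i by (simp add: axis_in_Basis_iff)
    let ?M = "\<lambda>\<xi>. (\<xi> \<bullet> ?b j) * (\<xi> \<bullet> ?b k) * (\<xi> \<bullet> ?b l)"
    let ?g = "\<lambda>t x \<xi>. cis (x \<bullet> \<xi>) * complex_of_real (?M \<xi> * (exp (- t * (norm \<xi>)\<^sup>2) / (norm \<xi>)\<^sup>2))"
    let ?f = "\<lambda>t x \<xi>. cis (x \<bullet> \<xi>) * complex_of_real ((\<xi> \<bullet> ?b l) * exp (- t * (norm \<xi>)\<^sup>2))"
    obtain C1 where C1: "0 \<le> C1" "\<And>t x. t > 0 \<Longrightarrow> integrable lborel (?g t x)"
      "\<And>t x. t > 0 \<Longrightarrow> norm (\<integral>\<xi>. ?g t x \<xi> \<partial>lborel) \<le> C1 * (norm x + sqrt t) powr - (?D + 1)"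
      using gaussian_riesz_bound[OF b b b, of j k l] by auto
    define m where "m b = (if b = ?b l then 1 else (0::nat))" for b
    have M: "(\<Prod>b\<in>Basis. (\<xi> \<bullet> b) ^ m b) = \<xi> \<bullet> ?b l" for \<xi>
      unfolding m_def using b[of l] by (subst prod.mono_neutral_right[of _ "{?b l}"]) auto
    have m_sum: "(\<Sum>b\<in>Basis. m b) = 1"
      using b[of l] by (simp add: m_def)
    obtain C2 where C2: "0 \<le> C2" "\<And>t x. t > 0 \<Longrightarrow> norm (\<integral>\<xi>. ?f t x \<xi> \<partial>lborel)
      \<le> C2 * t powr (- ((?D + 1) / 2)) * exp (- (norm x)\<^sup>2 / (8 * t))"
      using gaussian_monomial_bound[of m] unfolding M m_sum of_nat_add by auto
    have f_int: "integrable lborel (?f t x)" if "t > 0" for t x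
      using gaussian_monomial_factorization(1)[OF that, of x m] unfolding M .
    define K where "K = exp ((?D + 1)\<^sup>2 / (4 * (1 / 8)))"
    have C2': "norm (\<integral>\<xi>. ?f t x \<xi> \<partial>lborel) \<le> C2 * K * (norm x + sqrt t) powr - (?D + 1)" if t: "t > 0" for t x
    proof -
      have "C2 * t powr (- ((?D + 1) / 2)) * exp (- (norm x)\<^sup>2 / (8 * t))
          = C2 * (t powr (- ((?D + 1) / 2)) * exp (- (1/8) * (norm x)\<^sup>2 / t))"
        by (simp add: mult_ac)
      also have "\<dots> \<le> C2 * (K * (norm x + sqrt t) powr - (?D + 1))"
        unfolding K_def using C2(1) t by (intro mult_left_mono scaled_gaussian_le) auto
      finally show ?thesis using C2(2)[OF t, of x] by (simp only: mult_ac)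
    qed
    have "\<bar>oseen_kernel t j k l x\<bar> \<le> (C2 * K + C1) * (norm x + sqrt t) powr - (?D + 1)" if t: "t > 0" for t x
    proof -
      define \<delta> :: complex where "\<delta> = (if j = k then 1 else 0)"
      have \<delta>: "norm \<delta> \<le> 1" by (simp add: \<delta>_def)
      have eq: "cis (x \<bullet> \<xi>) * oseen_symbol t j k l \<xi> = \<i> * (\<delta> * ?f t x \<xi> - ?g t x \<xi>)" for \<xi>
        by (simp add: oseen_symbol_def \<delta>_def cart_eq_inner_axis[of \<xi>] algebra_simps)
      let ?I = "\<integral>\<xi>. \<i> * (\<delta> * ?f t x \<xi> - ?g t x \<xi>) \<partial>lborel"
      have int: "integrable lborel (\<lambda>\<xi>. \<i> * (\<delta> * ?f t x \<xi> - ?g t x \<xi>))"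
        by (intro integrable_mult_right Bochner_Integration.integrable_diff f_int C1(2) t)
      have "(\<integral>\<xi>. cis (x \<bullet> \<xi>) * oseen_symbol t j k l \<xi> \<partial>lebesgue) = ?I"
        unfolding eq using borel_measurable_integrable[OF int] by (rule integral_completion)
      then have "\<bar>oseen_kernel t j k l x\<bar> = \<bar>Re ?I\<bar> / (2 * pi) ^ CARD('n)"
        by (simp add: oseen_kernel_def)
      also have "\<dots> \<le> norm ?I / 1"
      proof (intro frac_le abs_Re_le_cmod)
        show "1 \<le> (2 * pi) ^ CARD('n)" using pi_gt3 by (intro one_le_power) auto
      qed auto
      also have "?I = \<i> * (\<delta> * (\<integral>\<xi>. ?f t x \<xi> \<partial>lborel) - (\<integral>\<xi>. ?g t x \<xi> \<partial>lborel))"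
        by (simp only: integral_mult_right_zero Bochner_Integration.integral_diff integrable_mult_right f_int[OF t] C1(2)[OF t])
      also have "norm \<dots> / 1 \<le> norm \<delta> * norm (\<integral>\<xi>. ?f t x \<xi> \<partial>lborel) + norm (\<integral>\<xi>. ?g t x \<xi> \<partial>lborel)"
        using norm_triangle_ineq4[of "\<delta> * (\<integral>\<xi>. ?f t x \<xi> \<partial>lborel)" "\<integral>\<xi>. ?g t x \<xi> \<partial>lborel"]
        by (simp only: norm_mult norm_ii mult_1 div_by_1)
      also have "\<dots> \<le> 1 * norm (\<integral>\<xi>. ?f t x \<xi> \<partial>lborel) + norm (\<integral>\<xi>. ?g t x \<xi> \<partial>lborel)"
        using \<delta> by (intro add_right_mono mult_right_mono) auto
      also have "\<dots> \<le> (C2 * K + C1) * (norm x + sqrt t) powr - (?D + 1)"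
        using C1(3)[OF t, of x] C2'[OF t, of x] by (simp only: distrib_right mult_1)
      finally show ?thesis .
    qed
    moreover have "0 \<le> C2 * K + C1" using C1(1) C2(1) by (simp add: K_def)
    ultimately show ?thesis by blast
  qed
  then obtain C where C: "\<And>j k l. 0 \<le> C j k l"
    "\<And>j k l t x. t > 0 \<Longrightarrow> \<bar>oseen_kernel t j k l (x::real^'n)\<bar> \<le> C j k l * (norm x + sqrt t) powr - (?D + 1)"
    by metis
  \<comment> \<open>Summing over the finitely many index triples gives one constant for all of
    them.\<close>
  define C' where "C' = (\<Sum>(j, k, l)\<in>UNIV. C j k l)"
  have le: "C j k l \<le> C'" for j k l
    unfolding C'_def using member_le_sum[of "(j, k, l)" UNIV "\<lambda>(j, k, l). C j k l"] C(1) by auto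
  have "\<bar>oseen_kernel t j k l x\<bar> \<le> C' * (norm x + sqrt t) powr - (?D + 1)" if "t > 0" for t j k l and x :: "real^'n"
    using C(2)[OF that, of j k l x] mult_right_mono[OF le[of j k l], of "(norm x + sqrt t) powr - (?D + 1)"] by simp
  moreover have "0 \<le> C'" unfolding C'_def using C(1) by (auto intro!: sum_nonneg)
  ultimately show ?thesis by blast
qed

text \<open>Trading a factor sqrt t for one more power of decay puts the heat kernel under the Oseen
  majorant, so that its convolution estimate also serves the heat flow.\<close>

lemma heat_kernel_le:
  "\<exists>C\<ge>0. \<forall>t>0. \<forall>x::real^'n. heat_kernel t x \<le> C * (sqrt t * (norm x + sqrt t) powr - (real CARD('n) + 1))"
proof -
  let ?D = "real CARD('n)"
  define C where "C = (4 * pi) powr (- ?D / 2) * exp ((?D + 1)\<^sup>2 / (4 * (1 / 4)))"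
  have "heat_kernel t x \<le> C * (sqrt t * (norm x + sqrt t) powr - (?D + 1))" if t: "t > 0" for t and x :: "real^'n"
  proof -
    have "t powr (- ?D / 2) = sqrt t * t powr (- ((?D + 1) / 2))"
      using t by (simp only: powr_half_sqrt[symmetric] powr_add[symmetric] less_imp_le) (rule arg_cong[where f="(powr) t"], simp add: field_simps)
    then have "heat_kernel t x = (4 * pi) powr (- ?D / 2) * sqrt t * (t powr (- ((?D + 1) / 2)) * exp (- (1/4) * (norm x)\<^sup>2 / t))"
      using t by (simp add: heat_kernel_def powr_mult)
    also have "\<dots> \<le> (4 * pi) powr (- ?D / 2) * sqrt t * (exp ((?D + 1)\<^sup>2 / (4 * (1 / 4))) * (norm x + sqrt t) powr - (?D + 1))"
      using t by (intro mult_left_mono scaled_gaussian_le) auto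
    finally show ?thesis by (simp only: C_def mult_ac)
  qed
  then show ?thesis by (intro exI[of _ C]) (auto simp: C_def)
qed

section \<open>Space-time estimates for the Duhamel majorant\<close>

lemma powr_minus_le_half:
  fixes x y e :: real
  assumes "0 < y" "y / c \<le> x" "0 \<le> e" "0 < c"
  shows "x powr - e \<le> c powr e * y powr - e"
proof -
  have "x powr - e \<le> (y / c) powr - e"
    using assms by (intro powr_mono2') auto
  also have "\<dots> = c powr e * y powr - e"
    using assms by (simp add: powr_divide powr_minus_divide[of c])
  finally show ?thesis .
qed

lemma nn_integral_sqrt_powr:
  fixes q t :: real
  assumes "0 \<le> q" "q < 2" "0 < t"
  shows "(\<integral>\<^sup>+\<tau>. ennreal (sqrt \<tau> powr - q) * indicator {0<..<t} \<tau> \<partial>lborel) \<le> ennreal (sqrt t powr (2 - q) / (1 - q / 2))"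
proof -
  have "((\<lambda>\<tau>. \<tau> powr (- (q / 2))) has_integral (t powr (- (q / 2) + 1) / (- (q / 2) + 1))) {0..t}"
    using assms by (intro has_integral_powr_from_0) auto
  then have "(\<integral>\<^sup>+\<tau>. ennreal (\<tau> powr (- (q / 2))) * indicator {0..t} \<tau> \<partial>lborel) = ennreal (t powr (- (q / 2) + 1) / (- (q / 2) + 1))"
    by (rule nn_integral_has_integral_lebesgue'[rotated]) simp
  also have "t powr (- (q / 2) + 1) = sqrt t powr (2 - q)"
    using assms by (simp add: powr_half_sqrt[symmetric] powr_powr field_simps)
  finally have "(\<integral>\<^sup>+\<tau>. ennreal (\<tau> powr (- (q / 2))) * indicator {0..t} \<tau> \<partial>lborel) = ennreal (sqrt t powr (2 - q) / (1 - q / 2))"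
    by simp
  moreover have "(\<integral>\<^sup>+\<tau>. ennreal (sqrt \<tau> powr - q) * indicator {0<..<t} \<tau> \<partial>lborel)
      \<le> (\<integral>\<^sup>+\<tau>. ennreal (\<tau> powr (- (q / 2))) * indicator {0..t} \<tau> \<partial>lborel)"
    by (intro nn_integral_mono) (auto simp: indicator_def powr_half_sqrt[symmetric] powr_powr)
  ultimately show ?thesis by simp
qed

lemma nn_integral_sqrt_powr_reflect:
  fixes q t :: real
  assumes "0 \<le> q" "q < 2" "0 < t"
  shows "(\<integral>\<^sup>+\<tau>. ennreal (sqrt (t - \<tau>) powr - q) * indicator {0<..<t} \<tau> \<partial>lborel) \<le> ennreal (sqrt t powr (2 - q) / (1 - q / 2))"
proof -
  have "(\<integral>\<^sup>+\<tau>. ennreal (sqrt \<tau> powr - q) * indicator {0<..<t} \<tau> \<partial>lborel)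
      = (\<integral>\<^sup>+\<tau>. ennreal (sqrt (t - \<tau>) powr - q) * indicator {0<..<t} (t - \<tau>) \<partial>lborel)"
    by (subst nn_integral_real_affine[where c="-1" and t=t]) auto
  also have "\<dots> = (\<integral>\<^sup>+\<tau>. ennreal (sqrt (t - \<tau>) powr - q) * indicator {0<..<t} \<tau> \<partial>lborel)"
    by (intro nn_integral_cong) (auto simp: indicator_def)
  finally show ?thesis using nn_integral_sqrt_powr[OF assms] by simp
qed

definition oseen_majorant :: "real \<Rightarrow> 'a::euclidean_space \<Rightarrow> real" where
  "oseen_majorant s z = (norm z + sqrt s) powr - (real DIM('a) + 1)"

text \<open>The Duhamel integral with the kernel replaced by its majorant and the tensor by a scalar
  bound. As an extended nonnegative integral it can be estimated before any convergence is
  known.\<close>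

definition duhamel_majorant :: "(real \<Rightarrow> 'a::euclidean_space \<Rightarrow> real) \<Rightarrow> real \<Rightarrow> 'a \<Rightarrow> ennreal" where
  "duhamel_majorant h t x =
     (\<integral>\<^sup>+\<tau>. (\<integral>\<^sup>+y. ennreal (oseen_majorant (t - \<tau>) (x - y) * h \<tau> y) \<partial>lborel) * indicator {0<..<t} \<tau> \<partial>lborel)"

text \<open>At \<open>x = 0\<close> the value is \<open>0 powr -\<alpha> = 0\<close> instead of infinity, so bounds
  by this weight are only stated for \<open>x \<noteq> 0\<close>.\<close>

definition critical_weight :: "real \<Rightarrow> real \<Rightarrow> 'a::euclidean_space \<Rightarrow> real" where
  "critical_weight \<alpha> t x = norm x powr - \<alpha> * sqrt t powr - (1 - \<alpha>)"

text \<open>For w \<ge> 0, t > 0 and x \<noteq> 0 this is comparable to the smaller of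
  \<open>|x| powr - w\<close> and \<open>t powr (- w / 2)\<close>, so that it encodes decay in space
  and in time at once.\<close>

definition decay_weight :: "real \<Rightarrow> real \<Rightarrow> 'a::euclidean_space \<Rightarrow> real" where
  "decay_weight w t x = (norm x + sqrt t) powr - w"

lemma critical_weight_nonneg [simp]: "0 \<le> critical_weight \<alpha> t x"
  by (simp add: critical_weight_def)

lemma decay_weight_nonneg [simp]: "0 \<le> decay_weight w t x"
  by (simp add: decay_weight_def)

lemma oseen_majorant_nonneg [simp]: "0 \<le> oseen_majorant s z"
  by (simp add: oseen_majorant_def)

text \<open>The constant depends neither on the function h nor on its bound A, which later carries
  the powers of \<tau>. The origin is exempted because \<open>0 powr - a\<close> is 0; one point
  does not affect the integral.\<close>

lemma oseen_majorant_conv_le: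
  fixes a :: real
  assumes "0 \<le> a" "a < real DIM('a::euclidean_space)"
  shows "\<exists>C\<ge>0. \<forall>s>0. \<forall>(x::'a) A h. 0 \<le> A \<longrightarrow> (\<forall>y. y \<noteq> 0 \<longrightarrow> h y \<le> A * norm y powr - a) \<longrightarrow>
     (\<integral>\<^sup>+y. ennreal (oseen_majorant s (x - y) * h y) \<partial>lborel) \<le> ennreal (C * (A * sqrt s powr - 1 * (norm x + sqrt s) powr - a))"
proof -
  obtain C where C: "C \<ge> 0" "\<And>r x. r > 0 \<Longrightarrow> (\<integral>\<^sup>+y. ennreal ((norm (x - y) + r) powr - (real DIM('a) + 1) * norm (y::'a) powr - a) \<partial>lborel)
    \<le> ennreal (C / r * (norm x + r) powr - a)"
    using nn_integral_shifted_norm_powr_conv_le[OF assms] by blast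
  have "(\<integral>\<^sup>+y. ennreal (oseen_majorant s (x - y) * h y) \<partial>lborel) \<le> ennreal (C * (A * sqrt s powr - 1 * (norm x + sqrt s) powr - a))"
    if s: "s > 0" and A: "0 \<le> A" and h: "\<forall>y. y \<noteq> 0 \<longrightarrow> h y \<le> A * norm y powr - a" for s A h and x :: 'a
  proof -
    have "(\<integral>\<^sup>+y. ennreal (oseen_majorant s (x - y) * h y) \<partial>lborel)
       \<le> (\<integral>\<^sup>+y. ennreal A * ennreal ((norm (x - y) + sqrt s) powr - (real DIM('a) + 1) * norm (y::'a) powr - a) \<partial>lborel)"
    proof (rule nn_integral_mono_AE)
      have "AE y in lborel. y \<noteq> (0::'a)" by (rule AE_lborel_singleton)
      then show "AE y in lborel. ennreal (oseen_majorant s (x - y) * h y)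
        \<le> ennreal A * ennreal ((norm (x - y) + sqrt s) powr - (real DIM('a) + 1) * norm y powr - a)"
      proof eventually_elim
        case (elim y)
        have "oseen_majorant s (x - y) * h y \<le> oseen_majorant s (x - y) * (A * norm y powr - a)"
          using h elim by (intro mult_left_mono) auto
        also have "\<dots> = A * ((norm (x - y) + sqrt s) powr - (real DIM('a) + 1) * norm y powr - a)"
          by (simp only: oseen_majorant_def mult_ac)
        finally show ?case using A by (simp only: ennreal_mult[symmetric] ennreal_leI mult_nonneg_nonneg powr_ge_zero)
      qed
    qed
    also have "\<dots> = ennreal A * (\<integral>\<^sup>+y. ennreal ((norm (x - y) + sqrt s) powr - (real DIM('a) + 1) * norm (y::'a) powr - a) \<partial>lborel)"
      by (rule nn_integral_cmult) measurable
    also have "\<dots> \<le> ennreal A * ennreal (C / sqrt s * (norm x + sqrt s) powr - a)"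
      using s by (intro mult_left_mono C) auto
    also have "\<dots> = ennreal (A * (C / sqrt s * (norm x + sqrt s) powr - a))"
      using A C(1) s by (subst ennreal_mult) auto
    also have "A * (C / sqrt s * (norm x + sqrt s) powr - a) = C * (A * sqrt s powr - 1 * (norm x + sqrt s) powr - a)"
      using s by (simp add: powr_minus_divide)
    finally show ?thesis .
  qed
  with C(1) show ?thesis by blast
qed

text \<open>A Beta integral, estimated by halves: t - \<tau> is comparable to t on the first half of
  the interval, \<tau> is on the second. In powers of square roots, integrability at the two ends
  reads p < 2 and q < 2.\<close>

lemma nn_integral_beta_le:
  fixes p q :: real
  assumes p: "0 \<le> p" "p < 2" and q: "0 \<le> q" "q < 2"
  shows "\<exists>C\<ge>0. \<forall>t>0. (\<integral>\<^sup>+\<tau>. ennreal (sqrt (t - \<tau>) powr - p * sqrt \<tau> powr - q) * indicator {0<..<t} \<tau> \<partial>lborel)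
      \<le> ennreal (C * sqrt t powr (2 - p - q))"
proof -
  define C where "C = 2 powr p / (1 - q / 2) + 2 powr q / (1 - p / 2)"
  have "(\<integral>\<^sup>+\<tau>. ennreal (sqrt (t - \<tau>) powr - p * sqrt \<tau> powr - q) * indicator {0<..<t} \<tau> \<partial>lborel)
      \<le> ennreal (C * sqrt t powr (2 - p - q))" if t: "t > 0" for t
  proof -
    let ?A = "2 powr p * sqrt t powr - p" and ?B = "2 powr q * sqrt t powr - q"
    have pt: "sqrt (t - \<tau>) powr - p * sqrt \<tau> powr - q \<le> ?A * sqrt \<tau> powr - q + ?B * sqrt (t - \<tau>) powr - p"
      if \<tau>: "0 < \<tau>" "\<tau> < t" for \<tau>
    proof (cases "\<tau> \<le> t / 2")
      case True
      have "sqrt t / 2 = sqrt (t / 4)" by (simp add: real_sqrt_divide)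
      also have "\<dots> \<le> sqrt (t - \<tau>)" using True \<tau> t by (intro real_sqrt_le_mono) auto
      finally have "sqrt (t - \<tau>) powr - p \<le> ?A" using t p by (intro powr_minus_le_half) auto
      then have "sqrt (t - \<tau>) powr - p * sqrt \<tau> powr - q \<le> ?A * sqrt \<tau> powr - q" by (rule mult_right_mono) simp
      moreover have "0 \<le> ?B * sqrt (t - \<tau>) powr - p" by simp
      ultimately show ?thesis by linarith
    next
      case False
      have "sqrt t / 2 = sqrt (t / 4)" by (simp add: real_sqrt_divide)
      also have "\<dots> \<le> sqrt \<tau>" using False \<tau> t by (intro real_sqrt_le_mono) auto
      finally have "sqrt \<tau> powr - q \<le> ?B" using t q by (intro powr_minus_le_half) auto
      then have "sqrt (t - \<tau>) powr - p * sqrt \<tau> powr - q \<le> sqrt (t - \<tau>) powr - p * ?B" by (rule mult_left_mono) simp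
      moreover have "0 \<le> ?A * sqrt \<tau> powr - q" by simp
      moreover have "sqrt (t - \<tau>) powr - p * ?B = ?B * sqrt (t - \<tau>) powr - p" by (rule mult.commute)
      ultimately show ?thesis by linarith
    qed
    have "(\<integral>\<^sup>+\<tau>. ennreal (sqrt (t - \<tau>) powr - p * sqrt \<tau> powr - q) * indicator {0<..<t} \<tau> \<partial>lborel)
      \<le> (\<integral>\<^sup>+\<tau>. ennreal ?A * (ennreal (sqrt \<tau> powr - q) * indicator {0<..<t} \<tau>)
            + ennreal ?B * (ennreal (sqrt (t - \<tau>) powr - p) * indicator {0<..<t} \<tau>) \<partial>lborel)"
    proof (rule nn_integral_mono)
      fix \<tau>
      show "ennreal (sqrt (t - \<tau>) powr - p * sqrt \<tau> powr - q) * indicator {0<..<t} \<tau>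
        \<le> ennreal ?A * (ennreal (sqrt \<tau> powr - q) * indicator {0<..<t} \<tau>)
            + ennreal ?B * (ennreal (sqrt (t - \<tau>) powr - p) * indicator {0<..<t} \<tau>)"
      proof (cases "\<tau> \<in> {0<..<t}")
        case True
        then show ?thesis using ennreal_leI[OF pt[of \<tau>]]
          by (simp only: indicator_simps mult_1_right greaterThanLessThan_iff ennreal_plus ennreal_mult mult_nonneg_nonneg powr_ge_zero)
      qed simp
    qed
    also have "\<dots> = ennreal ?A * (\<integral>\<^sup>+\<tau>. ennreal (sqrt \<tau> powr - q) * indicator {0<..<t} \<tau> \<partial>lborel)
        + ennreal ?B * (\<integral>\<^sup>+\<tau>. ennreal (sqrt (t - \<tau>) powr - p) * indicator {0<..<t} \<tau> \<partial>lborel)"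
      by (subst nn_integral_add, measurable, subst (1 2) nn_integral_cmult, measurable)
    also have "\<dots> \<le> ennreal ?A * ennreal (sqrt t powr (2 - q) / (1 - q / 2)) + ennreal ?B * ennreal (sqrt t powr (2 - p) / (1 - p / 2))"
      by (intro add_mono mult_left_mono nn_integral_sqrt_powr nn_integral_sqrt_powr_reflect p q t) auto
    also have "\<dots> = ennreal (?A * (sqrt t powr (2 - q) / (1 - q / 2)) + ?B * (sqrt t powr (2 - p) / (1 - p / 2)))"
      using p q by (subst (1 2) ennreal_mult[symmetric]) (auto intro!: ennreal_plus[symmetric] divide_nonneg_nonneg mult_nonneg_nonneg)
    also have "?A * (sqrt t powr (2 - q) / (1 - q / 2)) + ?B * (sqrt t powr (2 - p) / (1 - p / 2))
        = 2 powr p / (1 - q / 2) * (sqrt t powr - p * sqrt t powr (2 - q)) + 2 powr q / (1 - p / 2) * (sqrt t powr - q * sqrt t powr (2 - p))"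
      by simp
    also have "sqrt t powr - p * sqrt t powr (2 - q) = sqrt t powr (2 - p - q)"
      by (simp only: powr_add[symmetric]) (simp add: algebra_simps)
    also have "sqrt t powr - q * sqrt t powr (2 - p) = sqrt t powr (2 - p - q)"
      by (simp only: powr_add[symmetric]) (simp add: algebra_simps)
    finally show ?thesis by (simp only: C_def distrib_right)
  qed
  moreover have "0 \<le> C" using p q by (simp add: C_def)
  ultimately show ?thesis by blast
qed

text \<open>The squared weight contains \<open>|y| powr -(2 * \<alpha>)\<close>, locally integrable
  since 2 \<alpha> < 2 \<le> d. After the convolution half of this decay is kept as
  \<open>|x| powr - \<alpha>\<close> and half is spent on t - \<tau>. The Beta integral then has
  exponents 1 + \<alpha> and 2 (1 - \<alpha>), both below 2.\<close>

lemma duhamel_majorant_critical_le: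
  fixes \<alpha> :: real
  assumes \<alpha>: "0 < \<alpha>" "\<alpha> < 1" and dim: "2 \<le> DIM('a::euclidean_space)"
  shows "\<exists>C\<ge>0. \<forall>t>0. \<forall>x::'a. x \<noteq> 0 \<longrightarrow>
    duhamel_majorant (\<lambda>\<tau> y. critical_weight \<alpha> \<tau> y * critical_weight \<alpha> \<tau> y) t x \<le> ennreal (C * critical_weight \<alpha> t x)"
proof -
  obtain C1 where C1: "0 \<le> C1" "\<And>s (x::'a) A h. s > 0 \<Longrightarrow> 0 \<le> A \<Longrightarrow> \<forall>y. y \<noteq> 0 \<longrightarrow> h y \<le> A * norm y powr - (2 * \<alpha>) \<Longrightarrow>
     (\<integral>\<^sup>+y. ennreal (oseen_majorant s (x - y) * h y) \<partial>lborel) \<le> ennreal (C1 * (A * sqrt s powr - 1 * (norm x + sqrt s) powr - (2 * \<alpha>)))"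
    using oseen_majorant_conv_le[of "2 * \<alpha>", where 'a='a] \<alpha> dim by auto
  obtain C2 where C2: "0 \<le> C2" "\<And>t. t > 0 \<Longrightarrow> (\<integral>\<^sup>+\<tau>. ennreal (sqrt (t - \<tau>) powr - (1 + \<alpha>) * sqrt \<tau> powr - (2 * (1 - \<alpha>))) * indicator {0<..<t} \<tau> \<partial>lborel)
      \<le> ennreal (C2 * sqrt t powr (2 - (1 + \<alpha>) - 2 * (1 - \<alpha>)))"
    using nn_integral_beta_le[of "1 + \<alpha>" "2 * (1 - \<alpha>)"] \<alpha> by auto
  have "duhamel_majorant (\<lambda>\<tau> y. critical_weight \<alpha> \<tau> y * critical_weight \<alpha> \<tau> y) t x \<le> ennreal (C1 * C2 * critical_weight \<alpha> t x)"
    if t: "t > 0" and x: "x \<noteq> 0" for t and x :: 'a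
  proof -
    have inner: "(\<integral>\<^sup>+y. ennreal (oseen_majorant (t - \<tau>) (x - y) * (critical_weight \<alpha> \<tau> y * critical_weight \<alpha> \<tau> y)) \<partial>lborel)
       \<le> ennreal (C1 * norm x powr - \<alpha>) * ennreal (sqrt (t - \<tau>) powr - (1 + \<alpha>) * sqrt \<tau> powr - (2 * (1 - \<alpha>)))"
      if \<tau>: "0 < \<tau>" "\<tau> < t" for \<tau>
    proof -
      let ?A = "sqrt \<tau> powr - (2 * (1 - \<alpha>))" and ?s = "sqrt (t - \<tau>)"
      have s: "0 < ?s" using \<tau> by simp
      have h: "critical_weight \<alpha> \<tau> y * critical_weight \<alpha> \<tau> y = ?A * norm y powr - (2 * \<alpha>)" for y :: 'a
      proof -
        have "norm y powr - (2 * \<alpha>) = norm y powr - \<alpha> * norm y powr - \<alpha>" by (simp only: powr_add[symmetric]) simp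
        moreover have "?A = sqrt \<tau> powr - (1 - \<alpha>) * sqrt \<tau> powr - (1 - \<alpha>)" by (simp only: powr_add[symmetric]) simp
        ultimately show ?thesis by (simp only: critical_weight_def mult_ac)
      qed
      have "(\<integral>\<^sup>+y. ennreal (oseen_majorant (t - \<tau>) (x - y) * (critical_weight \<alpha> \<tau> y * critical_weight \<alpha> \<tau> y)) \<partial>lborel)
         \<le> ennreal (C1 * (?A * ?s powr - 1 * (norm x + ?s) powr - (2 * \<alpha>)))"
        by (rule C1(2)) (use \<tau> in \<open>simp_all add: h\<close>)
      also have "\<dots> \<le> ennreal ((C1 * norm x powr - \<alpha>) * (?s powr - (1 + \<alpha>) * ?A))"
      proof (rule ennreal_leI)
        have "(norm x + ?s) powr - (2 * \<alpha>) = (norm x + ?s) powr - \<alpha> * (norm x + ?s) powr - \<alpha>" by (simp only: powr_add[symmetric]) simp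
        also have "\<dots> \<le> norm x powr - \<alpha> * ?s powr - \<alpha>"
          using s x \<alpha> by (intro mult_mono powr_mono2') auto
        finally have "C1 * (?A * ?s powr - 1 * (norm x + ?s) powr - (2 * \<alpha>)) \<le> C1 * (?A * ?s powr - 1 * (norm x powr - \<alpha> * ?s powr - \<alpha>))"
          using C1(1) by (intro mult_left_mono) auto
        also have "\<dots> = (C1 * norm x powr - \<alpha>) * ((?s powr - 1 * ?s powr - \<alpha>) * ?A)" by (simp only: mult_ac)
        also have "?s powr - 1 * ?s powr - \<alpha> = ?s powr - (1 + \<alpha>)" by (simp only: powr_add[symmetric]) simp
        finally show "C1 * (?A * ?s powr - 1 * (norm x + ?s) powr - (2 * \<alpha>)) \<le> (C1 * norm x powr - \<alpha>) * (?s powr - (1 + \<alpha>) * ?A)" .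
      qed
      also have "\<dots> = ennreal (C1 * norm x powr - \<alpha>) * ennreal (?s powr - (1 + \<alpha>) * ?A)"
        using C1(1) by (intro ennreal_mult) auto
      finally show ?thesis .
    qed
    have "duhamel_majorant (\<lambda>\<tau> y. critical_weight \<alpha> \<tau> y * critical_weight \<alpha> \<tau> y) t x
      \<le> (\<integral>\<^sup>+\<tau>. ennreal (C1 * norm x powr - \<alpha>) * (ennreal (sqrt (t - \<tau>) powr - (1 + \<alpha>) * sqrt \<tau> powr - (2 * (1 - \<alpha>))) * indicator {0<..<t} \<tau>) \<partial>lborel)"
      unfolding duhamel_majorant_def
    proof (rule nn_integral_mono)
      fix \<tau>
      show "(\<integral>\<^sup>+y. ennreal (oseen_majorant (t - \<tau>) (x - y) * (critical_weight \<alpha> \<tau> y * critical_weight \<alpha> \<tau> y)) \<partial>lborel) * indicator {0<..<t} \<tau>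
        \<le> ennreal (C1 * norm x powr - \<alpha>) * (ennreal (sqrt (t - \<tau>) powr - (1 + \<alpha>) * sqrt \<tau> powr - (2 * (1 - \<alpha>))) * indicator {0<..<t} \<tau>)"
      proof (cases "\<tau> \<in> {0<..<t}")
        case True
        then show ?thesis using inner[of \<tau>] by (simp only: indicator_simps mult_1_right greaterThanLessThan_iff)
      qed simp
    qed
    also have "\<dots> = ennreal (C1 * norm x powr - \<alpha>) * (\<integral>\<^sup>+\<tau>. ennreal (sqrt (t - \<tau>) powr - (1 + \<alpha>) * sqrt \<tau> powr - (2 * (1 - \<alpha>))) * indicator {0<..<t} \<tau> \<partial>lborel)"
      by (rule nn_integral_cmult) measurable
    also have "\<dots> \<le> ennreal (C1 * norm x powr - \<alpha>) * ennreal (C2 * sqrt t powr (2 - (1 + \<alpha>) - 2 * (1 - \<alpha>)))"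
      by (intro mult_left_mono C2 t) auto
    also have "\<dots> = ennreal ((C1 * norm x powr - \<alpha>) * (C2 * sqrt t powr (2 - (1 + \<alpha>) - 2 * (1 - \<alpha>))))"
      using C1(1) C2(1) by (intro ennreal_mult[symmetric]) auto
    also have "2 - (1 + \<alpha>) - 2 * (1 - \<alpha>) = - (1 - \<alpha>)" by simp
    also have "(C1 * norm x powr - \<alpha>) * (C2 * sqrt t powr - (1 - \<alpha>)) = C1 * C2 * critical_weight \<alpha> t x"
      by (simp only: critical_weight_def mult_ac)
    finally show ?thesis .
  qed
  then show ?thesis using C1(1) C2(1) by (intro exI[of _ "C1 * C2"]) auto
qed


text \<open>Three regimes. For \<tau> \<le> t/2 the kernel is regular in time and the singularity of
  the weights at \<tau> = 0 has to be integrated. For \<tau> > t/2 and |x| \<le> sqrt t the decay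
  weight is, uniformly in y, at most a multiple of its value at (t, x). For \<tau> > t/2 and |x| >
  sqrt t the decay comes from the convolution. The first regime produces the term with
  \<open>H1\<close>, the other two the term with \<open>H2\<close>.\<close>

lemma duhamel_majorant_decay_le:
  fixes \<alpha> w :: real
  assumes \<alpha>: "0 < \<alpha>" "\<alpha> < 1" and w: "0 \<le> w" "w < real DIM('a::euclidean_space)"
  shows "\<exists>C\<ge>0. \<forall>t>0. \<forall>x::'a.
    duhamel_majorant (\<lambda>\<tau> y. critical_weight \<alpha> \<tau> y * decay_weight w \<tau> y) t x \<le> ennreal (C * decay_weight w t x)"
proof -
  \<comment> \<open>The number of powers of |y| exchanged for powers of sqrt \<tau>; the exponent a
    that remains is max \<alpha> w, below the dimension.\<close>
  define \<kappa> where "\<kappa> = min \<alpha> w"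
  define a where "a = \<alpha> + w - \<kappa>"
  have \<kappa>: "0 \<le> \<kappa>" "\<kappa> \<le> \<alpha>" "\<kappa> \<le> w" using \<alpha> w by (auto simp: \<kappa>_def)
  have \<alpha>d: "\<alpha> < real DIM('a)" using DIM_positive[where 'a='a] \<alpha>(2) by linarith
  then have a: "0 \<le> a" "a < real DIM('a)" "a = w + (\<alpha> - \<kappa>)"
    using \<alpha> w by (auto simp: a_def \<kappa>_def min_def)
  obtain C1 where C1: "0 \<le> C1" "\<And>s (x::'a) A h. s > 0 \<Longrightarrow> 0 \<le> A \<Longrightarrow> \<forall>y. y \<noteq> 0 \<longrightarrow> h y \<le> A * norm y powr - a \<Longrightarrow>
     (\<integral>\<^sup>+y. ennreal (oseen_majorant s (x - y) * h y) \<partial>lborel) \<le> ennreal (C1 * (A * sqrt s powr - 1 * (norm x + sqrt s) powr - a))"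
    using oseen_majorant_conv_le[OF a(1,2)] by auto
  obtain C2 where C2: "0 \<le> C2" "\<And>s (x::'a) A h. s > 0 \<Longrightarrow> 0 \<le> A \<Longrightarrow> \<forall>y. y \<noteq> 0 \<longrightarrow> h y \<le> A * norm y powr - \<alpha> \<Longrightarrow>
     (\<integral>\<^sup>+y. ennreal (oseen_majorant s (x - y) * h y) \<partial>lborel) \<le> ennreal (C2 * (A * sqrt s powr - 1 * (norm x + sqrt s) powr - \<alpha>))"
    using oseen_majorant_conv_le[OF less_imp_le[OF \<alpha>(1)] \<alpha>d] by auto
  define G1 where "G1 = C1 * (2 powr 1 * 2 powr a)"
  define G2 where "G2 = C2 * (4 powr w * 2 powr (1 - \<alpha>)) + C1 * (2 powr (1 - \<alpha>) * 2 powr w)"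
  have G: "0 \<le> G1" "0 \<le> G2" using C1(1) C2(1) by (auto simp: G1_def G2_def)
  \<comment> \<open>The exponent of 1 / sqrt \<tau> in the first regime: 1 - \<alpha> from the
    critical weight and \<kappa> from the exchange, at most 1 in total.\<close>
  define p where "p = 1 - \<alpha> + \<kappa>"
  define N1 where "N1 = 1 / (1 - p / 2)"
  define N2 where "N2 = 1 / (1 - (1 + \<alpha>) / 2)"
  have p: "0 \<le> p" "p < 2" using \<alpha> \<kappa> by (auto simp: p_def)
  have N: "0 \<le> N1" "0 \<le> N2" using p \<alpha> by (auto simp: N1_def N2_def)
  have "duhamel_majorant (\<lambda>\<tau> y. critical_weight \<alpha> \<tau> y * decay_weight w \<tau> y) t x \<le> ennreal ((G1 * N1 + G2 * N2) * decay_weight w t x)"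
    if t: "t > 0" for t and x :: 'a
  proof -
    define T where "T = sqrt t"
    define \<rho> where "\<rho> = norm x + T"
    have T: "0 < T" and \<rho>: "0 < \<rho>" "T \<le> \<rho>" "norm x \<le> \<rho>" using t by (auto simp: T_def \<rho>_def add_nonneg_pos)
    define H1 where "H1 = G1 * (T powr - (1 + \<alpha> - \<kappa>) * \<rho> powr - w)"
    define H2 where "H2 = G2 * (T powr - (1 - \<alpha>) * \<rho> powr - w)"
    have H: "0 \<le> H1" "0 \<le> H2" using G by (auto simp: H1_def H2_def)
    let ?h = "\<lambda>\<tau> y::'a. critical_weight \<alpha> \<tau> y * decay_weight w \<tau> y"
    let ?I = "\<lambda>\<tau>. \<integral>\<^sup>+y. ennreal (oseen_majorant (t - \<tau>) (x - y) * ?h \<tau> y) \<partial>lborel"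
    have inner: "?I \<tau> \<le> ennreal (H1 * sqrt \<tau> powr - p + H2 * sqrt (t - \<tau>) powr - (1 + \<alpha>))"
      if \<tau>: "0 < \<tau>" "\<tau> < t" for \<tau>
    proof -
      define P where "P = sqrt \<tau>"
      define S where "S = sqrt (t - \<tau>)"
      have PS: "0 < P" "0 < S" using \<tau> by (auto simp: P_def S_def)
      \<comment> \<open>Of the decay weight, w - \<kappa> powers are bounded through |y| and
        \<kappa> powers through sqrt \<tau>.\<close>
      have h_a: "?h \<tau> y \<le> (P powr - (1 - \<alpha>) * P powr - \<kappa>) * norm y powr - a" if "y \<noteq> 0" for y
      proof -
        have "(norm y + P) powr - w = (norm y + P) powr - (w - \<kappa>) * (norm y + P) powr - \<kappa>"
          by (simp only: powr_add[symmetric]) simp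
        also have "\<dots> \<le> norm y powr - (w - \<kappa>) * P powr - \<kappa>"
          using that PS \<kappa> by (intro mult_mono powr_mono2') auto
        finally have "?h \<tau> y \<le> (norm y powr - \<alpha> * P powr - (1 - \<alpha>)) * (norm y powr - (w - \<kappa>) * P powr - \<kappa>)"
          unfolding critical_weight_def decay_weight_def P_def[symmetric] by (rule mult_left_mono) simp
        also have "\<dots> = (P powr - (1 - \<alpha>) * P powr - \<kappa>) * (norm y powr - \<alpha> * norm y powr - (w - \<kappa>))"
          by (simp only: mult_ac)
        also have "norm y powr - \<alpha> * norm y powr - (w - \<kappa>) = norm y powr - a"
          by (simp only: powr_add[symmetric] a_def) (simp add: algebra_simps)
        finally show ?thesis .
      qed
      have Ia: "?I \<tau> \<le> ennreal (C1 * ((P powr - (1 - \<alpha>) * P powr - \<kappa>) * S powr - 1 * (norm x + S) powr - a))"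
        unfolding S_def by (rule C1(2)) (use \<tau> h_a in auto)
      show ?thesis
      proof (cases "P \<le> S")
        case True
        \<comment> \<open>In fact t - \<tau> \<ge> t/2; the quarter makes the square root come out
          as T/2.\<close>
        then have "t / 4 \<le> t - \<tau>" using \<tau> by (simp add: P_def S_def)
        then have S: "T / 2 \<le> S" unfolding T_def S_def by (intro real_le_rsqrt) (simp add: power_divide t less_imp_le)
        have "(norm x + S) powr - a \<le> 2 powr a * \<rho> powr - a"
        proof (rule powr_minus_le_half)
          show "\<rho> / 2 \<le> norm x + S" using add_mono[OF _ S, of "norm x / 2" "norm x"] by (simp add: \<rho>_def add_divide_distrib)
        qed (use \<rho> a in auto)
        also have "\<rho> powr - a = \<rho> powr - w * \<rho> powr - (\<alpha> - \<kappa>)"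
          by (simp only: powr_add[symmetric] a) simp
        also have "2 powr a * (\<rho> powr - w * \<rho> powr - (\<alpha> - \<kappa>)) \<le> 2 powr a * (\<rho> powr - w * T powr - (\<alpha> - \<kappa>))"
          using T \<rho> \<kappa> by (intro mult_left_mono powr_mono2') auto
        finally have x_le: "(norm x + S) powr - a \<le> 2 powr a * (\<rho> powr - w * T powr - (\<alpha> - \<kappa>))" .
        have p_eq: "P powr - (1 - \<alpha>) * P powr - \<kappa> = P powr - p"
          by (simp only: powr_add[symmetric] p_def) (simp add: algebra_simps)
        have s_le: "S powr - 1 \<le> 2 powr 1 * T powr - 1"
          by (rule powr_minus_le_half) (use S T in auto)
        have "C1 * ((P powr - (1 - \<alpha>) * P powr - \<kappa>) * S powr - 1 * (norm x + S) powr - a)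
          \<le> C1 * ((P powr - (1 - \<alpha>) * P powr - \<kappa>) * (2 powr 1 * T powr - 1) * (2 powr a * (\<rho> powr - w * T powr - (\<alpha> - \<kappa>))))"
          using C1(1) by (intro mult_left_mono mult_mono x_le s_le) auto
        also have "\<dots> = G1 * ((T powr - 1 * T powr - (\<alpha> - \<kappa>)) * \<rho> powr - w) * (P powr - (1 - \<alpha>) * P powr - \<kappa>)"
          by (simp only: G1_def mult_ac)
        also have "T powr - 1 * T powr - (\<alpha> - \<kappa>) = T powr - (1 + \<alpha> - \<kappa>)"
          by (simp only: powr_add[symmetric]) (simp add: algebra_simps)
        also note p_eq
        also have "G1 * (T powr - (1 + \<alpha> - \<kappa>) * \<rho> powr - w) * P powr - p \<le> H1 * P powr - p + H2 * S powr - (1 + \<alpha>)"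
          using H(2) by (simp add: H1_def)
        finally show ?thesis using Ia unfolding P_def[symmetric] S_def[symmetric] p_eq
          by (meson ennreal_leI order_trans)
      next
        case False
        then have "t / 4 \<le> \<tau>" using \<tau> by (simp add: P_def S_def)
        then have P: "T / 2 \<le> P" unfolding T_def P_def by (intro real_le_rsqrt) (simp add: power_divide t less_imp_le)
        have p_le: "P powr - (1 - \<alpha>) \<le> 2 powr (1 - \<alpha>) * T powr - (1 - \<alpha>)"
          by (rule powr_minus_le_half) (use P T \<alpha> in auto)
        have "?I \<tau> \<le> ennreal (H2 * S powr - (1 + \<alpha>))"
        proof (cases "norm x \<le> T")
          case True
          have h_\<alpha>: "?h \<tau> y \<le> (P powr - (1 - \<alpha>) * P powr - w) * norm y powr - \<alpha>" for y
          proof -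
            have "(norm y + P) powr - w \<le> P powr - w"
              using PS w by (intro powr_mono2') auto
            then have "?h \<tau> y \<le> (norm y powr - \<alpha> * P powr - (1 - \<alpha>)) * P powr - w"
              unfolding critical_weight_def decay_weight_def P_def[symmetric] by (rule mult_left_mono) simp
            then show ?thesis by (simp only: mult_ac)
          qed
          have "?I \<tau> \<le> ennreal (C2 * ((P powr - (1 - \<alpha>) * P powr - w) * S powr - 1 * (norm x + S) powr - \<alpha>))"
            unfolding S_def by (rule C2(2)) (use \<tau> h_\<alpha> in auto)
          also have "\<dots> \<le> ennreal (H2 * S powr - (1 + \<alpha>))"
          proof (rule ennreal_leI)
            \<comment> \<open>Here \<rho> \<le> 2 T \<le> 4 P, whence the base 4.\<close>
            have w_le: "P powr - w \<le> 4 powr w * \<rho> powr - w"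
              by (rule powr_minus_le_half) (use P True \<rho> w in \<open>auto simp: \<rho>_def\<close>)
            have x_le: "(norm x + S) powr - \<alpha> \<le> S powr - \<alpha>"
              using PS \<alpha> by (intro powr_mono2') auto
            have "C2 * ((P powr - (1 - \<alpha>) * P powr - w) * S powr - 1 * (norm x + S) powr - \<alpha>)
              \<le> C2 * (((2 powr (1 - \<alpha>) * T powr - (1 - \<alpha>)) * (4 powr w * \<rho> powr - w)) * S powr - 1 * S powr - \<alpha>)"
              using C2(1) by (intro mult_left_mono mult_mono p_le w_le x_le order_refl) auto
            also have "\<dots> = C2 * (4 powr w * 2 powr (1 - \<alpha>)) * (T powr - (1 - \<alpha>) * \<rho> powr - w) * (S powr - 1 * S powr - \<alpha>)"
              by (simp only: mult_ac)
            also have "S powr - 1 * S powr - \<alpha> = S powr - (1 + \<alpha>)"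
              by (simp only: powr_add[symmetric]) (simp add: algebra_simps)
            also have "C2 * (4 powr w * 2 powr (1 - \<alpha>)) * (T powr - (1 - \<alpha>) * \<rho> powr - w) * S powr - (1 + \<alpha>) \<le> H2 * S powr - (1 + \<alpha>)"
              unfolding H2_def G2_def mult.assoc[symmetric] using C1(1) by (intro mult_right_mono) auto
            finally show "C2 * ((P powr - (1 - \<alpha>) * P powr - w) * S powr - 1 * (norm x + S) powr - \<alpha>) \<le> H2 * S powr - (1 + \<alpha>)" .
          qed
          finally show ?thesis .
        next
          case False
          then have x: "0 < norm x" "\<rho> / 2 \<le> norm x" using T by (auto simp: \<rho>_def)
          have w_le: "norm x powr - w \<le> 2 powr w * \<rho> powr - w"
            by (rule powr_minus_le_half) (use x \<rho> w in auto)
          have "(norm x + S) powr - a = (norm x + S) powr - w * (norm x + S) powr - (\<alpha> - \<kappa>)"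
            by (simp only: powr_add[symmetric] a) simp
          also have "\<dots> \<le> norm x powr - w * S powr - (\<alpha> - \<kappa>)"
            using x PS w \<kappa> by (intro mult_mono powr_mono2') auto
          also have "\<dots> \<le> (2 powr w * \<rho> powr - w) * S powr - (\<alpha> - \<kappa>)"
            by (intro mult_right_mono w_le) auto
          finally have x_le: "(norm x + S) powr - a \<le> (2 powr w * \<rho> powr - w) * S powr - (\<alpha> - \<kappa>)" .
          \<comment> \<open>In this half S < P, so the power -\<kappa> may be moved from P to S,
            where it completes the exponent 1 + \<alpha>.\<close>
          have \<kappa>_le: "P powr - \<kappa> \<le> S powr - \<kappa>" using PS \<kappa> \<open>\<not> P \<le> S\<close> by (intro powr_mono2') auto
          have "C1 * ((P powr - (1 - \<alpha>) * P powr - \<kappa>) * S powr - 1 * (norm x + S) powr - a)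
            \<le> C1 * (((2 powr (1 - \<alpha>) * T powr - (1 - \<alpha>)) * S powr - \<kappa>) * S powr - 1 * ((2 powr w * \<rho> powr - w) * S powr - (\<alpha> - \<kappa>)))"
            using C1(1) by (intro mult_left_mono mult_mono p_le \<kappa>_le x_le order_refl) auto
          also have "\<dots> = C1 * (2 powr (1 - \<alpha>) * 2 powr w) * (T powr - (1 - \<alpha>) * \<rho> powr - w) * (S powr - \<kappa> * (S powr - 1 * S powr - (\<alpha> - \<kappa>)))"
            by (simp only: mult_ac)
          also have "S powr - \<kappa> * (S powr - 1 * S powr - (\<alpha> - \<kappa>)) = S powr - (1 + \<alpha>)"
            by (simp only: powr_add[symmetric]) (simp add: algebra_simps)
          also have "C1 * (2 powr (1 - \<alpha>) * 2 powr w) * (T powr - (1 - \<alpha>) * \<rho> powr - w) * S powr - (1 + \<alpha>) \<le> H2 * S powr - (1 + \<alpha>)"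
            unfolding H2_def G2_def mult.assoc[symmetric] using C2(1) by (intro mult_right_mono) auto
          finally show ?thesis using Ia by (meson ennreal_leI order_trans)
        qed
        also have "\<dots> \<le> ennreal (H1 * P powr - p + H2 * S powr - (1 + \<alpha>))"
          using H(1) by (intro ennreal_leI) simp
        finally show ?thesis unfolding P_def S_def .
      qed
    qed
    have "duhamel_majorant ?h t x
      \<le> (\<integral>\<^sup>+\<tau>. ennreal H1 * (ennreal (sqrt \<tau> powr - p) * indicator {0<..<t} \<tau>)
            + ennreal H2 * (ennreal (sqrt (t - \<tau>) powr - (1 + \<alpha>)) * indicator {0<..<t} \<tau>) \<partial>lborel)"
      unfolding duhamel_majorant_def
    proof (rule nn_integral_mono)
      fix \<tau>
      show "?I \<tau> * indicator {0<..<t} \<tau> \<le> ennreal H1 * (ennreal (sqrt \<tau> powr - p) * indicator {0<..<t} \<tau>)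
            + ennreal H2 * (ennreal (sqrt (t - \<tau>) powr - (1 + \<alpha>)) * indicator {0<..<t} \<tau>)"
      proof (cases "\<tau> \<in> {0<..<t}")
        case True
        then show ?thesis using inner[of \<tau>] H
          by (simp only: indicator_simps mult_1_right greaterThanLessThan_iff ennreal_plus ennreal_mult mult_nonneg_nonneg powr_ge_zero)
      qed simp
    qed
    also have "\<dots> = ennreal H1 * (\<integral>\<^sup>+\<tau>. ennreal (sqrt \<tau> powr - p) * indicator {0<..<t} \<tau> \<partial>lborel)
        + ennreal H2 * (\<integral>\<^sup>+\<tau>. ennreal (sqrt (t - \<tau>) powr - (1 + \<alpha>)) * indicator {0<..<t} \<tau> \<partial>lborel)"
      by (subst nn_integral_add, measurable, subst (1 2) nn_integral_cmult, measurable)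
    also have "\<dots> \<le> ennreal H1 * ennreal (sqrt t powr (2 - p) / (1 - p / 2)) + ennreal H2 * ennreal (sqrt t powr (2 - (1 + \<alpha>)) / (1 - (1 + \<alpha>) / 2))"
      using \<alpha> by (intro add_mono mult_left_mono nn_integral_sqrt_powr nn_integral_sqrt_powr_reflect p t) auto
    also have "\<dots> = ennreal (H1 * (T powr (2 - p) * N1) + H2 * (T powr (2 - (1 + \<alpha>)) * N2))"
      using N H unfolding T_def[symmetric] N1_def N2_def
      by (subst (1 2) ennreal_mult[symmetric]) (auto intro!: ennreal_plus[symmetric] mult_nonneg_nonneg)
    also have "H1 * (T powr (2 - p) * N1) + H2 * (T powr (2 - (1 + \<alpha>)) * N2)
        = G1 * N1 * (T powr - (1 + \<alpha> - \<kappa>) * T powr (2 - p)) * \<rho> powr - w + G2 * N2 * (T powr - (1 - \<alpha>) * T powr (2 - (1 + \<alpha>))) * \<rho> powr - w"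
      by (simp only: H1_def H2_def mult_ac)
    \<comment> \<open>The powers of T cancel, as scaling demands, and only the weight at (t, x)
      remains.\<close>
    also have "T powr - (1 + \<alpha> - \<kappa>) * T powr (2 - p) = 1"
      using T by (simp only: powr_add[symmetric] p_def) simp
    also have "T powr - (1 - \<alpha>) * T powr (2 - (1 + \<alpha>)) = 1"
      using T by (simp only: powr_add[symmetric]) simp
    finally show ?thesis by (simp only: decay_weight_def T_def[symmetric] \<rho>_def[symmetric] mult_1_right distrib_right)
  qed
  moreover have "0 \<le> G1 * N1 + G2 * N2" using G N by simp
  ultimately show ?thesis by blast
qed

section \<open>The Duhamel operator\<close>

lemma borel_measurable_vec_component [measurable]:
  "f \<in> borel_measurable M \<Longrightarrow> (\<lambda>x. f x $ i) \<in> borel_measurable M"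
  for f :: "_ \<Rightarrow> 'b::euclidean_space ^ 'n"
  by (rule measurable_compose[OF _ borel_measurable_continuous_onI]) (auto intro: continuous_intros)

lemma borel_measurable_vec_lambda [measurable]:
  fixes f :: "'n::finite \<Rightarrow> 'a \<Rightarrow> real"
  assumes "\<And>i. f i \<in> borel_measurable M"
  shows "(\<lambda>x. \<chi> i. f i x) \<in> borel_measurable M"
proof (subst borel_measurable_euclidean_space, rule ballI)
  fix b :: "real^'n" assume "b \<in> Basis"
  then obtain i where "b = axis i 1" by (auto simp: Basis_vec_def)
  then have "(\<lambda>x. (\<chi> i. f i x) \<bullet> b) = f i" by (auto simp: fun_eq_iff inner_axis)
  then show "(\<lambda>x. (\<chi> i. f i x) \<bullet> b) \<in> borel_measurable M" using assms by simp
qed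

lemma oseen_symbol_measurable [measurable]:
  assumes [measurable]: "f \<in> borel_measurable M" "g \<in> borel_measurable M"
  shows "(\<lambda>z. oseen_symbol (f z) j k l (g z)) \<in> borel_measurable M"
  unfolding oseen_symbol_def by measurable

text \<open>For Borel integrands the completed measure gives the same integral, and over
  \<open>lborel\<close> an integral with parameters is measurable in these by the product
  structure.\<close>

lemma oseen_kernel_lborel:
  "oseen_kernel t j k l x = Re (\<integral>\<xi>. cis (x \<bullet> \<xi>) * oseen_symbol t j k l \<xi> \<partial>lborel) / (2 * pi) ^ CARD('n)"
  for x :: "real^'n"
proof -
  have "(\<lambda>\<xi>. cis (x \<bullet> \<xi>) * oseen_symbol t j k l \<xi>) \<in> borel_measurable lborel" by measurable
  from integral_completion[OF this] show ?thesis by (simp add: oseen_kernel_def)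
qed

lemma oseen_kernel_measurable [measurable]:
  assumes [measurable]: "f \<in> borel_measurable M" "g \<in> borel_measurable M"
  shows "(\<lambda>z. oseen_kernel (f z) j k l (g z)) \<in> borel_measurable M"
  unfolding oseen_kernel_lborel by measurable

lemma oseen_majorant_measurable [measurable]:
  assumes [measurable]: "f \<in> borel_measurable M" "g \<in> borel_measurable M"
  shows "(\<lambda>z. oseen_majorant (f z) (g z)) \<in> borel_measurable M"
  unfolding oseen_majorant_def by measurable

text \<open>Borel rather than Lebesgue measurability: slices and compositions of Lebesgue measurable
  functions need not be measurable, and the iteration forms both. Lebesgue measurable data enter
  through Borel representatives.\<close>

definition spacetime_borel :: "(real \<Rightarrow> 'a::euclidean_space \<Rightarrow> 'b::euclidean_space) \<Rightarrow> bool" where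
  "spacetime_borel F \<longleftrightarrow> (\<lambda>(t, x). F t x) \<in> borel_measurable (borel \<Otimes>\<^sub>M borel)"

lemma spacetime_borelD:
  assumes "spacetime_borel F" "f \<in> borel_measurable M" "g \<in> borel_measurable M"
  shows "(\<lambda>z. F (f z) (g z)) \<in> borel_measurable M"
  using measurable_compose[OF measurable_Pair[OF assms(2,3)] assms(1)[unfolded spacetime_borel_def]] by simp

lemma borel_measurable_vec2:
  "(\<And>k l. (\<lambda>z. F z $ k $ l) \<in> borel_measurable M) \<Longrightarrow> F \<in> borel_measurable M"
  for F :: "_ \<Rightarrow> real^'m^'n"
proof (subst borel_measurable_euclidean_space, rule ballI)
  fix b :: "real^'m^'n" assume F: "\<And>k l. (\<lambda>z. F z $ k $ l) \<in> borel_measurable M" and "b \<in> Basis"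
  then obtain i j where "b = axis i (axis j 1)" by (auto simp: Basis_vec_def)
  then have "(\<lambda>x. F x \<bullet> b) = (\<lambda>z. F z $ i $ j)" by (auto simp: fun_eq_iff inner_axis)
  then show "(\<lambda>x. F x \<bullet> b) \<in> borel_measurable M" using F by simp
qed

lemma spacetime_borel_tensor:
  assumes u: "spacetime_borel u" and v: "spacetime_borel v"
  shows "spacetime_borel (\<lambda>t x. tensor (u t x) (v t x))"
proof -
  note [measurable] = spacetime_borelD[OF u] spacetime_borelD[OF v]
  show ?thesis
    unfolding spacetime_borel_def split_beta'
    by (rule borel_measurable_vec2) (simp add: tensor_def, measurable)
qed

definition duhamel :: "(real \<Rightarrow> real^'n \<Rightarrow> real^'n^'n) \<Rightarrow> real \<Rightarrow> real^'n \<Rightarrow> real^'n" where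
  "duhamel F t x = (LINT \<tau>:{0<..<t}|lebesgue. oseen (t - \<tau>) (F \<tau>) x)"

lemma oseen_lborel:
  assumes F[measurable]: "F \<in> borel_measurable borel"
  shows "oseen s F x = (\<chi> j. \<Sum>k\<in>UNIV. \<Sum>l\<in>UNIV. \<integral>y. oseen_kernel s j k l (x - y) * F y $ k $ l \<partial>lborel)"
proof -
  have "(\<lambda>y. oseen_kernel s j k l (x - y) * F y $ k $ l) \<in> borel_measurable lborel" for j k l by measurable
  from integral_completion[OF this] show ?thesis by (simp add: oseen_def)
qed

lemma spacetime_borel_slice: "spacetime_borel F \<Longrightarrow> F \<tau> \<in> borel_measurable borel"
  using spacetime_borelD[of F "\<lambda>_. \<tau>" borel "\<lambda>y. y"] by simp

lemma oseen_slice_measurable: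
  assumes F: "spacetime_borel F" and [measurable]: "f \<in> borel_measurable M" "g \<in> borel_measurable M" "h \<in> borel_measurable M"
  shows "(\<lambda>z. oseen (f z) (F (g z)) (h z)) \<in> borel_measurable M"
proof -
  note [measurable] = spacetime_borelD[OF F]
  show ?thesis unfolding oseen_lborel[OF spacetime_borel_slice[OF F]] by measurable
qed

lemma duhamel_lborel:
  assumes F: "spacetime_borel F"
  shows "duhamel F t x = (\<integral>\<tau>. indicator {0<..<t} \<tau> *\<^sub>R oseen (t - \<tau>) (F \<tau>) x \<partial>lborel)"
proof -
  note [measurable] = oseen_slice_measurable[OF F]
  have "(\<lambda>\<tau>. indicator {0<..<t} \<tau> *\<^sub>R oseen (t - \<tau>) (F \<tau>) x) \<in> borel_measurable lborel" by measurable
  from integral_completion[OF this] show ?thesis by (simp add: duhamel_def set_lebesgue_integral_def)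
qed

lemma spacetime_borel_duhamel:
  assumes F: "spacetime_borel F"
  shows "spacetime_borel (duhamel F)"
proof -
  note [measurable] = oseen_slice_measurable[OF F]
  have "(\<lambda>z. \<integral>\<tau>. indicator {0<..<fst z} \<tau> *\<^sub>R oseen (fst z - \<tau>) (F \<tau>) (snd z) \<partial>lborel) \<in> borel_measurable (borel \<Otimes>\<^sub>M borel)"
  proof (rule lborel.borel_measurable_lebesgue_integral)
    \<comment> \<open>The interval moves with t, so its indicator is written as a condition that is
      visibly measurable jointly in t, x and \<tau>.\<close>
    have "(\<lambda>p. (if 0 < snd p \<and> snd p < fst (fst p) then 1 else (0::real)) *\<^sub>R oseen (fst (fst p) - snd p) (F (snd p)) (snd (fst p)))
        \<in> borel_measurable ((borel \<Otimes>\<^sub>M borel) \<Otimes>\<^sub>M lborel)"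
      by measurable
    then show "(\<lambda>(z, \<tau>). indicator {0<..<fst z} \<tau> *\<^sub>R oseen (fst z - \<tau>) (F \<tau>) (snd z))
        \<in> borel_measurable ((borel \<Otimes>\<^sub>M borel) \<Otimes>\<^sub>M lborel)"
      by (simp add: split_beta' indicator_def)
  qed
  then show ?thesis unfolding spacetime_borel_def duhamel_lborel[OF F] split_beta' .
qed

text \<open>Chosen once per dimension, so that later estimates can name the constant instead of
  quantifying over it.\<close>

definition oseen_constant :: "'n::finite itself \<Rightarrow> real" where
  "oseen_constant _ = (SOME C. 0 \<le> C \<and>
     (\<forall>t>0. \<forall>(x::real^'n) j k l. \<bar>oseen_kernel t j k l x\<bar> \<le> C * oseen_majorant t x))"

lemma oseen_constant:
  "0 \<le> oseen_constant TYPE('n::finite)"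
  "0 < t \<Longrightarrow> \<bar>oseen_kernel t j k l (x::real^'n)\<bar> \<le> oseen_constant TYPE('n) * oseen_majorant t x"
proof -
  have "\<exists>C. 0 \<le> C \<and> (\<forall>t>0. \<forall>(x::real^'n) j k l. \<bar>oseen_kernel t j k l x\<bar> \<le> C * oseen_majorant t x)"
    using oseen_kernel_le[where 'n='n] by (simp add: oseen_majorant_def)
  then have *: "0 \<le> oseen_constant TYPE('n) \<and>
      (\<forall>t>0. \<forall>(x::real^'n) j k l. \<bar>oseen_kernel t j k l x\<bar> \<le> oseen_constant TYPE('n) * oseen_majorant t x)"
    unfolding oseen_constant_def by (rule someI_ex)
  then show "0 \<le> oseen_constant TYPE('n)" by (rule conjunct1)
  show "\<bar>oseen_kernel t j k l x\<bar> \<le> oseen_constant TYPE('n) * oseen_majorant t x" if "0 < t"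
    using conjunct2[OF *] that by simp
qed

text \<open>One factor of the dimension per index: j from bounding the Euclidean norm by the sum of
  the components, k and l from the contraction with the tensor. The bracketing follows the nested
  sums.\<close>

definition duhamel_constant :: "'n::finite itself \<Rightarrow> real" where
  "duhamel_constant N = real CARD('n) * (real CARD('n) * (real CARD('n) * oseen_constant N))"

lemma duhamel_constant_nonneg: "0 \<le> duhamel_constant TYPE('n::finite)"
  using oseen_constant(1)[where 'n='n] by (simp add: duhamel_constant_def)

section \<open>Absolute convergence and norm bounds for the Duhamel term\<close>

lemma oseen_component_nn_integral_le:
  fixes F :: "real^'n \<Rightarrow> real^'n^'n"
  assumes s: "s > 0" and F[measurable]: "F \<in> borel_measurable borel" and h[measurable]: "h \<in> borel_measurable borel"
    and Fh: "\<And>y k l. \<bar>F y $ k $ l\<bar> \<le> h y"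
  shows "(\<integral>\<^sup>+y. ennreal (norm (oseen_kernel s j k l (x - y) * F y $ k $ l)) \<partial>lborel)
    \<le> ennreal (oseen_constant TYPE('n)) * (\<integral>\<^sup>+y. ennreal (oseen_majorant s (x - y) * h y) \<partial>lborel)"
proof -
  let ?C = "oseen_constant TYPE('n)"
  have "(\<integral>\<^sup>+y. ennreal (norm (oseen_kernel s j k l (x - y) * F y $ k $ l)) \<partial>lborel)
     \<le> (\<integral>\<^sup>+y. ennreal ?C * ennreal (oseen_majorant s (x - y) * h y) \<partial>lborel)"
  proof (rule nn_integral_mono)
    fix y
    have h0: "0 \<le> h y" using Fh[of y k l] by linarith
    have "norm (oseen_kernel s j k l (x - y) * F y $ k $ l) \<le> (?C * oseen_majorant s (x - y)) * h y"
      unfolding real_norm_def abs_mult using oseen_constant[where 'n='n] s Fh[of y k l] h0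
      by (intro mult_mono) auto
    then show "ennreal (norm (oseen_kernel s j k l (x - y) * F y $ k $ l)) \<le> ennreal ?C * ennreal (oseen_majorant s (x - y) * h y)"
      using oseen_constant(1)[where 'n='n] h0 by (simp only: ennreal_mult[symmetric] oseen_majorant_nonneg mult_nonneg_nonneg ennreal_leI mult.assoc)
  qed
  also have "\<dots> = ennreal ?C * (\<integral>\<^sup>+y. ennreal (oseen_majorant s (x - y) * h y) \<partial>lborel)" by (rule nn_integral_cmult) measurable
  finally show ?thesis .
qed

lemma oseen_component_integrable:
  fixes F :: "real^'n \<Rightarrow> real^'n^'n"
  assumes s: "s > 0" and F[measurable]: "F \<in> borel_measurable borel" and h: "h \<in> borel_measurable borel"
    and Fh: "\<And>y k l. \<bar>F y $ k $ l\<bar> \<le> h y"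
    and fin: "(\<integral>\<^sup>+y. ennreal (oseen_majorant s (x - y) * h y) \<partial>lborel) < \<infinity>"
  shows "integrable lborel (\<lambda>y. oseen_kernel s j k l (x - y) * F y $ k $ l)"
proof (rule integrableI_bounded)
  have "ennreal (oseen_constant TYPE('n)) * (\<integral>\<^sup>+y. ennreal (oseen_majorant s (x - y) * h y) \<partial>lborel) < \<infinity>"
    using fin by (simp add: ennreal_mult_less_top)
  then show "(\<integral>\<^sup>+y. ennreal (norm (oseen_kernel s j k l (x - y) * F y $ k $ l)) \<partial>lborel) < \<infinity>"
    by (rule le_less_trans[OF oseen_component_nn_integral_le[OF s F h Fh]])
qed measurable

lemma oseen_norm_le:
  fixes F :: "real^'n \<Rightarrow> real^'n^'n"
  assumes s: "s > 0" and F: "F \<in> borel_measurable borel" and h: "h \<in> borel_measurable borel"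
    and Fh: "\<And>y k l. \<bar>F y $ k $ l\<bar> \<le> h y"
  shows "ennreal (norm (oseen s F x)) \<le> ennreal (duhamel_constant TYPE('n)) * (\<integral>\<^sup>+y. ennreal (oseen_majorant s (x - y) * h y) \<partial>lborel)"
proof -
  let ?J = "\<integral>\<^sup>+y. ennreal (oseen_majorant s (x - y) * h y) \<partial>lborel"
  let ?c = "\<lambda>j k l y. oseen_kernel s j k l (x - y) * F y $ k $ l"
  \<comment> \<open>No finiteness is assumed: for a non-integrable component the integral is 0 by
    convention and the bound is trivial.\<close>
  have ib: "ennreal (norm (\<integral>y. ?c j k l y \<partial>lborel)) \<le> ennreal (oseen_constant TYPE('n)) * ?J" for j k l
  proof (cases "integrable lborel (?c j k l)")
    case True
    show ?thesis by (rule order_trans[OF integral_norm_bound_ennreal[OF True] oseen_component_nn_integral_le[OF s F h Fh]])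
  qed (simp add: not_integrable_integral_eq)
  have "ennreal (norm (oseen s F x)) \<le> ennreal (\<Sum>j\<in>UNIV. \<Sum>k\<in>UNIV. \<Sum>l\<in>UNIV. norm (\<integral>y. ?c j k l y \<partial>lborel))"
  proof (rule ennreal_leI)
    have "norm (oseen s F x) \<le> (\<Sum>j\<in>UNIV. \<bar>oseen s F x $ j\<bar>)" by (rule norm_le_l1_cart)
    also have "\<dots> \<le> (\<Sum>j\<in>UNIV. \<Sum>k\<in>UNIV. \<Sum>l\<in>UNIV. norm (\<integral>y. ?c j k l y \<partial>lborel))"
    proof (rule sum_mono)
      fix j
      have "\<bar>oseen s F x $ j\<bar> = \<bar>\<Sum>k\<in>UNIV. \<Sum>l\<in>UNIV. \<integral>y. ?c j k l y \<partial>lborel\<bar>"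
        unfolding oseen_lborel[OF F] vec_lambda_beta ..
      also have "\<dots> \<le> (\<Sum>k\<in>UNIV. \<bar>\<Sum>l\<in>UNIV. \<integral>y. ?c j k l y \<partial>lborel\<bar>)" by (rule sum_abs)
      also have "\<dots> \<le> (\<Sum>k\<in>UNIV. \<Sum>l\<in>UNIV. norm (\<integral>y. ?c j k l y \<partial>lborel))"
        unfolding real_norm_def by (intro sum_mono sum_abs)
      finally show "\<bar>oseen s F x $ j\<bar> \<le> (\<Sum>k\<in>UNIV. \<Sum>l\<in>UNIV. norm (\<integral>y. ?c j k l y \<partial>lborel))" .
    qed
    finally show "norm (oseen s F x) \<le> (\<Sum>j\<in>UNIV. \<Sum>k\<in>UNIV. \<Sum>l\<in>UNIV. norm (\<integral>y. ?c j k l y \<partial>lborel))" .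
  qed
  also have "\<dots> = (\<Sum>j\<in>UNIV. \<Sum>k\<in>UNIV. \<Sum>l\<in>UNIV. ennreal (norm (\<integral>y. ?c j k l y \<partial>lborel)))"
    by (simp only: sum_ennreal[symmetric] sum_nonneg norm_ge_zero)
  also have "\<dots> \<le> (\<Sum>j\<in>(UNIV::'n set). \<Sum>k\<in>(UNIV::'n set). \<Sum>l\<in>(UNIV::'n set). ennreal (oseen_constant TYPE('n)) * ?J)"
    by (intro sum_mono ib)
  also have "\<dots> = ennreal (duhamel_constant TYPE('n)) * ?J"
    using oseen_constant(1)[where 'n='n]
    by (simp add: duhamel_constant_def ennreal_mult ennreal_of_nat_eq_real_of_nat mult.assoc)
  finally show ?thesis .
qed

context
  fixes F :: "real \<Rightarrow> real^'n \<Rightarrow> real^'n^'n" and h t x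
  assumes F: "spacetime_borel F" and h: "spacetime_borel h" and Fh: "\<And>\<tau> y k l. \<bar>F \<tau> y $ k $ l\<bar> \<le> h \<tau> y"
    and fin: "duhamel_majorant h t x < \<infinity>"
begin

text \<open>A finite iterated integral of nonnegative functions has a finite inner integral for
  almost every \<tau>, and at such \<tau> the kernel bound gives absolute convergence.\<close>

lemma duhamel_AE_integrable:
  "AE \<tau> in lborel. \<tau> \<in> {0<..<t} \<longrightarrow> (\<forall>j k l. integrable lborel (\<lambda>y. oseen_kernel (t - \<tau>) j k l (x - y) * F \<tau> y $ k $ l))"
proof -
  note [measurable] = spacetime_borelD[OF h]
  let ?J = "\<lambda>\<tau>. \<integral>\<^sup>+y. ennreal (oseen_majorant (t - \<tau>) (x - y) * h \<tau> y) \<partial>lborel"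
  have "?J \<in> borel_measurable lborel" by measurable
  then have "(\<lambda>\<tau>. ?J \<tau> * indicator {0<..<t} \<tau>) \<in> borel_measurable lborel"
    by (rule borel_measurable_times_ennreal) simp
  then have "AE \<tau> in lborel. ?J \<tau> * indicator {0<..<t} \<tau> \<noteq> \<infinity>"
    by (rule nn_integral_PInf_AE) (use fin in \<open>simp add: duhamel_majorant_def\<close>)
  then show ?thesis
  proof eventually_elim
    case (elim \<tau>)
    then have "?J \<tau> < \<infinity>" if "\<tau> \<in> {0<..<t}" using that by (simp add: less_top)
    then show ?case
      using oseen_component_integrable[OF _ spacetime_borel_slice[OF F] spacetime_borel_slice[OF h] Fh, of "t - \<tau>" x \<tau>] by auto
  qed
qed

lemma duhamel_nn_integral_le:
  "(\<integral>\<^sup>+\<tau>. ennreal (norm (indicator {0<..<t} \<tau> *\<^sub>R oseen (t - \<tau>) (F \<tau>) x)) \<partial>lborel)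
     \<le> ennreal (duhamel_constant TYPE('n)) * duhamel_majorant h t x"
proof -
  note [measurable] = spacetime_borelD[OF h]
  let ?J = "\<lambda>\<tau>. \<integral>\<^sup>+y. ennreal (oseen_majorant (t - \<tau>) (x - y) * h \<tau> y) \<partial>lborel"
  have pt: "ennreal (norm (indicator {0<..<t} \<tau> *\<^sub>R oseen (t - \<tau>) (F \<tau>) x)) \<le> ennreal (duhamel_constant TYPE('n)) * (?J \<tau> * indicator {0<..<t} \<tau>)" for \<tau>
  proof (cases "\<tau> \<in> {0<..<t}")
    case True
    then show ?thesis
      using oseen_norm_le[OF _ spacetime_borel_slice[OF F] spacetime_borel_slice[OF h] Fh, of "t - \<tau>" \<tau> x] by simp
  qed simp
  have "?J \<in> borel_measurable lborel" by measurable
  then have "(\<lambda>\<tau>. ?J \<tau> * indicator {0<..<t} \<tau>) \<in> borel_measurable lborel"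
    by (rule borel_measurable_times_ennreal) simp
  note cmult = nn_integral_cmult[OF this]
  have "(\<integral>\<^sup>+\<tau>. ennreal (norm (indicator {0<..<t} \<tau> *\<^sub>R oseen (t - \<tau>) (F \<tau>) x)) \<partial>lborel)
     \<le> (\<integral>\<^sup>+\<tau>. ennreal (duhamel_constant TYPE('n)) * (?J \<tau> * indicator {0<..<t} \<tau>) \<partial>lborel)"
    by (intro nn_integral_mono pt)
  then show ?thesis unfolding duhamel_majorant_def cmult .
qed

lemma duhamel_integrable:
  "integrable lborel (\<lambda>\<tau>. indicator {0<..<t} \<tau> *\<^sub>R oseen (t - \<tau>) (F \<tau>) x)"
proof (rule integrableI_bounded)
  note [measurable] = oseen_slice_measurable[OF F]
  show "(\<lambda>\<tau>. indicator {0<..<t} \<tau> *\<^sub>R oseen (t - \<tau>) (F \<tau>) x) \<in> borel_measurable lborel"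
    by measurable
  have "ennreal (duhamel_constant TYPE('n)) * duhamel_majorant h t x < \<infinity>" using fin by (simp add: ennreal_mult_less_top)
  then show "(\<integral>\<^sup>+\<tau>. ennreal (norm (indicator {0<..<t} \<tau> *\<^sub>R oseen (t - \<tau>) (F \<tau>) x)) \<partial>lborel) < \<infinity>"
    by (rule le_less_trans[OF duhamel_nn_integral_le])
qed

lemma duhamel_norm_le:
  "ennreal (norm (duhamel F t x)) \<le> ennreal (duhamel_constant TYPE('n)) * duhamel_majorant h t x"
  unfolding duhamel_lborel[OF F]
  by (rule order_trans[OF integral_norm_bound_ennreal[OF duhamel_integrable] duhamel_nn_integral_le])

end

text \<open>Integrals that default to 0 are not additive in general. The common majorant makes both
  terms converge at (t, x), in space for almost every \<tau> and then in time.\<close>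

lemma duhamel_diff:
  fixes F G :: "real \<Rightarrow> real^'n \<Rightarrow> real^'n^'n"
  assumes F: "spacetime_borel F" and G: "spacetime_borel G" and h: "spacetime_borel h"
    and Fh: "\<And>\<tau> y k l. \<bar>F \<tau> y $ k $ l\<bar> \<le> h \<tau> y" and Gh: "\<And>\<tau> y k l. \<bar>G \<tau> y $ k $ l\<bar> \<le> h \<tau> y"
    and fin: "duhamel_majorant h t x < \<infinity>"
  shows "duhamel F t x - duhamel G t x = duhamel (\<lambda>\<tau> y. F \<tau> y - G \<tau> y) t x"
proof -
  have FG: "spacetime_borel (\<lambda>\<tau> y. F \<tau> y - G \<tau> y)"
    unfolding spacetime_borel_def split_beta'
    by (rule borel_measurable_diff[OF spacetime_borelD[OF F measurable_fst measurable_snd] spacetime_borelD[OF G measurable_fst measurable_snd]])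
  note iF = duhamel_AE_integrable[OF F h Fh fin] duhamel_integrable[OF F h Fh fin]
  note iG = duhamel_AE_integrable[OF G h Gh fin] duhamel_integrable[OF G h Gh fin]
  note [measurable] = oseen_slice_measurable[OF F] oseen_slice_measurable[OF G] oseen_slice_measurable[OF FG]
  have "duhamel F t x - duhamel G t x
      = (\<integral>\<tau>. indicator {0<..<t} \<tau> *\<^sub>R oseen (t - \<tau>) (F \<tau>) x - indicator {0<..<t} \<tau> *\<^sub>R oseen (t - \<tau>) (G \<tau>) x \<partial>lborel)"
    unfolding duhamel_lborel[OF F] duhamel_lborel[OF G] using iF(2) iG(2) by simp
  also have "\<dots> = (\<integral>\<tau>. indicator {0<..<t} \<tau> *\<^sub>R oseen (t - \<tau>) (\<lambda>y. F \<tau> y - G \<tau> y) x \<partial>lborel)"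
  proof (rule integral_cong_AE)
    show "AE \<tau> in lborel. indicator {0<..<t} \<tau> *\<^sub>R oseen (t - \<tau>) (F \<tau>) x - indicator {0<..<t} \<tau> *\<^sub>R oseen (t - \<tau>) (G \<tau>) x
        = indicator {0<..<t} \<tau> *\<^sub>R oseen (t - \<tau>) (\<lambda>y. F \<tau> y - G \<tau> y) x"
      using iF(1) iG(1)
    proof eventually_elim
      case (elim \<tau>)
      show ?case
      proof (cases "\<tau> \<in> {0<..<t}")
        case True
        then have "integrable lborel (\<lambda>y. oseen_kernel (t - \<tau>) j k l (x - y) * F \<tau> y $ k $ l)"
          "integrable lborel (\<lambda>y. oseen_kernel (t - \<tau>) j k l (x - y) * G \<tau> y $ k $ l)" for j k l
          using elim by auto
        from Bochner_Integration.integral_diff[OF this]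
        have "oseen (t - \<tau>) (F \<tau>) x - oseen (t - \<tau>) (G \<tau>) x = oseen (t - \<tau>) (\<lambda>y. F \<tau> y - G \<tau> y) x"
          unfolding oseen_lborel[OF spacetime_borel_slice[OF F]] oseen_lborel[OF spacetime_borel_slice[OF G]] oseen_lborel[OF spacetime_borel_slice[OF FG]]
          by (simp only: vec_eq_iff vector_minus_component vec_lambda_beta right_diff_distrib sum_subtractf simp_thms)
        with True show ?thesis by simp
      qed simp
    qed
  qed measurable
  finally show ?thesis unfolding duhamel_lborel[OF FG] .
qed

section \<open>Heat flow and Picard iteration\<close>

text \<open>Representatives are chosen for each component; the finitely many exceptional null sets
  combine.\<close>

lemma lebesgue_measurable_ex_borel:
  fixes u :: "real^'n \<Rightarrow> real^'n"
  assumes u: "u \<in> borel_measurable lebesgue"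
  obtains v where "v \<in> borel_measurable borel" "AE x in lebesgue. u x = v x"
proof -
  have "\<exists>g\<in>borel_measurable lborel. AE x in lborel. u x $ i = g x" for i
    by (rule completion_ex_borel_measurable_real) (use u in measurable)
  then obtain g where g: "\<And>i. g i \<in> borel_measurable lborel" "\<And>i. AE x in lborel. u x $ i = g i x"
    by metis
  have "AE x in lborel. \<forall>i. u x $ i = g i x"
    using g(2) by (simp add: AE_all_countable)
  then have "AE x in lborel. u x = (\<chi> i. g i x)" by eventually_elim (simp add: vec_eq_iff)
  from AE_completion[OF this] show thesis
    using g(1) by (intro that[of "\<lambda>x. \<chi> i. g i x"]) (simp_all add: borel_measurable_vec_lambda)
qed

lemma weighted_Linf_AE:
  assumes "u \<in> weighted_Linf w"
  obtains M where "0 \<le> M" "AE x in lebesgue. x \<noteq> 0 \<longrightarrow> norm (u x) \<le> M * norm x powr - w"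
proof -
  let ?e = "esssup lebesgue (\<lambda>x. ereal (wpow (norm x) w * norm (u x)))"
  have "?e < \<infinity>" using assms by (simp add: weighted_Linf_def)
  then obtain M0 where M0: "?e \<le> ereal M0" by (cases ?e) auto
  \<comment> \<open>Truncation at 0 gives a nonnegative bound without a discussion of the sign of
    the essential supremum.\<close>
  define M where "M = max M0 0"
  have "AE x in lebesgue. ereal (wpow (norm x) w * norm (u x)) \<le> ?e" by (rule esssup_AE)
  then have "AE x in lebesgue. x \<noteq> 0 \<longrightarrow> norm (u x) \<le> M * norm x powr - w"
  proof eventually_elim
    case (elim x)
    show ?case
    proof
      assume x: "x \<noteq> 0"
      have "ereal (wpow (norm x) w * norm (u x)) \<le> ereal M0" using elim M0 by (rule order_trans)
      moreover have "wpow (norm x) w = norm x powr w" using x by (simp add: wpow_def)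
      ultimately have "norm x powr w * norm (u x) \<le> M" by (simp add: M_def)
      then have "norm (u x) \<le> M / norm x powr w" using x by (simp add: pos_le_divide_eq mult.commute)
      then show "norm (u x) \<le> M * norm x powr - w" by (simp only: powr_minus divide_inverse)
    qed
  qed
  then show thesis by (intro that[of M]) (auto simp: M_def)
qed

lemma heat_kernel_measurable [measurable]:
  assumes [measurable]: "f \<in> borel_measurable M" "g \<in> borel_measurable M"
  shows "(\<lambda>z. heat_kernel (f z) (g z)) \<in> borel_measurable M"
  unfolding heat_kernel_def by measurable

lemma heat_kernel_nonneg: "0 \<le> heat_kernel t x"
  by (simp add: heat_kernel_def)

text \<open>The heat flow depends on the datum only modulo null sets, so measurability and
  integrability can be read off from a Borel representative.\<close>

lemma heat_borel_representative:
  fixes u v :: "real^'n \<Rightarrow> real^'n"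
  assumes u: "u \<in> borel_measurable lebesgue" and v: "v \<in> borel_measurable borel" and eq: "AE x in lebesgue. u x = v x"
  shows "heat t u x = (\<integral>y. heat_kernel t (x - y) *\<^sub>R v y \<partial>lborel)"
    and "integrable lebesgue (\<lambda>y. heat_kernel t (x - y) *\<^sub>R u y) \<longleftrightarrow> integrable lborel (\<lambda>y. heat_kernel t (x - y) *\<^sub>R v y)"
proof -
  have k: "(\<lambda>y. heat_kernel t (x - y)) \<in> borel_measurable lborel" by measurable
  have kv: "(\<lambda>y. heat_kernel t (x - y) *\<^sub>R v y) \<in> borel_measurable lborel"
    by (rule borel_measurable_scaleR[OF k]) (use v in simp)
  have ku: "(\<lambda>y. heat_kernel t (x - y) *\<^sub>R u y) \<in> borel_measurable lebesgue"
    by (rule borel_measurable_scaleR[OF measurable_completion[OF k] u])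
  have ae: "AE y in lebesgue. heat_kernel t (x - y) *\<^sub>R u y = heat_kernel t (x - y) *\<^sub>R v y"
    using eq by eventually_elim simp
  show "heat t u x = (\<integral>y. heat_kernel t (x - y) *\<^sub>R v y \<partial>lborel)"
    unfolding heat_def integral_completion[OF kv, symmetric]
    by (rule integral_cong_AE[OF ku measurable_completion[OF kv] ae])
  show "integrable lebesgue (\<lambda>y. heat_kernel t (x - y) *\<^sub>R u y) \<longleftrightarrow> integrable lborel (\<lambda>y. heat_kernel t (x - y) *\<^sub>R v y)"
    unfolding integrable_completion[OF kv, symmetric]
    by (rule integrable_cong_AE[OF ku measurable_completion[OF kv] ae])
qed

lemma spacetime_borel_heat:
  fixes u :: "real^'n \<Rightarrow> real^'n"
  assumes u: "u \<in> borel_measurable lebesgue"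
  shows "spacetime_borel (\<lambda>t. heat t u)"
proof -
  obtain v where v: "v \<in> borel_measurable borel" "AE x in lebesgue. u x = v x"
    using lebesgue_measurable_ex_borel[OF u] .
  note [measurable] = v(1)
  show ?thesis
    unfolding spacetime_borel_def split_beta' heat_borel_representative(1)[OF u v] by measurable
qed

text \<open>The factor sqrt t between the heat kernel and the Oseen majorant cancels the 1 / sqrt t
  of the convolution estimate. The bound \<open>|x| powr - w\<close> on the datum, locally
  integrable because w < d, thus becomes one that is finite at x = 0 for every t > 0.\<close>

lemma heat_estimate:
  fixes u :: "real^'n \<Rightarrow> real^'n"
  assumes u: "u \<in> weighted_Linf w" and w: "0 \<le> w" "w < real CARD('n)"
  shows "\<exists>M\<ge>0. \<forall>t>0. \<forall>x. integrable lebesgue (\<lambda>y. heat_kernel t (x - y) *\<^sub>R u y) \<and>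
    norm (heat t u x) \<le> M * decay_weight w t x"
proof -
  have um: "u \<in> borel_measurable lebesgue" using u by (simp add: weighted_Linf_def)
  obtain v where v[measurable]: "v \<in> borel_measurable borel" and uv: "AE x in lebesgue. u x = v x"
    using lebesgue_measurable_ex_borel[OF um] .
  obtain M where M: "0 \<le> M" "AE x in lebesgue. x \<noteq> 0 \<longrightarrow> norm (u x) \<le> M * norm x powr - w"
    using weighted_Linf_AE[OF u] .
  have "AE x in lebesgue. x \<noteq> 0 \<longrightarrow> norm (v x) \<le> M * norm x powr - w"
    using M(2) uv by eventually_elim simp
  then have vM: "AE x in lborel. x \<noteq> 0 \<longrightarrow> norm (v x) \<le> M * norm x powr - w"
    by (simp only: AE_completion_iff)
  obtain C0 where C0: "0 \<le> C0" "\<And>t x. 0 < t \<Longrightarrow> heat_kernel t (x::real^'n) \<le> C0 * (sqrt t * (norm x + sqrt t) powr - (real CARD('n) + 1))"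
    using heat_kernel_le[where 'n='n] by auto
  obtain C1 where C1: "0 \<le> C1" "\<And>s (x::real^'n) A h. s > 0 \<Longrightarrow> 0 \<le> A \<Longrightarrow> \<forall>y. y \<noteq> 0 \<longrightarrow> h y \<le> A * norm y powr - w \<Longrightarrow>
     (\<integral>\<^sup>+y. ennreal (oseen_majorant s (x - y) * h y) \<partial>lborel) \<le> ennreal (C1 * (A * sqrt s powr - 1 * (norm x + sqrt s) powr - w))"
    using oseen_majorant_conv_le[of w, where 'a="real^'n"] w by auto
  have nn: "(\<integral>\<^sup>+y. ennreal (norm (heat_kernel t (x - y) *\<^sub>R v y)) \<partial>lborel) \<le> ennreal (C1 * C0 * M * decay_weight w t x)"
    if t: "0 < t" for t and x :: "real^'n"
  proof -
    have "AE y in lborel. y \<noteq> (0::real^'n)" by (rule AE_lborel_singleton)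
    then have "AE y in lborel. norm (heat_kernel t (x - y) *\<^sub>R v y) \<le> oseen_majorant t (x - y) * (C0 * sqrt t * M * norm y powr - w)"
      using vM
    proof eventually_elim
      case (elim y)
      have "norm (heat_kernel t (x - y) *\<^sub>R v y) = heat_kernel t (x - y) * norm (v y)"
        by (simp add: heat_kernel_nonneg)
      also have "\<dots> \<le> (C0 * (sqrt t * (norm (x - y) + sqrt t) powr - (real CARD('n) + 1))) * (M * norm y powr - w)"
        using elim C0(1) t by (intro mult_mono C0(2)) auto
      also have "\<dots> = oseen_majorant t (x - y) * (C0 * sqrt t * M * norm y powr - w)"
        by (simp add: oseen_majorant_def mult_ac)
      finally show ?case .
    qed
    then have "(\<integral>\<^sup>+y. ennreal (norm (heat_kernel t (x - y) *\<^sub>R v y)) \<partial>lborel)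
       \<le> (\<integral>\<^sup>+y. ennreal (oseen_majorant t (x - y) * (C0 * sqrt t * M * norm y powr - w)) \<partial>lborel)"
      by (intro nn_integral_mono_AE) (auto intro: ennreal_leI elim: eventually_mono)
    also have "\<dots> \<le> ennreal (C1 * ((C0 * sqrt t * M) * sqrt t powr - 1 * (norm x + sqrt t) powr - w))"
      by (rule C1(2)[OF t]) (use C0(1) M(1) t in auto)
    also have "C1 * ((C0 * sqrt t * M) * sqrt t powr - 1 * (norm x + sqrt t) powr - w) = C1 * C0 * M * decay_weight w t x"
      using t by (simp add: decay_weight_def powr_minus_divide)
    finally show ?thesis .
  qed
  have int: "integrable lborel (\<lambda>y. heat_kernel t (x - y) *\<^sub>R v y)" if t: "0 < t" for t and x :: "real^'n"
  proof (rule integrableI_bounded)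
    show "(\<integral>\<^sup>+y. ennreal (norm (heat_kernel t (x - y) *\<^sub>R v y)) \<partial>lborel) < \<infinity>"
      by (rule le_less_trans[OF nn[OF t]]) simp
  qed measurable
  show ?thesis
  proof (intro exI[of _ "C1 * C0 * M"] conjI allI impI)
    show "0 \<le> C1 * C0 * M" using C0(1) C1(1) M(1) by simp
    fix t :: real and x :: "real^'n" assume t: "0 < t"
    show "integrable lebesgue (\<lambda>y. heat_kernel t (x - y) *\<^sub>R u y)"
      using int[OF t] by (simp only: heat_borel_representative(2)[OF um v uv])
    have "ennreal (norm (heat t u x)) \<le> ennreal (C1 * C0 * M * decay_weight w t x)"
      unfolding heat_borel_representative(1)[OF um v uv]
      by (rule order_trans[OF integral_norm_bound_ennreal[OF int[OF t]] nn[OF t]])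
    then show "norm (heat t u x) \<le> C1 * C0 * M * decay_weight w t x"
      using C0(1) C1(1) M(1) by (subst (asm) ennreal_le_iff) auto
  qed
qed

section \<open>Comparison of Duhamel majorants and squares of fields\<close>

lemma spacetime_borel_critical_weight: "spacetime_borel (critical_weight \<alpha>)"
  unfolding spacetime_borel_def critical_weight_def split_beta' by measurable

lemma spacetime_borel_decay_weight: "spacetime_borel (decay_weight w)"
  unfolding spacetime_borel_def decay_weight_def split_beta' by measurable

text \<open>The comparison is asked for only where the weights carry information; the origin in
  space is a null set, and the time integral runs over \<tau> > 0.\<close>

lemma duhamel_majorant_le_cmult:
  assumes g: "spacetime_borel g" and A: "0 \<le> A"
    and le: "\<And>\<tau> y. 0 < \<tau> \<Longrightarrow> y \<noteq> 0 \<Longrightarrow> h \<tau> y \<le> A * g \<tau> y"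
  shows "duhamel_majorant h t x \<le> ennreal A * duhamel_majorant g t x"
proof -
  note [measurable] = spacetime_borelD[OF g]
  let ?H = "\<lambda>\<tau>. \<integral>\<^sup>+y. ennreal (oseen_majorant (t - \<tau>) (x - y) * h \<tau> y) \<partial>lborel"
  let ?G = "\<lambda>\<tau>. \<integral>\<^sup>+y. ennreal (oseen_majorant (t - \<tau>) (x - y) * g \<tau> y) \<partial>lborel"
  have inner: "?H \<tau> \<le> ennreal A * ?G \<tau>" if \<tau>: "0 < \<tau>" for \<tau>
  proof -
    have "AE y in lborel. y \<noteq> (0::'a)" by (rule AE_lborel_singleton)
    then have "?H \<tau> \<le> (\<integral>\<^sup>+y. ennreal A * ennreal (oseen_majorant (t - \<tau>) (x - y) * g \<tau> y) \<partial>lborel)"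
    proof (intro nn_integral_mono_AE, eventually_elim)
      case (elim y)
      have "oseen_majorant (t - \<tau>) (x - y) * h \<tau> y \<le> oseen_majorant (t - \<tau>) (x - y) * (A * g \<tau> y)"
        by (rule mult_left_mono[OF le[OF \<tau> elim(2)]]) simp
      also have "\<dots> = A * (oseen_majorant (t - \<tau>) (x - y) * g \<tau> y)" by (simp only: mult_ac)
      finally show ?case using A by (simp only: ennreal_mult'[symmetric] ennreal_leI)
    qed
    also have "\<dots> = ennreal A * ?G \<tau>" by (rule nn_integral_cmult) measurable
    finally show ?thesis .
  qed
  have "?G \<in> borel_measurable lborel" by measurable
  then have meas: "(\<lambda>\<tau>. ?G \<tau> * indicator {0<..<t} \<tau>) \<in> borel_measurable lborel"
    by (rule borel_measurable_times_ennreal) simp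
  have "duhamel_majorant h t x \<le> (\<integral>\<^sup>+\<tau>. ennreal A * (?G \<tau> * indicator {0<..<t} \<tau>) \<partial>lborel)"
    unfolding duhamel_majorant_def
  proof (rule nn_integral_mono)
    fix \<tau>
    show "?H \<tau> * indicator {0<..<t} \<tau> \<le> ennreal A * (?G \<tau> * indicator {0<..<t} \<tau>)"
      by (cases "\<tau> \<in> {0<..<t}") (use inner in auto)
  qed
  also have "\<dots> = ennreal A * duhamel_majorant g t x"
    unfolding duhamel_majorant_def by (rule nn_integral_cmult[OF meas])
  finally show ?thesis .
qed

definition tensor_square :: "(real \<Rightarrow> real^'n \<Rightarrow> real^'n) \<Rightarrow> real \<Rightarrow> real^'n \<Rightarrow> real^'n^'n" where
  "tensor_square u t x = tensor (u t x) (u t x)"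

lemma spacetime_borel_tensor_square: "spacetime_borel u \<Longrightarrow> spacetime_borel (tensor_square u)"
  unfolding tensor_square_def[abs_def] by (rule spacetime_borel_tensor)

lemma tensor_square_le: "\<bar>tensor_square u t x $ k $ l\<bar> \<le> norm (u t x) * norm (u t x)"
  by (simp add: tensor_square_def tensor_def abs_mult mult_mono component_le_norm_cart)

lemma tensor_square_diff_le:
  "\<bar>(tensor_square u t x - tensor_square v t x) $ k $ l\<bar> \<le> norm (u t x - v t x) * (norm (u t x) + norm (v t x))"
proof -
  let ?a = "u t x" and ?b = "v t x"
  \<comment> \<open>The identity a \<otimes> a - b \<otimes> b = (a - b) \<otimes> a + b \<otimes>
    (a - b), read in components.\<close>
  have "(tensor_square u t x - tensor_square v t x) $ k $ l = (?a - ?b) $ k * ?a $ l + ?b $ k * (?a - ?b) $ l"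
    by (simp add: tensor_square_def tensor_def algebra_simps)
  also have "\<bar>\<dots>\<bar> \<le> \<bar>(?a - ?b) $ k\<bar> * \<bar>?a $ l\<bar> + \<bar>?b $ k\<bar> * \<bar>(?a - ?b) $ l\<bar>"
    by (rule order_trans[OF abs_triangle_ineq]) (simp only: abs_mult)
  also have "\<dots> \<le> norm (?a - ?b) * norm ?a + norm ?b * norm (?a - ?b)"
    by (intro add_mono mult_mono component_le_norm_cart) auto
  finally show ?thesis by (simp add: algebra_simps)
qed


section \<open>Picard iterates and admissible weights\<close>

primrec picard :: "(real \<Rightarrow> real^'n \<Rightarrow> real^'n) \<Rightarrow> nat \<Rightarrow> real \<Rightarrow> real^'n \<Rightarrow> real^'n" where
  "picard L 0 = L"
| "picard L (Suc n) = (\<lambda>t x. L t x - duhamel (tensor_square (picard L n)) t x)"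

text \<open>The property shared by the critical weight and the decay weights: multiplication by the
  critical weight followed by the Duhamel majorant reproduces g up to the factor K. The iteration is
  run once against this property and then specialised.\<close>

definition admissible_weight :: "real \<Rightarrow> real \<Rightarrow> (real \<Rightarrow> 'a::euclidean_space \<Rightarrow> real) \<Rightarrow> bool" where
  "admissible_weight \<alpha> K g \<longleftrightarrow> spacetime_borel g \<and> (\<forall>t x. 0 \<le> g t x) \<and>
     (\<forall>t>0. \<forall>x. x \<noteq> 0 \<longrightarrow>
       duhamel_majorant (\<lambda>\<tau> y. critical_weight \<alpha> \<tau> y * g \<tau> y) t x \<le> ennreal (K * g t x))"

lemma spacetime_borel_mult:
  fixes f g :: "real \<Rightarrow> 'a::euclidean_space \<Rightarrow> real"
  assumes "spacetime_borel f" "spacetime_borel g"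
  shows "spacetime_borel (\<lambda>t x. f t x * g t x)"
  unfolding spacetime_borel_def split_beta'
  by (intro borel_measurable_times spacetime_borelD[OF assms(1)] spacetime_borelD[OF assms(2)] measurable_fst measurable_snd)

lemma spacetime_borel_add:
  fixes f g :: "real \<Rightarrow> 'a::euclidean_space \<Rightarrow> 'b::euclidean_space"
  assumes "spacetime_borel f" "spacetime_borel g"
  shows "spacetime_borel (\<lambda>t x. f t x + g t x)"
  unfolding spacetime_borel_def split_beta'
  by (intro borel_measurable_add spacetime_borelD[OF assms(1)] spacetime_borelD[OF assms(2)] measurable_fst measurable_snd)

lemma spacetime_borel_diff:
  fixes f g :: "real \<Rightarrow> 'a::euclidean_space \<Rightarrow> 'b::euclidean_space"
  assumes "spacetime_borel f" "spacetime_borel g"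
  shows "spacetime_borel (\<lambda>t x. f t x - g t x)"
  unfolding spacetime_borel_def split_beta'
  by (intro borel_measurable_diff spacetime_borelD[OF assms(1)] spacetime_borelD[OF assms(2)] measurable_fst measurable_snd)

lemma spacetime_borel_norm:
  fixes f :: "real \<Rightarrow> 'a::euclidean_space \<Rightarrow> 'b::euclidean_space"
  assumes "spacetime_borel f"
  shows "spacetime_borel (\<lambda>t x. norm (f t x))"
proof -
  note [measurable] = spacetime_borelD[OF assms]
  show ?thesis unfolding spacetime_borel_def split_beta' by measurable
qed

lemma admissible_majorant_le:
  assumes g: "admissible_weight \<alpha> K g" and A: "0 \<le> A" and K: "0 \<le> K"
    and h: "\<And>\<tau> y. 0 < \<tau> \<Longrightarrow> y \<noteq> 0 \<Longrightarrow> h \<tau> y \<le> A * (critical_weight \<alpha> \<tau> y * g \<tau> y)"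
    and t: "0 < t" "x \<noteq> 0"
  shows "duhamel_majorant h t x \<le> ennreal (A * (K * g t x))"
proof -
  have "duhamel_majorant h t x \<le> ennreal A * duhamel_majorant (\<lambda>\<tau> y. critical_weight \<alpha> \<tau> y * g \<tau> y) t x"
    using g unfolding admissible_weight_def
    by (intro duhamel_majorant_le_cmult spacetime_borel_mult spacetime_borel_critical_weight A h) auto
  also have "\<dots> \<le> ennreal A * ennreal (K * g t x)"
    using g t unfolding admissible_weight_def by (intro mult_left_mono) auto
  also have "\<dots> = ennreal (A * (K * g t x))"
    using g A K unfolding admissible_weight_def by (intro ennreal_mult[symmetric]) auto
  finally show ?thesis .
qed

lemma admissible_duhamel_le:
  fixes F :: "real \<Rightarrow> real^'n \<Rightarrow> real^'n^'n"
  assumes g: "admissible_weight \<alpha> K g" and A: "0 \<le> A" and K: "0 \<le> K"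
    and h: "\<And>\<tau> y. 0 < \<tau> \<Longrightarrow> y \<noteq> 0 \<Longrightarrow> h \<tau> y \<le> A * (critical_weight \<alpha> \<tau> y * g \<tau> y)"
    and t: "0 < t" "x \<noteq> 0"
    and F: "spacetime_borel F" "spacetime_borel h" "\<And>\<tau> y k l. \<bar>F \<tau> y $ k $ l\<bar> \<le> h \<tau> y"
  shows "norm (duhamel F t x) \<le> duhamel_constant TYPE('n) * K * A * g t x"
proof -
  have maj: "duhamel_majorant h t x \<le> ennreal (A * (K * g t x))"
    by (rule admissible_majorant_le[OF g A K h t])
  have nn: "0 \<le> A * (K * g t x)" using A K g by (simp add: admissible_weight_def)
  have "ennreal (norm (duhamel F t x)) \<le> ennreal (duhamel_constant TYPE('n)) * duhamel_majorant h t x"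
    by (rule duhamel_norm_le[OF F(1) F(2) F(3)]) (use maj in \<open>auto intro: le_less_trans\<close>)
  also have "\<dots> \<le> ennreal (duhamel_constant TYPE('n)) * ennreal (A * (K * g t x))"
    by (intro mult_left_mono maj) auto
  also have "\<dots> = ennreal (duhamel_constant TYPE('n) * (A * (K * g t x)))"
    by (rule ennreal_mult[symmetric, OF duhamel_constant_nonneg nn])
  finally have "norm (duhamel F t x) \<le> duhamel_constant TYPE('n) * (A * (K * g t x))"
    using mult_nonneg_nonneg[OF duhamel_constant_nonneg[where 'n='n] nn] by (simp only: ennreal_le_iff)
  then show ?thesis by (simp only: mult_ac)
qed

text \<open>At x = 0 the weights give no control of the iterates. The value 0 on this null set makes
  the final supremum, taken over every x, harmless there.\<close>

definition picard_limit :: "(real \<Rightarrow> real^'n \<Rightarrow> real^'n) \<Rightarrow> real \<Rightarrow> real^'n \<Rightarrow> real^'n" where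
  "picard_limit L t x = (if 0 < t \<and> x \<noteq> 0 then lim (\<lambda>n. picard L n t x) else 0)"

context
  fixes L :: "real \<Rightarrow> real^'n \<Rightarrow> real^'n" and \<alpha> K \<delta> :: real
  assumes L: "spacetime_borel L" and K: "0 \<le> K" and \<delta>: "0 \<le> \<delta>"
    and small: "8 * (duhamel_constant TYPE('n) * K) * \<delta> \<le> 1"
    and p: "admissible_weight \<alpha> K (critical_weight \<alpha> :: real \<Rightarrow> real^'n \<Rightarrow> real)"
    and L_le: "\<And>t x. 0 < t \<Longrightarrow> x \<noteq> 0 \<Longrightarrow> norm (L t x) \<le> \<delta> * critical_weight \<alpha> t x"
begin

lemma spacetime_borel_picard: "spacetime_borel (picard L n)"
  by (induction n) (auto intro: L spacetime_borel_diff spacetime_borel_duhamel spacetime_borel_tensor_square)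

text \<open>The number 4 \<delta> a arises from the quadratic term, for instance as 2 \<delta> times
  2 a. The factor 8 in the smallness assumption is chosen to leave a/2.\<close>

lemma contraction:
  assumes "0 \<le> a"
  shows "duhamel_constant TYPE('n) * K * (4 * \<delta> * a) \<le> a / 2"
proof -
  have "duhamel_constant TYPE('n) * K * (4 * \<delta> * a) = (8 * (duhamel_constant TYPE('n) * K) * \<delta>) * (a / 2)"
    by simp
  also have "\<dots> \<le> 1 * (a / 2)" using small assms by (intro mult_right_mono) auto
  finally show ?thesis by simp
qed

text \<open>One factor of the square is measured in the critical weight, where it is small, the
  other in g, where M may be large. Added to a linear part bounded by M g, the result respects the
  bound 2 M g again.\<close>

lemma norm_duhamel_square_le:
  fixes u :: "real \<Rightarrow> real^'n \<Rightarrow> real^'n"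
  assumes u: "spacetime_borel u" and g: "admissible_weight \<alpha> K g" and M: "0 \<le> M"
    and up: "\<And>t x. 0 < t \<Longrightarrow> x \<noteq> 0 \<Longrightarrow> norm (u t x) \<le> 2 * \<delta> * critical_weight \<alpha> t x"
    and ug: "\<And>t x. 0 < t \<Longrightarrow> x \<noteq> 0 \<Longrightarrow> norm (u t x) \<le> 2 * M * g t x"
    and t: "0 < t" "x \<noteq> 0"
  shows "norm (duhamel (tensor_square u) t x) \<le> M * g t x"
proof -
  have g0: "0 \<le> g t x" for t x using g by (simp add: admissible_weight_def)
  have "norm (duhamel (tensor_square u) t x) \<le> duhamel_constant TYPE('n) * K * (4 * \<delta> * M) * g t x"
  proof (rule admissible_duhamel_le[OF g _ K _ t spacetime_borel_tensor_square[OF u] spacetime_borel_mult[OF spacetime_borel_norm[OF u] spacetime_borel_norm[OF u]] tensor_square_le[of u]])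
    fix \<tau> :: real and y :: "real^'n" assume \<tau>: "0 < \<tau>" "y \<noteq> 0"
    have "norm (u \<tau> y) * norm (u \<tau> y) \<le> (2 * \<delta> * critical_weight \<alpha> \<tau> y) * (2 * M * g \<tau> y)"
      using \<delta> by (intro mult_mono up ug \<tau>) auto
    then show "norm (u \<tau> y) * norm (u \<tau> y) \<le> 4 * \<delta> * M * (critical_weight \<alpha> \<tau> y * g \<tau> y)"
      by (simp add: mult_ac)
  qed (use \<delta> M in auto)
  also have "\<dots> \<le> M / 2 * g t x" by (rule mult_right_mono[OF contraction[OF M] g0])
  also have "\<dots> \<le> M * g t x" using M g0[of t x] by (intro mult_right_mono) auto
  finally show ?thesis .
qed

lemma picard_le_critical:
  "0 < t \<Longrightarrow> x \<noteq> 0 \<Longrightarrow> norm (picard L n t x) \<le> 2 * \<delta> * critical_weight \<alpha> t x"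
proof (induction n arbitrary: t x)
  case 0
  have "\<delta> * critical_weight \<alpha> t x \<le> 2 * \<delta> * critical_weight \<alpha> t x" using \<delta> by (intro mult_right_mono) auto
  then show ?case using L_le[OF 0] by simp
next
  case (Suc n)
  have "norm (duhamel (tensor_square (picard L n)) t x) \<le> \<delta> * critical_weight \<alpha> t x"
    \<comment> \<open>The case in which g is the critical weight itself and M = \<delta>, so that
      both bounds on the iterate coincide.\<close>
    by (rule norm_duhamel_square_le[OF spacetime_borel_picard p \<delta> Suc.IH Suc.IH Suc.prems])
  then show ?case
    using L_le[OF Suc.prems] norm_triangle_ineq4[of "L t x" "duhamel (tensor_square (picard L n)) t x"] by simp
qed

lemma picard_le_weight:
  assumes g: "admissible_weight \<alpha> K g" and M: "0 \<le> M"
    and Lg: "\<And>t x. 0 < t \<Longrightarrow> x \<noteq> 0 \<Longrightarrow> norm (L t x) \<le> M * g t x"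
  shows "0 < t \<Longrightarrow> x \<noteq> 0 \<Longrightarrow> norm (picard L n t x) \<le> 2 * M * g t x"
proof (induction n arbitrary: t x)
  case 0
  have "M * g t x \<le> 2 * M * g t x" using M g by (intro mult_right_mono) (auto simp: admissible_weight_def)
  then show ?case using Lg[OF 0] by simp
next
  case (Suc n)
  have "norm (duhamel (tensor_square (picard L n)) t x) \<le> M * g t x"
    by (rule norm_duhamel_square_le[OF spacetime_borel_picard g M picard_le_critical Suc.IH Suc.prems])
  then show ?case
    using Lg[OF Suc.prems] norm_triangle_ineq4[of "L t x" "duhamel (tensor_square (picard L n)) t x"] by simp
qed

text \<open>Contraction with ratio 1/2 in the critical weight. D stays free because the estimate is
  applied to consecutive iterates and also to an iterate and the limit.\<close>

lemma norm_duhamel_square_diff_le: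
  fixes u v :: "real \<Rightarrow> real^'n \<Rightarrow> real^'n"
  assumes u: "spacetime_borel u" and v: "spacetime_borel v" and D: "0 \<le> D"
    and up: "\<And>t x. 0 < t \<Longrightarrow> x \<noteq> 0 \<Longrightarrow> norm (u t x) \<le> 2 * \<delta> * critical_weight \<alpha> t x"
    and vp: "\<And>t x. 0 < t \<Longrightarrow> x \<noteq> 0 \<Longrightarrow> norm (v t x) \<le> 2 * \<delta> * critical_weight \<alpha> t x"
    and uv: "\<And>t x. 0 < t \<Longrightarrow> x \<noteq> 0 \<Longrightarrow> norm (u t x - v t x) \<le> D * critical_weight \<alpha> t x"
    and t: "0 < t" "x \<noteq> 0"
  shows "norm (duhamel (tensor_square u) t x - duhamel (tensor_square v) t x) \<le> D / 2 * critical_weight \<alpha> t x"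
proof -
  let ?p = "critical_weight \<alpha> :: real \<Rightarrow> real^'n \<Rightarrow> real"
  note bu = spacetime_borel_norm[OF u] and bv = spacetime_borel_norm[OF v] and bd = spacetime_borel_norm[OF spacetime_borel_diff[OF u v]]
  \<comment> \<open>A crude common majorant that shows both Duhamel terms to converge, so that they
    may be subtracted; the sharp bound then comes from the difference of the tensors.\<close>
  let ?h = "\<lambda>\<tau> y. norm (u \<tau> y) * norm (u \<tau> y) + norm (v \<tau> y) * norm (v \<tau> y)"
  have h: "spacetime_borel ?h" by (intro spacetime_borel_add spacetime_borel_mult bu bv)
  have "duhamel_majorant ?h t x \<le> ennreal (8 * \<delta> * \<delta> * (K * ?p t x))"
  proof (rule admissible_majorant_le[OF p _ K _ t])
    fix \<tau> :: real and y :: "real^'n" assume \<tau>: "0 < \<tau>" "y \<noteq> 0"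
    have "?h \<tau> y \<le> (2 * \<delta> * ?p \<tau> y) * (2 * \<delta> * ?p \<tau> y) + (2 * \<delta> * ?p \<tau> y) * (2 * \<delta> * ?p \<tau> y)"
      using \<delta> by (intro add_mono mult_mono up vp \<tau>) auto
    then show "?h \<tau> y \<le> 8 * \<delta> * \<delta> * (?p \<tau> y * ?p \<tau> y)" by (simp add: mult_ac)
  qed (use \<delta> in auto)
  then have "duhamel_majorant ?h t x < \<infinity>" by (rule le_less_trans) simp
  then have "duhamel (tensor_square u) t x - duhamel (tensor_square v) t x = duhamel (\<lambda>\<tau> y. tensor_square u \<tau> y - tensor_square v \<tau> y) t x"
  proof (rule duhamel_diff[OF spacetime_borel_tensor_square[OF u] spacetime_borel_tensor_square[OF v] h, rotated 2])
    fix \<tau> y k l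
    have "0 \<le> norm (u \<tau> y) * norm (u \<tau> y)" "0 \<le> norm (v \<tau> y) * norm (v \<tau> y)" by simp_all
    then show "\<bar>tensor_square u \<tau> y $ k $ l\<bar> \<le> ?h \<tau> y" "\<bar>tensor_square v \<tau> y $ k $ l\<bar> \<le> ?h \<tau> y"
      using tensor_square_le[of u \<tau> y k l] tensor_square_le[of v \<tau> y k l] by linarith+
  qed
  also have "norm \<dots> \<le> duhamel_constant TYPE('n) * K * (4 * \<delta> * D) * ?p t x"
  proof (rule admissible_duhamel_le[OF p _ K _ t _ _ tensor_square_diff_le[where u=u and v=v]])
    fix \<tau> :: real and y :: "real^'n" assume \<tau>: "0 < \<tau>" "y \<noteq> 0"
    have "norm (u \<tau> y - v \<tau> y) * (norm (u \<tau> y) + norm (v \<tau> y))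
        \<le> (D * ?p \<tau> y) * (2 * \<delta> * ?p \<tau> y + 2 * \<delta> * ?p \<tau> y)"
      using D by (intro mult_mono add_mono up vp uv \<tau>) auto
    then show "norm (u \<tau> y - v \<tau> y) * (norm (u \<tau> y) + norm (v \<tau> y)) \<le> 4 * \<delta> * D * (?p \<tau> y * ?p \<tau> y)"
      by (simp add: mult_ac)
  next
    show "0 \<le> 4 * \<delta> * D" using \<delta> D by simp
  qed (intro spacetime_borel_diff spacetime_borel_tensor_square spacetime_borel_mult spacetime_borel_add u v bu bv bd)+
  also have "\<dots> \<le> D / 2 * ?p t x" by (rule mult_right_mono[OF contraction[OF D]]) simp
  finally show ?thesis .
qed

lemma picard_step_le:
  "0 < t \<Longrightarrow> x \<noteq> 0 \<Longrightarrow> norm (picard L (Suc n) t x - picard L n t x) \<le> \<delta> / 2 ^ n * critical_weight \<alpha> t x"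
proof (induction n arbitrary: t x)
  case 0
  have "norm (duhamel (tensor_square L) t x) \<le> \<delta> * critical_weight \<alpha> t x"
    using norm_duhamel_square_le[OF spacetime_borel_picard[of 0] p \<delta> picard_le_critical picard_le_critical 0] by simp
  then show ?case by simp
next
  case (Suc n)
  have "norm (duhamel (tensor_square (picard L (Suc n))) t x - duhamel (tensor_square (picard L n)) t x)
      \<le> \<delta> / 2 ^ n / 2 * critical_weight \<alpha> t x"
    by (rule norm_duhamel_square_diff_le[OF spacetime_borel_picard spacetime_borel_picard _ picard_le_critical picard_le_critical Suc.IH Suc.prems])
      (use \<delta> in auto)
  then show ?case by (simp add: norm_minus_commute mult.commute)
qed

text \<open>The exact partial sum of the geometric series stands on the right, because the bound
  without the subtracted term would not pass through the induction on k.\<close>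

lemma picard_tail_le:
  assumes t: "0 < t" "x \<noteq> 0"
  shows "norm (picard L (n + k) t x - picard L n t x) \<le> 2 * \<delta> * (1 / 2 ^ n - 1 / 2 ^ (n + k)) * critical_weight \<alpha> t x"
proof (induction k)
  case (Suc k)
  have "norm (picard L (n + Suc k) t x - picard L n t x)
      \<le> norm (picard L (Suc (n + k)) t x - picard L (n + k) t x) + norm (picard L (n + k) t x - picard L n t x)"
    using norm_triangle_ineq[of "picard L (Suc (n + k)) t x - picard L (n + k) t x" "picard L (n + k) t x - picard L n t x"]
    by (simp del: picard.simps)
  also have "\<dots> \<le> \<delta> / 2 ^ (n + k) * critical_weight \<alpha> t x + 2 * \<delta> * (1 / 2 ^ n - 1 / 2 ^ (n + k)) * critical_weight \<alpha> t x"
    by (rule add_mono[OF picard_step_le[OF t] Suc.IH])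
  also have "\<dots> = 2 * \<delta> * (1 / 2 ^ n - 1 / 2 ^ (n + Suc k)) * critical_weight \<alpha> t x"
    by (simp add: algebra_simps)
  finally show ?case .
qed simp

lemma spacetime_borel_picard_limit: "spacetime_borel (picard_limit L)"
proof -
  have "(\<lambda>z. lim (\<lambda>n. picard L n (fst z) (snd z))) \<in> borel_measurable (borel \<Otimes>\<^sub>M borel)"
    by (intro borel_measurable_lim_metric spacetime_borelD[OF spacetime_borel_picard] measurable_fst measurable_snd)
  then show ?thesis
    unfolding spacetime_borel_def picard_limit_def split_beta' by (intro measurable_If) (simp_all, measurable)
qed

lemma picard_tail_le':
  assumes t: "0 < t" "x \<noteq> 0" and nm: "n \<le> m"
  shows "norm (picard L m t x - picard L n t x) \<le> 2 * \<delta> / 2 ^ n * critical_weight \<alpha> t x"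
proof -
  have "norm (picard L (n + (m - n)) t x - picard L n t x) \<le> 2 * \<delta> * (1 / 2 ^ n - 1 / 2 ^ (n + (m - n))) * critical_weight \<alpha> t x"
    by (rule picard_tail_le[OF t])
  also have "\<dots> \<le> 2 * \<delta> * (1 / 2 ^ n) * critical_weight \<alpha> t x"
    using \<delta> by (intro mult_right_mono mult_left_mono) auto
  finally show ?thesis using nm by simp
qed

lemma picard_LIMSEQ:
  assumes t: "0 < t" "x \<noteq> 0"
  shows "(\<lambda>n. picard L n t x) \<longlonglongrightarrow> picard_limit L t x"
proof -
  let ?e = "\<lambda>n. 2 * \<delta> / 2 ^ n * critical_weight \<alpha> t x"
  have e: "?e \<longlonglongrightarrow> 0"
    by (rule tendsto_eq_rhs[OF tendsto_mult_right[OF LIMSEQ_divide_realpow_zero]]) auto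
  have "Cauchy (\<lambda>n. picard L n t x)"
  proof (rule CauchyI')
    fix r :: real assume "0 < r"
    then obtain N where N: "\<And>n. n \<ge> N \<Longrightarrow> ?e n < r"
      using order_tendstoD(2)[OF e] by (auto simp: eventually_sequentially)
    show "\<exists>M. \<forall>m\<ge>M. \<forall>n>m. dist (picard L m t x) (picard L n t x) < r"
    proof (intro exI[of _ N] allI impI)
      fix m n assume "N \<le> m" "m < n"
      then show "dist (picard L m t x) (picard L n t x) < r"
        unfolding dist_norm
        using picard_tail_le'[OF t less_imp_le[OF \<open>m < n\<close>]] N[OF \<open>N \<le> m\<close>]
          norm_minus_commute[of "picard L m t x" "picard L n t x"] by linarith
    qed
  qed
  then show ?thesis using t by (simp add: picard_limit_def Cauchy_convergent_iff convergent_LIMSEQ_iff)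
qed

lemma picard_limit_le_critical:
  assumes t: "0 < t" "x \<noteq> 0"
  shows "norm (picard_limit L t x) \<le> 2 * \<delta> * critical_weight \<alpha> t x"
  by (rule LIMSEQ_le_const2[OF tendsto_norm[OF picard_LIMSEQ[OF t]]]) (use picard_le_critical[OF t] in blast)

lemma picard_limit_le_weight:
  assumes g: "admissible_weight \<alpha> K g" and M: "0 \<le> M"
    and Lg: "\<And>t x. 0 < t \<Longrightarrow> x \<noteq> 0 \<Longrightarrow> norm (L t x) \<le> M * g t x"
    and t: "0 < t" "x \<noteq> 0"
  shows "norm (picard_limit L t x) \<le> 2 * M * g t x"
  by (rule LIMSEQ_le_const2[OF tendsto_norm[OF picard_LIMSEQ[OF t]]]) (use picard_le_weight[OF g M Lg t] in blast)

lemma picard_limit_rate: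
  assumes t: "0 < t" "x \<noteq> 0"
  shows "norm (picard_limit L t x - picard L n t x) \<le> 2 * \<delta> / 2 ^ n * critical_weight \<alpha> t x"
  by (rule LIMSEQ_le_const2[OF tendsto_norm[OF tendsto_diff[OF picard_LIMSEQ[OF t] tendsto_const]]])
    (use picard_tail_le'[OF t] in blast)

text \<open>Passing to the limit in the recursion needs continuity of the Duhamel term along the
  iterates. This is the difference estimate with \<open>D = 2 * \<delta> / 2 ^ n\<close>, the rate
  at which the iterates approach the limit.\<close>

lemma picard_limit_fixed_point:
  assumes t: "0 < t" "x \<noteq> 0"
  shows "picard_limit L t x = L t x - duhamel (tensor_square (picard_limit L)) t x"
proof -
  have "(\<lambda>n. duhamel (tensor_square (picard L n)) t x - duhamel (tensor_square (picard_limit L)) t x) \<longlonglongrightarrow> 0"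
  proof (rule Lim_null_comparison)
    have "norm (duhamel (tensor_square (picard L n)) t x - duhamel (tensor_square (picard_limit L)) t x)
        \<le> 2 * \<delta> / 2 ^ n / 2 * critical_weight \<alpha> t x" for n
    proof (rule norm_duhamel_square_diff_le[OF spacetime_borel_picard spacetime_borel_picard_limit _ picard_le_critical picard_limit_le_critical _ t])
      fix \<tau> :: real and y :: "real^'n" assume "0 < \<tau>" "y \<noteq> 0"
      then show "norm (picard L n \<tau> y - picard_limit L \<tau> y) \<le> 2 * \<delta> / 2 ^ n * critical_weight \<alpha> \<tau> y"
        by (subst norm_minus_commute) (rule picard_limit_rate)
    qed (use \<delta> in auto)
    then show "\<forall>\<^sub>F n in sequentially. norm (duhamel (tensor_square (picard L n)) t x - duhamel (tensor_square (picard_limit L)) t x)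
        \<le> \<delta> / 2 ^ n * critical_weight \<alpha> t x" by simp
    show "(\<lambda>n. \<delta> / 2 ^ n * critical_weight \<alpha> t x) \<longlonglongrightarrow> 0"
      by (rule tendsto_eq_rhs[OF tendsto_mult_right[OF LIMSEQ_divide_realpow_zero]]) auto
  qed
  from tendsto_diff[OF tendsto_const[of "L t x"] LIM_zero_cancel[OF this]]
  have "(\<lambda>n. picard L (Suc n) t x) \<longlonglongrightarrow> L t x - duhamel (tensor_square (picard_limit L)) t x" by simp
  moreover have "(\<lambda>n. picard L (Suc n) t x) \<longlonglongrightarrow> picard_limit L t x"
    by (rule LIMSEQ_Suc[OF picard_LIMSEQ[OF t]])
  ultimately show ?thesis by (rule LIMSEQ_unique[rotated])
qed

lemma picard_limit_majorant_finite:
  assumes t: "0 < t" "x \<noteq> 0"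
  shows "duhamel_majorant (\<lambda>\<tau> y. norm (picard_limit L \<tau> y) * norm (picard_limit L \<tau> y)) t x < \<infinity>"
proof (rule le_less_trans)
  show "duhamel_majorant (\<lambda>\<tau> y. norm (picard_limit L \<tau> y) * norm (picard_limit L \<tau> y)) t x
      \<le> ennreal (4 * \<delta> * \<delta> * (K * critical_weight \<alpha> t x))"
  proof (rule admissible_majorant_le[OF p _ K _ t])
    fix \<tau> :: real and y :: "real^'n" assume \<tau>: "0 < \<tau>" "y \<noteq> 0"
    have "norm (picard_limit L \<tau> y) * norm (picard_limit L \<tau> y) \<le> (2 * \<delta> * critical_weight \<alpha> \<tau> y) * (2 * \<delta> * critical_weight \<alpha> \<tau> y)"
      using \<delta> by (intro mult_mono picard_limit_le_critical \<tau>) auto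
    then show "norm (picard_limit L \<tau> y) * norm (picard_limit L \<tau> y) \<le> 4 * \<delta> * \<delta> * (critical_weight \<alpha> \<tau> y * critical_weight \<alpha> \<tau> y)"
      by (simp add: mult_ac)
  qed (use \<delta> in auto)
qed simp

text \<open>The fixed point identity holds at every x \<noteq> 0, hence almost everywhere; what
  remains is the transfer of measurability and integrability from the Borel setting to the completed
  measure of the definition.\<close>

lemma picard_limit_mild:
  assumes heat: "\<And>t. 0 < t \<Longrightarrow> L t = heat t u0"
    and int: "\<And>t x. 0 < t \<Longrightarrow> integrable lebesgue (\<lambda>y. heat_kernel t (x - y) *\<^sub>R u0 y)"
  shows "global_mild_solution u0 (picard_limit L)"
  unfolding global_mild_solution_def
proof (intro conjI allI impI)
  have "(\<lambda>(t, x). picard_limit L t x) \<in> borel_measurable lborel"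
    using spacetime_borel_picard_limit unfolding spacetime_borel_def by (simp add: borel_prod)
  from measurable_restrict_space1[OF measurable_completion[OF this]]
  show "(\<lambda>(t, x). picard_limit L t x) \<in> borel_measurable (lebesgue_on ({0<..} \<times> UNIV))" .
next
  fix t :: real assume t: "0 < t"
  let ?F = "tensor_square (picard_limit L)"
  note F = spacetime_borel_tensor_square[OF spacetime_borel_picard_limit]
  note h = spacetime_borel_mult[OF spacetime_borel_norm[OF spacetime_borel_picard_limit] spacetime_borel_norm[OF spacetime_borel_picard_limit]]
  have F_eq: "(\<lambda>y. tensor (picard_limit L \<tau> y) (picard_limit L \<tau> y)) = ?F \<tau>" for \<tau>
    by (simp add: tensor_square_def fun_eq_iff)
  have "AE x in lebesgue. x \<noteq> (0::real^'n)" by (rule AE_completion[OF AE_lborel_singleton])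
  then show "AE x in lebesgue.
       integrable lebesgue (\<lambda>y. heat_kernel t (x - y) *\<^sub>R u0 y) \<and>
       (AE \<tau> in lebesgue. \<tau> \<in> {0<..<t} \<longrightarrow>
          oseen_converges (t - \<tau>) (\<lambda>y. tensor (picard_limit L \<tau> y) (picard_limit L \<tau> y)) x) \<and>
       set_integrable lebesgue {0<..<t} (\<lambda>\<tau>. oseen (t - \<tau>) (\<lambda>y. tensor (picard_limit L \<tau> y) (picard_limit L \<tau> y)) x) \<and>
       picard_limit L t x = heat t u0 x -
         (LINT \<tau>:{0<..<t}|lebesgue. oseen (t - \<tau>) (\<lambda>y. tensor (picard_limit L \<tau> y) (picard_limit L \<tau> y)) x)"
    unfolding F_eq
  proof eventually_elim
    case (elim x)
    note fin = picard_limit_majorant_finite[OF t elim]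
    have "AE \<tau> in lborel. \<tau> \<in> {0<..<t} \<longrightarrow> oseen_converges (t - \<tau>) (?F \<tau>) x"
      using duhamel_AE_integrable[OF F h tensor_square_le fin]
    proof eventually_elim
      case (elim \<tau>)
      have "(\<lambda>y. oseen_kernel (t - \<tau>) j k l (x - y) * ?F \<tau> y $ k $ l) \<in> borel_measurable lborel" for j k l
      proof -
        note [measurable] = spacetime_borelD[OF F]
        show ?thesis by measurable
      qed
      with elim show ?case by (simp add: oseen_converges_def integrable_completion)
    qed
    from AE_completion[OF this] have "AE \<tau> in lebesgue. \<tau> \<in> {0<..<t} \<longrightarrow> oseen_converges (t - \<tau>) (?F \<tau>) x" .
    moreover have "set_integrable lebesgue {0<..<t} (\<lambda>\<tau>. oseen (t - \<tau>) (?F \<tau>) x)"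
    proof -
      note i = duhamel_integrable[OF F h tensor_square_le fin]
      show ?thesis unfolding set_integrable_def
        by (rule iffD2[OF integrable_completion[OF borel_measurable_integrable[OF i]] i])
    qed
    moreover have "picard_limit L t x = heat t u0 x - (LINT \<tau>:{0<..<t}|lebesgue. oseen (t - \<tau>) (?F \<tau>) x)"
      using picard_limit_fixed_point[OF t elim] unfolding heat[OF t] duhamel_def .
    ultimately show ?case using int[OF t] by blast
  qed
qed

end


section \<open>Weighted bounds and assembly of the theorem\<close>

lemma powr_weights_le:
  assumes t: "0 < t" and x: "x \<noteq> 0" and w: "0 \<le> w" and M: "0 \<le> M"
    and u: "norm v \<le> M * decay_weight w t x"
  shows "(wpow (norm x) w + t powr (w / 2)) * norm v \<le> 2 * M"
proof -
  let ?r = "norm x + sqrt t"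
  have r: "0 < ?r" using t by (simp add: add_nonneg_pos)
  have "wpow (norm x) w = norm x powr w" using x by (simp add: wpow_def)
  \<comment> \<open>Both |x| and sqrt t lie below |x| + sqrt t; the two summands account for the
    factor 2.\<close>
  moreover have "norm x powr w \<le> ?r powr w" using t w by (intro powr_mono2) auto
  moreover have "t powr (w / 2) = sqrt t powr w" using t by (simp add: powr_half_sqrt[symmetric] powr_powr)
  moreover have "sqrt t powr w \<le> ?r powr w" using t w by (intro powr_mono2) auto
  ultimately have "(wpow (norm x) w + t powr (w / 2)) * norm v \<le> (2 * ?r powr w) * (M * ?r powr - w)"
    using u unfolding decay_weight_def by (intro mult_mono) auto
  also have "\<dots> = 2 * M * (?r powr w * ?r powr - w)" by (simp only: mult_ac)
  also have "?r powr w * ?r powr - w = 1" using r by (simp only: powr_add[symmetric]) simp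
  finally show ?thesis by simp
qed

theorem theorem2:
  fixes \<gamma> \<beta> \<gamma>' \<alpha> \<beta>' :: real
  assumes dim: "CARD('n::finite) \<ge> 2"
    and "0 \<le> \<gamma>" "\<gamma> \<le> 1" "1 \<le> \<beta>" "\<beta> < real CARD('n)"
    and "0 \<le> \<gamma>'" "\<gamma>' \<le> \<gamma>"
    and "\<beta>' \<ge> 0" "\<beta> - 2 < \<beta>'" "\<beta>' \<le> \<beta>"
    and "0 < \<alpha>" "\<alpha> < 1" "\<beta> - \<beta>' - 1 < \<alpha>" "\<alpha> < real CARD('n) - \<beta>'"
  shows "\<exists>\<delta>>0. \<forall>u0 :: real^'n \<Rightarrow> real^'n.
    u0 \<in> weighted_Linf \<gamma> \<inter> weighted_Linf \<beta> \<longrightarrow>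
    divergence_free u0 \<longrightarrow>
    (SUP x. SUP t\<in>{0<..}. ereal
       ((wpow (norm x) \<gamma>' * t powr ((\<gamma> - \<gamma>') / 2)
         + wpow (norm x) \<alpha> * t powr ((1 - \<alpha>) / 2)
         + wpow (norm x) \<beta>' * t powr ((\<beta> - \<beta>') / 2)) * norm (heat t u0 x))) \<le> ereal \<delta> \<longrightarrow>
    (\<exists>u. global_mild_solution u0 u \<and>
       (SUP x. SUP t\<in>{0<..}. ereal
          ((wpow (norm x) \<gamma> + t powr (\<gamma> / 2) + wpow (norm x) \<beta> + t powr (\<beta> / 2))
            * norm (u t x))) < \<infinity>)"
proof -
  let ?p = "critical_weight \<alpha> :: real \<Rightarrow> real^'n \<Rightarrow> real"
  let ?q = "\<lambda>w. decay_weight w :: real \<Rightarrow> real^'n \<Rightarrow> real"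
  have \<gamma>: "\<gamma> < real CARD('n)" using dim \<open>\<gamma> \<le> 1\<close> by linarith
  have \<beta>0: "0 \<le> \<beta>" using \<open>1 \<le> \<beta>\<close> by simp
  obtain K1 where K1: "0 \<le> K1" "\<And>t (x::real^'n). 0 < t \<Longrightarrow> x \<noteq> 0 \<Longrightarrow>
      duhamel_majorant (\<lambda>\<tau> y. ?p \<tau> y * ?p \<tau> y) t x \<le> ennreal (K1 * ?p t x)"
    using duhamel_majorant_critical_le[of \<alpha>, where 'a="real^'n"] \<open>0 < \<alpha>\<close> \<open>\<alpha> < 1\<close> dim by auto
  have decay: "\<exists>C\<ge>0. \<forall>t>0. \<forall>x::real^'n. duhamel_majorant (\<lambda>\<tau> y. ?p \<tau> y * ?q w \<tau> y) t x \<le> ennreal (C * ?q w t x)"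
    if "0 \<le> w" "w < real CARD('n)" for w
    by (rule duhamel_majorant_decay_le) (use that \<open>0 < \<alpha>\<close> \<open>\<alpha> < 1\<close> in auto)
  obtain K2 where K2: "0 \<le> K2" "\<And>t (x::real^'n). 0 < t \<Longrightarrow>
      duhamel_majorant (\<lambda>\<tau> y. ?p \<tau> y * ?q \<gamma> \<tau> y) t x \<le> ennreal (K2 * ?q \<gamma> t x)"
    using decay[OF \<open>0 \<le> \<gamma>\<close> \<gamma>] by auto
  obtain K3 where K3: "0 \<le> K3" "\<And>t (x::real^'n). 0 < t \<Longrightarrow>
      duhamel_majorant (\<lambda>\<tau> y. ?p \<tau> y * ?q \<beta> \<tau> y) t x \<le> ennreal (K3 * ?q \<beta> t x)"
    using decay[OF \<beta>0 \<open>\<beta> < real CARD('n)\<close>] by auto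
  \<comment> \<open>One constant for the three weights used, since each separate bound survives an
    enlargement of its constant.\<close>
  define K where "K = K1 + K2 + K3"
  have K: "0 \<le> K" "K1 \<le> K" "K2 \<le> K" "K3 \<le> K" using K1(1) K2(1) K3(1) by (auto simp: K_def)
  have enl: "A \<le> ennreal (K * c)" if "A \<le> ennreal (k * c)" "k \<le> K" "0 \<le> c" for A k c
    using that(1) by (rule order_trans) (intro ennreal_leI mult_right_mono that)
  have adm_p: "admissible_weight \<alpha> K ?p"
    unfolding admissible_weight_def using K(2) by (auto intro: spacetime_borel_critical_weight enl[OF K1(2)])
  have adm_\<gamma>: "admissible_weight \<alpha> K (?q \<gamma>)"
    unfolding admissible_weight_def using K(3) by (auto intro: spacetime_borel_decay_weight enl[OF K2(2)])
  have adm_\<beta>: "admissible_weight \<alpha> K (?q \<beta>)"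
    unfolding admissible_weight_def using K(4) by (auto intro: spacetime_borel_decay_weight enl[OF K3(2)])
  define D where "D = duhamel_constant TYPE('n) * K"
  \<comment> \<open>The summand 1 keeps the denominator positive when D = 0, and 8 D \<delta> \<le>
    1 is the smallness that the iteration asks for. K and D are fixed before the datum, so \<delta>
    depends only on the parameters.\<close>
  define \<delta> where "\<delta> = 1 / (8 * D + 1)"
  have D: "0 \<le> D" using duhamel_constant_nonneg[where 'n='n] K(1) by (simp add: D_def)
  then have \<delta>: "0 < \<delta>" "8 * D * \<delta> \<le> 1" by (auto simp: \<delta>_def pos_divide_le_eq add_nonneg_pos)
  have small: "8 * (duhamel_constant TYPE('n) * K) * \<delta> \<le> 1" using \<delta>(2) by (simp add: D_def)
  show ?thesis
  proof (intro exI[of _ \<delta>] conjI \<delta>(1) allI impI)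
    fix u0 :: "real^'n \<Rightarrow> real^'n"
    assume u0: "u0 \<in> weighted_Linf \<gamma> \<inter> weighted_Linf \<beta>"
      and sup: "(SUP x. SUP t\<in>{0<..}. ereal
       ((wpow (norm x) \<gamma>' * t powr ((\<gamma> - \<gamma>') / 2)
         + wpow (norm x) \<alpha> * t powr ((1 - \<alpha>) / 2)
         + wpow (norm x) \<beta>' * t powr ((\<beta> - \<beta>') / 2)) * norm (heat t u0 x))) \<le> ereal \<delta>"
    define L where "L t = heat t u0" for t
    obtain M1 where M1: "0 \<le> M1" "\<And>t x. 0 < t \<Longrightarrow> integrable lebesgue (\<lambda>y. heat_kernel t (x - y) *\<^sub>R u0 y)"
      "\<And>t x. 0 < t \<Longrightarrow> norm (heat t u0 x) \<le> M1 * decay_weight \<gamma> t x"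
      using heat_estimate[OF IntD1[OF u0] \<open>0 \<le> \<gamma>\<close> \<gamma>] by auto
    obtain M2 where M2: "0 \<le> M2" "\<And>t x. 0 < t \<Longrightarrow> integrable lebesgue (\<lambda>y. heat_kernel t (x - y) *\<^sub>R u0 y)"
      "\<And>t x. 0 < t \<Longrightarrow> norm (heat t u0 x) \<le> M2 * decay_weight \<beta> t x"
      using heat_estimate[OF IntD2[OF u0] \<beta>0 \<open>\<beta> < real CARD('n)\<close>] by auto
    have Lb: "spacetime_borel L"
      unfolding L_def by (rule spacetime_borel_heat) (use u0 in \<open>simp add: weighted_Linf_def\<close>)
    have Lp: "norm (L t x) \<le> \<delta> * critical_weight \<alpha> t x" if t: "0 < t" "x \<noteq> 0" for t x
    proof -
      let ?W = "wpow (norm x) \<gamma>' * t powr ((\<gamma> - \<gamma>') / 2) + wpow (norm x) \<alpha> * t powr ((1 - \<alpha>) / 2)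
         + wpow (norm x) \<beta>' * t powr ((\<beta> - \<beta>') / 2)"
      have "ereal (?W * norm (heat t u0 x)) \<le> ereal \<delta>"
        by (rule order_trans[OF _ sup]) (use t in \<open>auto intro!: SUP_upper2[of x] SUP_upper2[of t]\<close>)
      then have W: "?W * norm (L t x) \<le> \<delta>" by (simp add: L_def)
      have w0: "0 \<le> wpow (norm x) b" for b by (simp add: wpow_def)
      \<comment> \<open>The summand with \<alpha> is compared with the whole weight, the other
        summands being nonnegative; dividing by it gives the bound in the critical weight.\<close>
      have "norm x powr \<alpha> * sqrt t powr (1 - \<alpha>) = wpow (norm x) \<alpha> * t powr ((1 - \<alpha>) / 2)"
        using t \<open>0 < \<alpha>\<close> by (simp add: wpow_def powr_half_sqrt[symmetric] powr_powr)
      also have "\<dots> \<le> ?W" using w0 by (simp add: add_nonneg_nonneg)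
      finally have "norm x powr \<alpha> * sqrt t powr (1 - \<alpha>) * norm (L t x) \<le> ?W * norm (L t x)"
        by (rule mult_right_mono) simp
      then have "norm (L t x) * (norm x powr \<alpha> * sqrt t powr (1 - \<alpha>)) \<le> \<delta>" using W by (simp only: mult.commute)
      moreover have "0 < norm x powr \<alpha> * sqrt t powr (1 - \<alpha>)" using t by simp
      ultimately have "norm (L t x) \<le> \<delta> / (norm x powr \<alpha> * sqrt t powr (1 - \<alpha>))" by (simp only: pos_le_divide_eq)
      then show ?thesis by (simp only: critical_weight_def powr_minus divide_inverse inverse_mult_distrib)
    qed
    define u where "u = picard_limit L"
    have mild: "global_mild_solution u0 u"
      unfolding u_def by (rule picard_limit_mild[OF Lb K(1) less_imp_le[OF \<delta>(1)] small adm_p Lp L_def M1(2)])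
    have u\<gamma>: "norm (u t x) \<le> 2 * M1 * ?q \<gamma> t x" if "0 < t" "x \<noteq> 0" for t x
      unfolding u_def using M1(3) that
      by (intro picard_limit_le_weight[OF Lb K(1) less_imp_le[OF \<delta>(1)] small adm_p Lp adm_\<gamma> M1(1)]) (auto simp: L_def)
    have u\<beta>: "norm (u t x) \<le> 2 * M2 * ?q \<beta> t x" if "0 < t" "x \<noteq> 0" for t x
      unfolding u_def using M2(3) that
      by (intro picard_limit_le_weight[OF Lb K(1) less_imp_le[OF \<delta>(1)] small adm_p Lp adm_\<beta> M2(1)]) (auto simp: L_def)
    have bound: "(wpow (norm x) \<gamma> + t powr (\<gamma> / 2) + wpow (norm x) \<beta> + t powr (\<beta> / 2)) * norm (u t x) \<le> 4 * M1 + 4 * M2"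
      if t: "0 < t" for t and x :: "real^'n"
    \<comment> \<open>At x = 0 the limit is 0 by definition. Elsewhere the four weights are grouped
      into the pair for \<gamma> and the pair for \<beta>.\<close>
    proof (cases "x = 0")
      case True
      then have "u t x = 0"
        by (simp add: u_def picard_limit_def)
      then show ?thesis using M1(1) M2(1) by simp
    next
      case False
      have "(wpow (norm x) \<gamma> + t powr (\<gamma> / 2)) * norm (u t x) \<le> 2 * (2 * M1)"
        by (rule powr_weights_le[OF t False \<open>0 \<le> \<gamma>\<close> _ u\<gamma>[OF t False]]) (use M1(1) in simp)
      moreover have "(wpow (norm x) \<beta> + t powr (\<beta> / 2)) * norm (u t x) \<le> 2 * (2 * M2)"
        by (rule powr_weights_le[OF t False \<beta>0 _ u\<beta>[OF t False]]) (use M2(1) in simp)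
      ultimately show ?thesis by (simp add: algebra_simps)
    qed
    have "(SUP x. SUP t\<in>{0<..}. ereal
          ((wpow (norm x) \<gamma> + t powr (\<gamma> / 2) + wpow (norm x) \<beta> + t powr (\<beta> / 2))
            * norm (u t x))) \<le> ereal (4 * M1 + 4 * M2)"
      by (intro SUP_least) (use bound in auto)
    then have "(SUP x. SUP t\<in>{0<..}. ereal
          ((wpow (norm x) \<gamma> + t powr (\<gamma> / 2) + wpow (norm x) \<beta> + t powr (\<beta> / 2))
            * norm (u t x))) < \<infinity>"
      by (rule le_less_trans) simp
    with mild show "\<exists>u. global_mild_solution u0 u \<and>
       (SUP x. SUP t\<in>{0<..}. ereal
          ((wpow (norm x) \<gamma> + t powr (\<gamma> / 2) + wpow (norm x) \<beta> + t powr (\<beta> / 2))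
            * norm (u t x))) < \<infinity>" by blast
  qed
qed

end
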